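(* Let $(M,d)$ be a complete metric space. The Lipschitz-free space $\mathcal F(M)$ over $M$ is isometric to $\ell_1(\Gamma)$ if and only if $M$ is of density $|\Gamma|$ and $M$ is a negligible subset of an $\mathbb R$-tree $T$ such that $M$ contains all the branching points of $T$.
   Context: Here $\Gamma$ is a set, $|\Gamma|$ is its cardinality, and $\ell_1(\Gamma)$ is the real Banach space of absolutely summable families indexed by $\Gamma$. The density of a metric space is the least cardinality of a dense subset. For a metric space $(M,d)$ with a distinguished point $0\in M$, $\mathrm{Lip}_0(M)$ is the Banach space of Lipschitz functions $f:M\to\mathbb R$ with $f(0)=0$, with norm $\|f\|_L=\sup\{\frac{f(x)-f(y)}{d(x,y)}:x\neq y\}$. The Lipschitz-free space $\mathcal F(M)$ is the norm-closed linear span of $\{\delta_x:x\in M\}$ in $\mathrm{Lip}_0(M)^*$, where $\delta_x(f)=f(x)$. Changing the distinguished point changes $\mathcal F(M)$ only up to isometry. An $\mathbb R$-tree is a geodesic metric space $(T,d)$ satisfying the 4-point condition: $d(a,b)+d(c,e)\le\max\{d(a,c)+d(b,e),\,d(b,c)+d(a,e)\}$ for all $a,b,c,e\in T$. Being a subset of an $\mathbb R$-tree is understood up to isometry. For $x,y\in T$ let $\phi_{x,y}:[0,d(x,y)]\to T$ be the unique isometric embedding with $\phi_{x,y}(0)=x$ and $\phi_{x,y}(d(x,y))=y$; the segment $[x,y]$ is its range. A point $b\in T$ is a branching point of $T$ if there are three distinct points $x,y,z\in T\setminus\{b\}$ with $[x,b]\cap[y,b]=[x,b]\cap[z,b]=[y,b]\cap[z,b]=\{b\}$.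 Measure: a set $A\subset T$ is measurable if $\phi_{x,y}^{-1}(A)$ is Lebesgue measurable for all $x,y\in T$. For a segment $S=[x,y]$ and measurable $A$ put $\lambda_S(A)=\lambda(\phi_{x,y}^{-1}(A))$ with $\lambda$ Lebesgue measure on $\mathbb R$; for a finite disjoint union $R=\bigcup_{k=1}^r S_k$ of segments put $\lambda_R(A)=\sum_{k=1}^r\lambda_{S_k}(A)$; and $\lambda_T(A)=\sup_R\lambda_R(A)$ over all such $R$. For a subset $M$ of an $\mathbb R$-tree $T$, $\mathrm{conv}(M)=\bigcup\{[x,y]:x,y\in M\}$ is the minimal $\mathbb R$-tree containing $M$ (unique up to isometry), $\lambda(M):=\lambda_{\mathrm{conv}(M)}(M)$, and $M$ is called negligible if $\lambda(M)=0$.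
   Formalization: For finite M the condition "M is of density |Γ|" is replaced by |M| = |Γ| + 1, since the literal claim fails there (a two-point M has density 2 but its free space is ℝ = ℓ_1 of one point); for infinite M the statement is literal. *)

theory Defs
  imports "HOL-Analysis.Analysis" "HOL-Library.Equipollence"
begin

section \<open>Linear isometry and \<open>\<ell>\<^sub>1(\<Gamma>)\<close>\<close>

text \<open>The normed spaces below depend on a set and a metric given as terms, so they are represented
  by a carrier set of real functions, closed under the pointwise operations, with an explicit norm.\<close>

definition linearly_isometric ::
  "('i \<Rightarrow> real) set \<Rightarrow> (('i \<Rightarrow> real) \<Rightarrow> real) \<Rightarrow> ('j \<Rightarrow> real) set \<Rightarrow> (('j \<Rightarrow> real) \<Rightarrow> real) \<Rightarrow> bool"
  where
  "linearly_isometric X nX Y nY \<longleftrightarrow>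
     (\<exists>V. bij_betw V X Y \<and>
          (\<forall>u\<in>X. \<forall>v\<in>X. V (\<lambda>i. u i + v i) = (\<lambda>j. V u j + V v j)) \<and>
          (\<forall>c. \<forall>u\<in>X. V (\<lambda>i. c * u i) = (\<lambda>j. c * V u j)) \<and>
          (\<forall>u\<in>X. nY (V u) = nX u))"

definition ell1 :: "'g set \<Rightarrow> ('g \<Rightarrow> real) set" where
  "ell1 \<Gamma> = {u. (\<forall>i. i \<notin> \<Gamma> \<longrightarrow> u i = 0) \<and> (\<lambda>i. \<bar>u i\<bar>) summable_on \<Gamma>}"

definition ell1_norm :: "'g set \<Rightarrow> ('g \<Rightarrow> real) \<Rightarrow> real" where
  "ell1_norm \<Gamma> u = (\<Sum>\<^sub>\<infinity>i\<in>\<Gamma>. \<bar>u i\<bar>)"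


section \<open>Density\<close>

definition has_density :: "'a set \<Rightarrow> ('a \<Rightarrow> 'a \<Rightarrow> real) \<Rightarrow> 'g set \<Rightarrow> bool" where
  "has_density M d \<Gamma> \<longleftrightarrow>
     (\<exists>A\<subseteq>M. Metric_space.mtopology M d closure_of A = M \<and> A \<approx> \<Gamma>) \<and>
     (\<forall>A\<subseteq>M. Metric_space.mtopology M d closure_of A = M \<longrightarrow> \<Gamma> \<lesssim> A)"


section \<open>Lipschitz-free spaces\<close>

text \<open>Functions on \<open>M\<close> are extended by \<open>0\<close> outside \<open>M\<close>, and functionals on \<open>lip0 M d z\<close>
  by \<open>0\<close> outside \<open>lip0 M d z\<close>, so that equality of elements is equality of functions.\<close>

definition lip0 :: "'a set \<Rightarrow> ('a \<Rightarrow> 'a \<Rightarrow> real) \<Rightarrow> 'a \<Rightarrow> ('a \<Rightarrow> real) set" where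
  "lip0 M d z = {f. f z = 0 \<and> (\<forall>x. x \<notin> M \<longrightarrow> f x = 0) \<and>
                    (\<exists>L. \<forall>x\<in>M. \<forall>y\<in>M. \<bar>f x - f y\<bar> \<le> L * d x y)}"

text \<open>Inserting \<open>0\<close> matters only when \<open>M\<close> is a singleton, where the set of slopes is empty.\<close>

definition lip_norm :: "'a set \<Rightarrow> ('a \<Rightarrow> 'a \<Rightarrow> real) \<Rightarrow> ('a \<Rightarrow> real) \<Rightarrow> real" where
  "lip_norm M d f = Sup (insert 0 {(f x - f y) / d x y | x y. x \<in> M \<and> y \<in> M \<and> x \<noteq> y})"

definition lip0_dual ::
  "'a set \<Rightarrow> ('a \<Rightarrow> 'a \<Rightarrow> real) \<Rightarrow> 'a \<Rightarrow> (('a \<Rightarrow> real) \<Rightarrow> real) set" where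
  "lip0_dual M d z =
     {\<phi>. (\<forall>f\<in>lip0 M d z. \<forall>g\<in>lip0 M d z. \<phi> (\<lambda>x. f x + g x) = \<phi> f + \<phi> g) \<and>
         (\<forall>c. \<forall>f\<in>lip0 M d z. \<phi> (\<lambda>x. c * f x) = c * \<phi> f) \<and>
         (\<forall>f. f \<notin> lip0 M d z \<longrightarrow> \<phi> f = 0) \<and>
         (\<exists>C. \<forall>f\<in>lip0 M d z. \<bar>\<phi> f\<bar> \<le> C * lip_norm M d f)}"

definition lip0_dual_norm ::
  "'a set \<Rightarrow> ('a \<Rightarrow> 'a \<Rightarrow> real) \<Rightarrow> 'a \<Rightarrow> (('a \<Rightarrow> real) \<Rightarrow> real) \<Rightarrow> real" where
  "lip0_dual_norm M d z \<phi> = Sup {\<bar>\<phi> f\<bar> | f. f \<in> lip0 M d z \<and> lip_norm M d f \<le> 1}"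

definition lip_delta ::
  "'a set \<Rightarrow> ('a \<Rightarrow> 'a \<Rightarrow> real) \<Rightarrow> 'a \<Rightarrow> 'a \<Rightarrow> ('a \<Rightarrow> real) \<Rightarrow> real" where
  "lip_delta M d z x = (\<lambda>f. if f \<in> lip0 M d z then f x else 0)"

definition delta_span ::
  "'a set \<Rightarrow> ('a \<Rightarrow> 'a \<Rightarrow> real) \<Rightarrow> 'a \<Rightarrow> (('a \<Rightarrow> real) \<Rightarrow> real) set" where
  "delta_span M d z =
     {\<lambda>f. \<Sum>x\<in>A. c x * lip_delta M d z x f | A c. finite A \<and> A \<subseteq> M}"

definition lip_free ::
  "'a set \<Rightarrow> ('a \<Rightarrow> 'a \<Rightarrow> real) \<Rightarrow> 'a \<Rightarrow> (('a \<Rightarrow> real) \<Rightarrow> real) set" where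
  "lip_free M d z =
     {\<phi> \<in> lip0_dual M d z.
        \<forall>e>0. \<exists>\<psi>\<in>delta_span M d z. lip0_dual_norm M d z (\<lambda>f. \<phi> f - \<psi> f) < e}"


section \<open>Real trees\<close>

definition geodesics ::
  "'t set \<Rightarrow> ('t \<Rightarrow> 't \<Rightarrow> real) \<Rightarrow> 't \<Rightarrow> 't \<Rightarrow> (real \<Rightarrow> 't) set" where
  "geodesics T d x y =
     {\<phi> \<in> {0..d x y} \<rightarrow>\<^sub>E T.
        \<phi> 0 = x \<and> \<phi> (d x y) = y \<and>
        (\<forall>s\<in>{0..d x y}. \<forall>t\<in>{0..d x y}. d (\<phi> s) (\<phi> t) = \<bar>s - t\<bar>)}"

definition real_tree :: "'t set \<Rightarrow> ('t \<Rightarrow> 't \<Rightarrow> real) \<Rightarrow> bool" where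
  "real_tree T d \<longleftrightarrow>
     Metric_space T d \<and>
     (\<forall>x\<in>T. \<forall>y\<in>T. geodesics T d x y \<noteq> {}) \<and>
     (\<forall>a\<in>T. \<forall>b\<in>T. \<forall>c\<in>T. \<forall>e\<in>T.
        d a b + d c e \<le> max (d a c + d b e) (d b c + d a e))"

text \<open>In a real tree the four-point condition makes the geodesic between two points unique.\<close>

definition geodesic :: "'t set \<Rightarrow> ('t \<Rightarrow> 't \<Rightarrow> real) \<Rightarrow> 't \<Rightarrow> 't \<Rightarrow> real \<Rightarrow> 't" where
  "geodesic T d x y = (THE \<phi>. \<phi> \<in> geodesics T d x y)"

definition segment :: "'t set \<Rightarrow> ('t \<Rightarrow> 't \<Rightarrow> real) \<Rightarrow> 't \<Rightarrow> 't \<Rightarrow> 't set" where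
  "segment T d x y = geodesic T d x y ` {0..d x y}"

definition branching_points :: "'t set \<Rightarrow> ('t \<Rightarrow> 't \<Rightarrow> real) \<Rightarrow> 't set" where
  "branching_points T d =
     {b \<in> T. \<exists>x\<in>T - {b}. \<exists>y\<in>T - {b}. \<exists>w\<in>T - {b}. x \<noteq> y \<and> x \<noteq> w \<and> y \<noteq> w \<and>
        segment T d x b \<inter> segment T d y b = {b} \<and>
        segment T d x b \<inter> segment T d w b = {b} \<and>
        segment T d y b \<inter> segment T d w b = {b}}"

definition tree_hull :: "'t set \<Rightarrow> ('t \<Rightarrow> 't \<Rightarrow> real) \<Rightarrow> 't set \<Rightarrow> 't set" where
  "tree_hull T d S = (\<Union>x\<in>S. \<Union>y\<in>S. segment T d x y)"

definition segment_trace ::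
  "'t set \<Rightarrow> ('t \<Rightarrow> 't \<Rightarrow> real) \<Rightarrow> 't \<Rightarrow> 't \<Rightarrow> 't set \<Rightarrow> real set" where
  "segment_trace T d x y A = {t \<in> {0..d x y}. geodesic T d x y t \<in> A}"

definition tree_measurable :: "'t set \<Rightarrow> ('t \<Rightarrow> 't \<Rightarrow> real) \<Rightarrow> 't set \<Rightarrow> bool" where
  "tree_measurable T d A \<longleftrightarrow> A \<subseteq> T \<and> (\<forall>x\<in>T. \<forall>y\<in>T. segment_trace T d x y A \<in> sets lebesgue)"

text \<open>A finite disjoint union of segments is given by a finite set of pairs of end points;
  a segment and its reversal intersect, so no segment is counted twice.\<close>

definition tree_measure :: "'t set \<Rightarrow> ('t \<Rightarrow> 't \<Rightarrow> real) \<Rightarrow> 't set \<Rightarrow> ennreal" where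
  "tree_measure T d A =
     (SUP R \<in> {R. finite R \<and> R \<subseteq> T \<times> T \<and> disjoint_family_on (\<lambda>(x, y). segment T d x y) R}.
        \<Sum>(x, y)\<in>R. emeasure lebesgue (segment_trace T d x y A))"

text \<open>Measurability is required explicitly because \<open>emeasure\<close> is \<open>0\<close> on non-measurable sets.
  It holds automatically for complete \<open>S\<close>, which is closed in its hull.\<close>

definition negligible_in_tree :: "'t set \<Rightarrow> ('t \<Rightarrow> 't \<Rightarrow> real) \<Rightarrow> 't set \<Rightarrow> bool" where
  "negligible_in_tree T d S \<longleftrightarrow>
     tree_measurable (tree_hull T d S) d S \<and> tree_measure (tree_hull T d S) d S = 0"

text \<open>Being a subset of a real tree is understood up to isometry, hence the embedding \<open>f\<close>.\<close>

definition negligible_subset_with_branching ::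
  "'a set \<Rightarrow> ('a \<Rightarrow> 'a \<Rightarrow> real) \<Rightarrow> 't set \<Rightarrow> ('t \<Rightarrow> 't \<Rightarrow> real) \<Rightarrow> bool" where
  "negligible_subset_with_branching M d T dT \<longleftrightarrow>
     real_tree T dT \<and>
     (\<exists>f. f ` M \<subseteq> T \<and> (\<forall>x\<in>M. \<forall>y\<in>M. dT (f x) (f y) = d x y) \<and>
          negligible_in_tree T dT (f ` M) \<and> branching_points T dT \<subseteq> f ` M)"

end

theory Submission
  imports Defs "HOL-Library.Countable_Set_Type"
begin

text \<open>An isometry of the free space with \<open>\<ell>\<^sub>1(\<Gamma>)\<close> embeds \<open>M\<close> isometrically into
  \<open>\<ell>\<^sub>1(\<Gamma>)\<close> by \<open>x \<mapsto> u x\<close> in such a way that every Lipschitz function on \<open>M\<close> is the restriction of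
  a bounded functional of the same norm, with coefficients depending linearly on the function.
  Wherever a 1-Lipschitz function has slope 1, its coefficients are the signs of the differences
  of \<open>u\<close>. Choosing suitable functions, this forces the four-point condition, makes every
  coordinate jump over a single gap along a path in \<open>M\<close> (hence \<open>M\<close> is negligible), and rules out a
  branching point outside \<open>M\<close>. A space with the four-point condition spans a real tree.

  Conversely, root \<open>M\<close> at the base point \<open>z\<close>. As \<open>M\<close> is closed and null, the gaps of \<open>M\<close> below a
  point \<open>x\<close> have total length \<open>d z x\<close>, so a Lipschitz function is the sum of its increments over
  the gaps. As \<open>M\<close> contains the branching points, arbitrary slopes in \<open>[-1, 1]\<close> on the gaps
  define a 1-Lipschitz function. Hence the free space is \<open>\<ell>\<^sub>1\<close> over the set of gaps, and this set
  has the cardinality of \<open>\<Gamma>\<close> because both are determined by the density of \<open>M\<close>.\<close>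

section \<open>Geodesics and segments in real trees\<close>

text \<open>The coefficients come from duality: \<open>lip0\<close> is the dual of the free space,
  so an isometry of the free space with \<open>ell1\<close> turns Lipschitz functions into bounded
  families on \<Gamma>, the coefficient at i being the value on the preimage of the i-th unit
  vector. A 1-Lipschitz function of slope 1 on a pair norms the difference of the two image points,
  and equality in this pairing leaves no freedom on the support of that difference. The four-point
  condition, the single jump and the branching points are all read off from two such functions
  sharing a pair of slope 1. A finite space needs a clause of its own: evaluation at the base point
  is zero, so the free space has dimension \<open>card M - 1\<close>, whereas an infinite cardinal
  absorbs the missing point. The gaps are never counted directly: the free space is also represented
  over the set of gaps, so one cardinality argument serves this set and \<Gamma> alike.\<close>

locale four_point_space = Metric_space M d for M :: "'a set" and d +
  assumes four_point: "\<lbrakk>a \<in> M; b \<in> M; c \<in> M; e \<in> M\<rbrakk> \<Longrightarrow>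
    d a b + d c e \<le> max (d a c + d b e) (d b c + d a e)"
begin

text \<open>The four-point condition bounds \<open>d p w\<close> by the maximum, the triangle
  inequality gives the converse. Distances from a point of a segment thus depend only on the end
  points and the position; the tree is later built by turning this formula into a
  definition.\<close>

lemma dist_from_between:
  assumes "x \<in> M" "y \<in> M" "p \<in> M" "w \<in> M" "d x p + d p y = d x y"
  shows "d p w = max (d x w - d x p) (d y w - d p y)"
proof -
  have "d p w + d x y \<le> max (d p x + d w y) (d w x + d p y)"
    using four_point[of p w x y] assms by simp
  moreover have "d x w \<le> d x p + d p w" "d y w \<le> d y p + d p w"
    using triangle assms by auto
  moreover have "d p x = d x p" "d y p = d p y" "d w x = d x w" "d w y = d y w"
    by (simp_all add: commute)
  ultimately show ?thesis
    using assms(5) by linarith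
qed

lemma between_unique:
  assumes "x \<in> M" "y \<in> M" "p \<in> M" "q \<in> M"
    and "d x p + d p y = d x y" "d x q + d q y = d x y" "d x p = d x q"
  shows "p = q"
proof -
  have "d p q = 0"
    using dist_from_between[of x y p q] assms by (simp add: commute)
  then show ?thesis
    using assms by simp
qed

lemma between_chain:
  assumes "x \<in> M" "y \<in> M" "p \<in> M" "q \<in> M"
    and "d x p + d p y = d x y" "d x q + d q y = d x y" "d x p \<le> d x q"
  shows "d x p + d p q = d x q"
proof -
  have "d p q = max (d x q - d x p) (d y q - d p y)"
    using dist_from_between[of x y p q] assms by simp
  then show ?thesis
    using assms commute[of y q] by linarith
qed

text \<open>The two segments overlap in the nondegenerate piece from \<open>x\<close> to
  \<open>b\<close>. This excludes the first alternative of the maximum, and the second joins the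
  segments into one.\<close>

lemma between_extend:
  assumes "p \<in> M" "x \<in> M" "b \<in> M" "y \<in> M" "x \<noteq> b"
    and "d p x + d x b = d p b" "d x b + d b y = d x y"
  shows "d p b + d b y = d p y"
proof -
  have "d x b > 0"
    using assms by simp
  moreover have "d p b + d x y \<le> max (d p x + d b y) (d b x + d p y)"
    using four_point[of p b x y] assms by simp
  moreover have "d p y \<le> d p b + d b y"
    using triangle assms by auto
  ultimately show ?thesis
    using assms(6,7) commute[of b x] by linarith
qed

text \<open>The strict inequality says that \<open>x\<close> and \<open>y\<close> lie on the same
  side of \<open>b\<close>. Transitivity makes the branches at \<open>b\<close> equivalence
  classes.\<close>

lemma not_between_trans:
  assumes "x \<in> M" "y \<in> M" "w \<in> M" "b \<in> M"
    and "d x y < d x b + d b y" "d y w < d y b + d b w"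
  shows "d x w < d x b + d b w"
proof -
  have "d x w + d b y \<le> max (d x b + d w y) (d w b + d x y)"
    using four_point[of x w b y] assms by simp
  then show ?thesis
    using assms(5,6) commute[of w y] commute[of w b] commute[of b y] by linarith
qed

end

lemma real_tree_four_point: "real_tree T d \<Longrightarrow> four_point_space T d"
  unfolding real_tree_def four_point_space_def four_point_space_axioms_def by blast

lemma geodesics_unique:
  assumes "four_point_space T d" "x \<in> T" "y \<in> T" "\<phi> \<in> geodesics T d x y" "\<psi> \<in> geodesics T d x y"
  shows "\<phi> = \<psi>"
proof
  interpret four_point_space T d by fact
  fix t
  show "\<phi> t = \<psi> t"
  proof (cases "t \<in> {0..d x y}")
    case True
    have between: "d x (h t) = t \<and> d (h t) y = d x y - t \<and> h t \<in> T"
      if "h \<in> geodesics T d x y" for h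
    proof -
      have "h 0 = x" "h (d x y) = y" "h t \<in> T"
        and iso: "\<And>s t. s \<in> {0..d x y} \<Longrightarrow> t \<in> {0..d x y} \<Longrightarrow> d (h s) (h t) = \<bar>s - t\<bar>"
        using that True by (auto simp: geodesics_def)
      then show ?thesis
        using iso[of 0 t] iso[of t "d x y"] True by auto
    qed
    show ?thesis
      using between[OF assms(4)] between[OF assms(5)] assms(2,3) between_unique[of x y "\<phi> t" "\<psi> t"]
      by auto
  next
    case False
    then show ?thesis
      using assms(4,5) by (auto simp: geodesics_def PiE_def extensional_def)
  qed
qed

lemma geodesic_eqI:
  assumes "four_point_space T d" "x \<in> T" "y \<in> T" "\<phi> \<in> geodesics T d x y"
  shows "geodesic T d x y = \<phi>"
  unfolding geodesic_def using geodesics_unique[OF assms(1-3)] assms(4) by blast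

lemma geodesic_in_geodesics:
  assumes "real_tree T d" "x \<in> T" "y \<in> T"
  shows "geodesic T d x y \<in> geodesics T d x y"
proof -
  obtain \<phi> where "\<phi> \<in> geodesics T d x y"
    using assms unfolding real_tree_def by blast
  then show ?thesis
    using geodesic_eqI[OF real_tree_four_point] assms by metis
qed

lemma geodesic_point:
  assumes "real_tree T d" "x \<in> T" "y \<in> T" "t \<in> {0..d x y}"
  shows "geodesic T d x y t \<in> T" "d x (geodesic T d x y t) = t"
    "d (geodesic T d x y t) y = d x y - t"
proof -
  let ?\<phi> = "geodesic T d x y"
  have "?\<phi> 0 = x" "?\<phi> (d x y) = y"
    and iso: "\<And>s t. s \<in> {0..d x y} \<Longrightarrow> t \<in> {0..d x y} \<Longrightarrow> d (?\<phi> s) (?\<phi> t) = \<bar>s - t\<bar>"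
    using geodesic_in_geodesics[OF assms(1-3)] by (auto simp: geodesics_def)
  then show "d x (?\<phi> t) = t" "d (?\<phi> t) y = d x y - t"
    using iso[of 0 t] iso[of t "d x y"] assms(4) by auto
  show "?\<phi> t \<in> T"
    using geodesic_in_geodesics[OF assms(1-3)] assms(4) by (auto simp: geodesics_def)
qed

lemma geodesic_eq_between:
  assumes "real_tree T d" "x \<in> T" "y \<in> T" "w \<in> T" "d x w + d w y = d x y"
  shows "geodesic T d x y (d x w) = w"
proof -
  interpret four_point_space T d by (rule real_tree_four_point) fact
  have "d x w \<in> {0..d x y}"
    unfolding atLeastAtMost_iff using assms(5) nonneg[of x w] nonneg[of w y] by linarith
  then show ?thesis
    using geodesic_point[OF assms(1-3)] assms between_unique[of x y "geodesic T d x y (d x w)" w] by simp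
qed

lemma segment_iff:
  assumes "real_tree T d" "x \<in> T" "y \<in> T"
  shows "w \<in> segment T d x y \<longleftrightarrow> w \<in> T \<and> d x w + d w y = d x y"
proof
  assume "w \<in> segment T d x y"
  then show "w \<in> T \<and> d x w + d w y = d x y"
    using geodesic_point[OF assms] by (auto simp: segment_def)
next
  interpret four_point_space T d by (rule real_tree_four_point) fact
  assume w: "w \<in> T \<and> d x w + d w y = d x y"
  then have "d x w \<in> {0..d x y}"
    unfolding atLeastAtMost_iff using nonneg[of x w] nonneg[of w y] by linarith
  then show "w \<in> segment T d x y"
    using geodesic_eq_between[of T d x y w] assms w unfolding segment_def by (metis image_eqI)
qed

lemma real_tree_median:
  assumes "real_tree T d" "x \<in> T" "y \<in> T" "w \<in> T"
  obtains b where "b \<in> T" "d x b + d b y = d x y" "d x b + d b w = d x w" "d y b + d b w = d y w"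
proof -
  interpret four_point_space T d by (rule real_tree_four_point) fact
  \<comment> \<open>The Gromov product of \<open>x\<close> and \<open>y\<close> at \<open>w\<close>:
    the distance from \<open>w\<close> at which the segments to \<open>x\<close> and to
    \<open>y\<close> part.\<close>
  define t where "t = (d w x + d w y - d x y) / 2"
  have t: "t \<in> {0..d w x}"
    unfolding t_def atLeastAtMost_iff
    using triangle[of w x y] triangle[of x w y] assms commute[of x w] commute[of w y]
      triangle[of w y x] commute[of x y] by auto
  let ?b = "geodesic T d w x t"
  have b: "?b \<in> T" "d w ?b = t" "d ?b x = d w x - t"
    using geodesic_point[OF assms(1,4,2) t] .
  moreover have "d ?b y = d w y - t"
  proof -
    have "d ?b y = max (d w y - t) (d x y - (d w x - t))"
      using dist_from_between[of w x ?b y] b assms by simp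
    moreover have "2 * t = d w x + d w y - d x y"
      by (simp add: t_def)
    ultimately show ?thesis
      by linarith
  qed
  moreover have "2 * t = d w x + d w y - d x y"
    by (simp add: t_def)
  ultimately show ?thesis
    using that[of ?b] commute[of x w] commute[of y w] commute[of ?b w] commute[of ?b x] commute[of ?b y]
    by linarith
qed

text \<open>Measurability and measure are defined inside the hull, so its segments have to be
  identified with those of \<open>T\<close>. A geodesic of the hull is one of \<open>T\<close>, and
  there is only one.\<close>

lemma geodesic_tree_hull:
  assumes "real_tree T d" "S \<subseteq> T" "x \<in> S" "y \<in> S"
  shows "geodesic (tree_hull T d S) d x y = geodesic T d x y"
proof -
  have xy: "x \<in> T" "y \<in> T"
    using assms by auto
  have hull: "tree_hull T d S \<subseteq> T"
    unfolding tree_hull_def using assms(2) segment_iff[OF assms(1)] by blast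
  have "geodesics (tree_hull T d S) d x y \<subseteq> geodesics T d x y"
    using hull by (auto simp: geodesics_def PiE_def)
  moreover have "geodesic T d x y \<in> geodesics (tree_hull T d S) d x y"
    using geodesic_in_geodesics[OF assms(1) xy] assms(3,4)
    by (auto simp: geodesics_def PiE_def tree_hull_def segment_def)
  ultimately show ?thesis
    unfolding geodesic_def[of "tree_hull T d S"]
    using geodesics_unique[OF real_tree_four_point[OF assms(1)] xy] by blast
qed

lemma branching_point_of_median:
  assumes "real_tree T d" "b \<in> T" "x \<in> T" "y \<in> T" "w \<in> T" "x \<noteq> b" "y \<noteq> b" "w \<noteq> b"
    and "d x b + d b y = d x y" "d x b + d b w = d x w" "d y b + d b w = d y w"
  shows "b \<in> branching_points T d"
proof -
  interpret four_point_space T d by (rule real_tree_four_point) fact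
  have inter: "segment T d p b \<inter> segment T d q b = {b} \<and> p \<noteq> q"
    if "p \<in> T" "q \<in> T" "p \<noteq> b" "d p b + d b q = d p q" for p q
  proof -
    have "v = b" if "v \<in> T" "d p v + d v b = d p b" "d q v + d v b = d q b" for v
    proof -
      have "d p q \<le> d p v + d v q"
        using triangle \<open>p \<in> T\<close> \<open>q \<in> T\<close> that by blast
      then have "d v b \<le> 0"
        using that(2,3) \<open>d p b + d b q = d p q\<close> commute[of q v] commute[of q b] by linarith
      then show ?thesis
        using that assms(2) by (metis nonneg order_antisym zero)
    qed
    moreover have "p \<noteq> q"
      using that assms(2) by (metis mdist_zero mdist_pos_less nonneg add_pos_nonneg less_irrefl)
    ultimately show ?thesis
      using that assms(2) segment_iff[OF assms(1)] by auto
  qed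
  show ?thesis
    unfolding branching_points_def using assms inter by blast
qed

text \<open>The median of \<open>x\<close>, \<open>y\<close> and \<open>b\<close> lies on both
  segments, hence is \<open>b\<close>.\<close>

lemma branching_point_between:
  assumes "real_tree T d" "x \<in> T" "y \<in> T" "b \<in> T"
    and "segment T d x b \<inter> segment T d y b = {b}"
  shows "d x b + d b y = d x y"
proof -
  interpret four_point_space T d by (rule real_tree_four_point) fact
  obtain m where m: "m \<in> T" "d x m + d m y = d x y" "d x m + d m b = d x b" "d y m + d m b = d y b"
    using real_tree_median[OF assms(1-4)] by metis
  then have "m \<in> segment T d x b \<inter> segment T d y b"
    using segment_iff[OF assms(1)] assms(2-4) by auto
  then show ?thesis
    using m assms(5) by auto
qed

section \<open>The real tree spanned by a four-point space\<close>

context four_point_space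
begin

text \<open>A triple \<open>(x, y, t)\<close> stands for the point at distance \<open>t\<close> from \<open>x\<close> on a segment from \<open>x\<close> to \<open>y\<close>.\<close>

definition virtual_points :: "('a \<times> 'a \<times> real) set" where
  "virtual_points = {(x, y, t). x \<in> M \<and> y \<in> M \<and> 0 \<le> t \<and> t \<le> d x y}"

text \<open>The right-hand side of \<open>dist_from_between\<close>, with \<open>t\<close> and
  \<open>d x y - t\<close> in place of the distances to the end points. \<open>virtual_dist\<close>
  applies it once more, in the second argument.\<close>

fun virtual_dist1 :: "'a \<times> 'a \<times> real \<Rightarrow> 'a \<Rightarrow> real" where
  "virtual_dist1 (x, y, t) w = max (d x w - t) (d y w - (d x y - t))"

fun virtual_dist :: "'a \<times> 'a \<times> real \<Rightarrow> 'a \<times> 'a \<times> real \<Rightarrow> real" where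
  "virtual_dist p (x, y, t) = max (virtual_dist1 p x - t) (virtual_dist1 p y - (d x y - t))"

text \<open>Different triples may describe one point. Its distance function on \<open>M\<close>
  identifies them, and it also supplies the carrier type of the tree.\<close>

definition virtual_trace :: "'a \<times> 'a \<times> real \<Rightarrow> 'a \<Rightarrow> real" where
  "virtual_trace p = (\<lambda>w. if w \<in> M then virtual_dist1 p w else 0)"

lemma virtual_dist_sym: "virtual_dist p q = virtual_dist q p"
proof (cases p, cases q)
  fix x y t x' y' s
  assume pq: "p = (x, y, t)" "q = (x', y', s)"
  show ?thesis
    using commute[of x x'] commute[of x y'] commute[of y x'] commute[of y y']
    unfolding pq virtual_dist.simps virtual_dist1.simps by linarith
qed

lemma virtual_dist_self:
  assumes "p \<in> virtual_points"
  shows "virtual_dist p p = 0"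
proof -
  obtain x y t where p: "p = (x, y, t)" "x \<in> M" "y \<in> M" "0 \<le> t" "t \<le> d x y"
    using assms by (auto simp: virtual_points_def)
  then have "d x x = 0" "d y y = 0" "d y x = d x y"
    by (simp_all add: commute)
  then show ?thesis
    using p(4,5) unfolding p(1) virtual_dist.simps virtual_dist1.simps by linarith
qed

text \<open>Points of \<open>M\<close> are replaced by virtual points one at a time; each stage
  takes the maximum of two instances of the preceding one.\<close>

lemma virtual_four_point1:
  assumes "p \<in> virtual_points" "w \<in> M" "c \<in> M" "e \<in> M"
  shows "virtual_dist1 p w + d c e \<le> max (virtual_dist1 p c + d w e) (d w c + virtual_dist1 p e)"
proof -
  obtain x y t where p: "p = (x, y, t)" "x \<in> M" "y \<in> M"
    using assms(1) by (auto simp: virtual_points_def)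
  show ?thesis
    using four_point[of x w c e] four_point[of y w c e] assms(2-4) p(2,3)
    unfolding p(1) virtual_dist1.simps by linarith
qed

lemma virtual_four_point2:
  assumes "p \<in> virtual_points" "q \<in> virtual_points" "c \<in> M" "e \<in> M"
  shows "virtual_dist p q + d c e
    \<le> max (virtual_dist1 p c + virtual_dist1 q e) (virtual_dist1 q c + virtual_dist1 p e)"
proof -
  obtain x y t where q: "q = (x, y, t)" "x \<in> M" "y \<in> M"
    using assms(2) by (auto simp: virtual_points_def)
  show ?thesis
    using virtual_four_point1[OF assms(1) q(2) assms(3,4)] virtual_four_point1[OF assms(1) q(3) assms(3,4)]
    unfolding q(1) virtual_dist1.simps virtual_dist.simps by linarith
qed

lemma virtual_four_point3:
  assumes "p \<in> virtual_points" "q \<in> virtual_points" "r \<in> virtual_points" "e \<in> M"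
  shows "virtual_dist p q + virtual_dist1 r e
    \<le> max (virtual_dist p r + virtual_dist1 q e) (virtual_dist q r + virtual_dist1 p e)"
proof -
  obtain x y t where r: "r = (x, y, t)" "x \<in> M" "y \<in> M"
    using assms(3) by (auto simp: virtual_points_def)
  show ?thesis
    using virtual_four_point2[OF assms(1,2) r(2) assms(4)] virtual_four_point2[OF assms(1,2) r(3) assms(4)]
    unfolding r(1) virtual_dist1.simps[of x y t] virtual_dist.simps by linarith
qed

text \<open>The four-point inequality survives because \<open>virtual_dist\<close> is a maximum of translates of \<open>d\<close>
  in each argument and both sides of the inequality commute with such maxima.\<close>

lemma virtual_four_point:
  assumes "p \<in> virtual_points" "q \<in> virtual_points" "r \<in> virtual_points" "s \<in> virtual_points"
  shows "virtual_dist p q + virtual_dist r s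
    \<le> max (virtual_dist p r + virtual_dist q s) (virtual_dist q r + virtual_dist p s)"
proof -
  obtain x y t where s: "s = (x, y, t)" "x \<in> M" "y \<in> M"
    using assms(4) by (auto simp: virtual_points_def)
  show ?thesis
    using virtual_four_point3[OF assms(1-3) s(2)] virtual_four_point3[OF assms(1-3) s(3)]
    unfolding s(1) virtual_dist.simps by linarith
qed

text \<open>The four-point inequality with \<open>r\<close> taken twice.\<close>

lemma virtual_triangle:
  assumes "p \<in> virtual_points" "q \<in> virtual_points" "r \<in> virtual_points"
  shows "virtual_dist p q \<le> virtual_dist p r + virtual_dist r q"
  using virtual_four_point[OF assms assms(3)] virtual_dist_self[OF assms(3)]
    virtual_dist_sym[of q r] by simp

lemma virtual_dist_nonneg:
  assumes "p \<in> virtual_points" "q \<in> virtual_points"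
  shows "0 \<le> virtual_dist p q"
  using virtual_triangle[OF assms(1) assms(1) assms(2)] virtual_dist_self[OF assms(1)]
    virtual_dist_sym[of p q] by simp

lemma virtual_point: "x \<in> M \<Longrightarrow> (x, x, 0) \<in> virtual_points"
  by (simp add: virtual_points_def)

lemma virtual_dist_point: "x \<in> M \<Longrightarrow> virtual_dist p (x, x, 0) = virtual_dist1 p x"
  by simp

lemma virtual_dist_cong:
  assumes "virtual_trace p = virtual_trace p'" "q \<in> virtual_points"
  shows "virtual_dist p q = virtual_dist p' q"
proof -
  obtain x y t where q: "q = (x, y, t)" "x \<in> M" "y \<in> M"
    using assms(2) by (auto simp: virtual_points_def)
  then show ?thesis
    using fun_cong[OF assms(1), of x] fun_cong[OF assms(1), of y] by (simp add: virtual_trace_def)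
qed

lemma virtual_trace_eqI:
  assumes "p \<in> virtual_points" "q \<in> virtual_points" "virtual_dist p q = 0"
  shows "virtual_trace p = virtual_trace q"
proof
  fix w
  show "virtual_trace p w = virtual_trace q w"
    using virtual_triangle[OF assms(1) virtual_point[of w] assms(2)]
      virtual_triangle[OF assms(2) virtual_point[of w] assms(1)] assms(3)
      virtual_dist_sym[of p q] virtual_dist_point[of w]
    by (auto simp: virtual_trace_def)
qed

text \<open>The distance is a maximum of four terms, one for each choice of an end point of either
  segment. A choice attaining it gives \<open>a\<close> and \<open>b\<close> such that
  \<open>a\<close>, \<open>p\<close>, \<open>q\<close>, \<open>b\<close> are aligned in this
  order.\<close>

lemma virtual_dist_extend:
  assumes "p \<in> virtual_points" "q \<in> virtual_points"
  obtains a b where "a \<in> M" "b \<in> M" "d a b = virtual_dist1 p a + virtual_dist p q + virtual_dist1 q b"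
proof -
  obtain x y t x' y' s where pq: "p = (x, y, t)" "q = (x', y', s)" "x \<in> M" "y \<in> M" "x' \<in> M" "y' \<in> M"
    "0 \<le> t" "t \<le> d x y" "0 \<le> s" "s \<le> d x' y'"
    using assms by (auto simp: virtual_points_def)
  have ends: "virtual_dist1 p x = t" "virtual_dist1 p y = d x y - t"
    "virtual_dist1 q x' = s" "virtual_dist1 q y' = d x' y' - s"
    using pq commute[of x y] commute[of x' y'] by (auto simp: max_def)
  have "virtual_dist p q = d x x' - t - s \<or> virtual_dist p q = d x y' - t - (d x' y' - s) \<or>
    virtual_dist p q = d y x' - (d x y - t) - s \<or> virtual_dist p q = d y y' - (d x y - t) - (d x' y' - s)"
    unfolding pq(1,2) virtual_dist.simps virtual_dist1.simps by linarith
  then consider "d x x' = t + virtual_dist p q + s"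
    | "d x y' = t + virtual_dist p q + (d x' y' - s)"
    | "d y x' = (d x y - t) + virtual_dist p q + s"
    | "d y y' = (d x y - t) + virtual_dist p q + (d x' y' - s)"
    by linarith
  then show ?thesis
    by cases (use ends that pq(3-6) in metis)+
qed

lemma virtual_dist_same_segment:
  assumes "0 \<le> t" "t \<le> d x y" "0 \<le> s" "s \<le> d x y" "x \<in> M" "y \<in> M"
  shows "virtual_dist (x, y, t) (x, y, s) = \<bar>t - s\<bar>"
proof -
  have "d x x = 0" "d y y = 0" "d y x = d x y"
    using assms(5,6) by (simp_all add: commute)
  then show ?thesis
    using assms(1-4) unfolding virtual_dist.simps virtual_dist1.simps by linarith
qed

text \<open>Both points lie on the segment from \<open>a\<close> to \<open>b\<close>, which is
  parametrized by arc length starting at \<open>p\<close>. Its ends may be triples other than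
  \<open>p\<close> and \<open>q\<close>, hence distance 0 instead of equality.\<close>

lemma virtual_geodesic:
  assumes p: "p \<in> virtual_points" and q: "q \<in> virtual_points"
  obtains h where "h ` {0..virtual_dist p q} \<subseteq> virtual_points"
    "virtual_dist (h 0) p = 0" "virtual_dist (h (virtual_dist p q)) q = 0"
    "\<And>s t. s \<in> {0..virtual_dist p q} \<Longrightarrow> t \<in> {0..virtual_dist p q} \<Longrightarrow> virtual_dist (h s) (h t) = \<bar>s - t\<bar>"
proof -
  obtain a b where ab: "a \<in> M" "b \<in> M" "d a b = virtual_dist1 p a + virtual_dist p q + virtual_dist1 q b"
    using virtual_dist_extend[OF p q] by blast
  let ?D = "virtual_dist p q"
  let ?h = "\<lambda>s. (a, b, virtual_dist1 p a + s)"
  have nonneg: "0 \<le> ?D" "0 \<le> virtual_dist1 p a" "0 \<le> virtual_dist1 q b"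
    using virtual_dist_nonneg[OF p q] virtual_dist_nonneg[OF p virtual_point[OF ab(1)]]
      virtual_dist_nonneg[OF q virtual_point[OF ab(2)]] by auto
  have tri: "virtual_dist1 p b \<le> ?D + virtual_dist1 q b" "virtual_dist1 q a \<le> ?D + virtual_dist1 p a"
    using virtual_triangle[OF p virtual_point[OF ab(2)] q] virtual_triangle[OF q virtual_point[OF ab(1)] p]
      virtual_dist_point ab(1,2) virtual_dist_sym[of p q] by auto
  show ?thesis
  proof
    show "?h ` {0..?D} \<subseteq> virtual_points"
      using ab nonneg by (auto simp: virtual_points_def)
    have "virtual_dist p (?h 0) = 0"
      using ab(3) tri by (simp add: max_def)
    then show "virtual_dist (?h 0) p = 0"
      by (simp only: virtual_dist_sym)
    have "virtual_dist q (?h ?D) = 0"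
      using ab(3) tri by (simp add: max_def)
    then show "virtual_dist (?h ?D) q = 0"
      by (simp only: virtual_dist_sym)
    show "virtual_dist (?h s) (?h t) = \<bar>s - t\<bar>" if "s \<in> {0..?D}" "t \<in> {0..?D}" for s t
      using virtual_dist_same_segment[of "virtual_dist1 p a + s" a b "virtual_dist1 p a + t"] that nonneg ab
      by simp
  qed
qed

text \<open>The last property says that the tree has no loose ends: every segment prolongs to one
  with both ends in the image of \<open>M\<close>.\<close>

lemma real_tree_extension:
  obtains T :: "('a \<Rightarrow> real) set" and dT f where "real_tree T dT" "f ` M \<subseteq> T"
    "\<And>x y. x \<in> M \<Longrightarrow> y \<in> M \<Longrightarrow> dT (f x) (f y) = d x y"
    "\<And>p q. p \<in> T \<Longrightarrow> q \<in> T \<Longrightarrow>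
      \<exists>x\<in>M. \<exists>y\<in>M. dT (f x) (f y) = dT (f x) p + dT p q + dT q (f y)"
proof -
  let ?T = "virtual_trace ` virtual_points"
  define r where "r = inv_into virtual_points virtual_trace"
  \<comment> \<open>\<open>Metric_space\<close> asks for nonnegativity on the whole type; the
    absolute value provides it off \<open>?T\<close>.\<close>
  define dT where "dT = (\<lambda>g h. \<bar>virtual_dist (r g) (r h)\<bar>)"
  define f where "f = (\<lambda>x. virtual_trace (x, x, 0))"
  have dT: "dT (virtual_trace p) (virtual_trace q) = virtual_dist p q"
    if "p \<in> virtual_points" "q \<in> virtual_points" for p q
  proof -
    have r: "r (virtual_trace s) \<in> virtual_points \<and> virtual_trace (r (virtual_trace s)) = virtual_trace s"
      if "s \<in> virtual_points" for s
      using that unfolding r_def by (simp add: inv_into_into f_inv_into_f)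
    have "virtual_dist (r (virtual_trace p)) (r (virtual_trace q)) = virtual_dist p (r (virtual_trace q))"
      using r that virtual_dist_cong by blast
    also have "\<dots> = virtual_dist (r (virtual_trace q)) p"
      by (rule virtual_dist_sym)
    also have "\<dots> = virtual_dist q p"
      using r that virtual_dist_cong by blast
    finally show ?thesis
      using virtual_dist_nonneg[OF that] virtual_dist_sym[of p q] by (simp add: dT_def)
  qed
  have f: "f x \<in> ?T" "dT (virtual_trace p) (f x) = virtual_dist1 p x"
    if "x \<in> M" "p \<in> virtual_points" for x p
    using dT[OF that(2) virtual_point[OF that(1)]] that virtual_point unfolding f_def by auto
  have dT_sym: "dT g h = dT h g" for g h
    by (simp add: dT_def virtual_dist_sym)
  have "Metric_space ?T dT"
  proof
    show "0 \<le> dT g h" "dT g h = dT h g" for g h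
      by (simp_all add: dT_sym) (simp add: dT_def)
    show "dT g h = 0 \<longleftrightarrow> g = h" if "g \<in> ?T" "h \<in> ?T" for g h
    proof -
      obtain p q where pq: "p \<in> virtual_points" "q \<in> virtual_points" "g = virtual_trace p" "h = virtual_trace q"
        using \<open>g \<in> ?T\<close> \<open>h \<in> ?T\<close> by blast
      have "dT g h = 0" if "g = h"
        using dT[OF pq(1,1)] pq(3) that virtual_dist_self[OF pq(1)] by metis
      then show ?thesis
        using virtual_trace_eqI[OF pq(1,2)] dT[OF pq(1,2)] pq(3,4) by metis
    qed
    show "dT g k \<le> dT g h + dT h k" if "g \<in> ?T" "h \<in> ?T" "k \<in> ?T" for g h k
    proof -
      obtain p q r where pq: "p \<in> virtual_points" "q \<in> virtual_points" "r \<in> virtual_points"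
        "g = virtual_trace p" "h = virtual_trace q" "k = virtual_trace r"
        using \<open>g \<in> ?T\<close> \<open>h \<in> ?T\<close> \<open>k \<in> ?T\<close> by blast
      show ?thesis
        using virtual_triangle[OF pq(1,3,2)] unfolding pq(4-6) by (simp only: dT pq(1-3))
    qed
  qed
  moreover have "geodesics ?T dT g h \<noteq> {}" if "g \<in> ?T" "h \<in> ?T" for g h
  proof -
    obtain p q where pq: "p \<in> virtual_points" "q \<in> virtual_points" "g = virtual_trace p" "h = virtual_trace q"
      using \<open>g \<in> ?T\<close> \<open>h \<in> ?T\<close> by blast
    let ?D = "virtual_dist p q"
    obtain k where k: "k ` {0..?D} \<subseteq> virtual_points"
      "virtual_dist (k 0) p = 0" "virtual_dist (k ?D) q = 0"
      "\<And>s t. s \<in> {0..?D} \<Longrightarrow> t \<in> {0..?D} \<Longrightarrow> virtual_dist (k s) (k t) = \<bar>s - t\<bar>"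
      using virtual_geodesic[OF pq(1,2)] by blast
    have ends: "0 \<in> {0..?D}" "?D \<in> {0..?D}"
      using virtual_dist_nonneg[OF pq(1,2)] by auto
    then have mem: "k 0 \<in> virtual_points" "k ?D \<in> virtual_points"
      using k(1) by blast+
    have "restrict (\<lambda>s. virtual_trace (k s)) {0..?D} \<in> geodesics ?T dT g h"
      using virtual_trace_eqI[OF mem(1) pq(1) k(2)] virtual_trace_eqI[OF mem(2) pq(2) k(3)]
        dT pq k(1,4) ends dT[OF pq(1,2)]
      by (auto simp: geodesics_def image_subset_iff)
    then show ?thesis
      by blast
  qed
  moreover have "dT a b + dT c e \<le> max (dT a c + dT b e) (dT b c + dT a e)"
    if mem: "a \<in> ?T" "b \<in> ?T" "c \<in> ?T" "e \<in> ?T" for a b c e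
  proof -
    obtain p q s v where "a = virtual_trace p" "b = virtual_trace q" "c = virtual_trace s"
      "e = virtual_trace v" "p \<in> virtual_points" "q \<in> virtual_points" "s \<in> virtual_points"
      "v \<in> virtual_points"
      using mem by blast
    then show ?thesis
      by (simp only: virtual_four_point dT)
  qed
  ultimately have "real_tree ?T dT"
    unfolding real_tree_def by blast
  moreover have iso: "dT (f x) (f y) = d x y" if "x \<in> M" "y \<in> M" for x y
    using f(2)[OF that(2) virtual_point[OF that(1)]] by (simp add: f_def)
  moreover have "\<exists>x\<in>M. \<exists>y\<in>M. dT (f x) (f y) = dT (f x) g + dT g h + dT h (f y)"
    if "g \<in> ?T" "h \<in> ?T" for g h
  proof -
    obtain p q where pq: "p \<in> virtual_points" "q \<in> virtual_points" "g = virtual_trace p" "h = virtual_trace q"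
      using \<open>g \<in> ?T\<close> \<open>h \<in> ?T\<close> by blast
    obtain a b where "a \<in> M" "b \<in> M" "d a b = virtual_dist1 p a + virtual_dist p q + virtual_dist1 q b"
      using virtual_dist_extend[OF pq(1,2)] by blast
    then show ?thesis
      using iso f(2) dT pq dT_sym by (metis (no_types, lifting))
  qed
  ultimately show ?thesis
    using that[of ?T dT f] f(1) virtual_point by blast
qed

end

section \<open>Lipschitz-free spaces\<close>

definition lip_on :: "'a set \<Rightarrow> ('a \<Rightarrow> 'a \<Rightarrow> real) \<Rightarrow> real \<Rightarrow> ('a \<Rightarrow> real) \<Rightarrow> bool" where
  "lip_on M d L f \<longleftrightarrow> (\<forall>x\<in>M. \<forall>y\<in>M. \<bar>f x - f y\<bar> \<le> L * d x y)"

lemma lip_on_add: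
  assumes "lip_on M d L f" "lip_on M d K g"
  shows "lip_on M d (L + K) (\<lambda>x. f x + g x)"
  unfolding lip_on_def
proof (intro ballI)
  fix x y assume "x \<in> M" "y \<in> M"
  then have "\<bar>f x - f y\<bar> \<le> L * d x y" "\<bar>g x - g y\<bar> \<le> K * d x y"
    using assms by (auto simp: lip_on_def)
  then show "\<bar>f x + g x - (f y + g y)\<bar> \<le> (L + K) * d x y"
    unfolding distrib_right by linarith
qed

lemma lip_on_scale:
  assumes "lip_on M d L f"
  shows "lip_on M d (\<bar>c\<bar> * L) (\<lambda>x. c * f x)"
  unfolding lip_on_def
proof (intro ballI)
  fix x y assume "x \<in> M" "y \<in> M"
  then have "\<bar>c\<bar> * \<bar>f x - f y\<bar> \<le> \<bar>c\<bar> * (L * d x y)"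
    using assms by (auto simp: lip_on_def intro!: mult_left_mono)
  then show "\<bar>c * f x - c * f y\<bar> \<le> \<bar>c\<bar> * L * d x y"
    by (simp add: abs_mult flip: right_diff_distrib)
qed

text \<open>The value \<open>T\<close> is known in advance, and remainders rather than terms are
  compared: those of \<open>h\<close> tend to 0 and control those of \<open>g\<close>.\<close>

lemma has_sum_dominated:
  fixes g h :: "'i \<Rightarrow> real"
  assumes "(h has_sum S) A"
    and "\<And>F. finite F \<Longrightarrow> F \<subseteq> A \<Longrightarrow> \<bar>T - sum g F\<bar> \<le> L * (S - sum h F)"
  shows "(g has_sum T) A"
proof -
  have "((\<lambda>F. L * (S - sum h F)) \<longlongrightarrow> L * (S - S)) (finite_subsets_at_top A)"
    using assms(1) unfolding has_sum_def by (intro tendsto_intros)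
  then have "((\<lambda>F. L * (S - sum h F)) \<longlongrightarrow> 0) (finite_subsets_at_top A)"
    by simp
  moreover have "\<forall>\<^sub>F F in finite_subsets_at_top A. norm (T - sum g F) \<le> L * (S - sum h F)"
    using assms(2) by (intro eventually_finite_subsets_at_top_weakI) simp
  ultimately have "((\<lambda>F. T - sum g F) \<longlongrightarrow> 0) (finite_subsets_at_top A)"
    by (rule Lim_null_comparison[rotated])
  then have "((\<lambda>F. T - (T - sum g F)) \<longlongrightarrow> T - 0) (finite_subsets_at_top A)"
    by (intro tendsto_intros)
  then show ?thesis
    by (simp add: has_sum_def)
qed

locale pointed_metric_space = Metric_space M d for M :: "'a set" and d +
  fixes z :: 'a
  assumes base_point: "z \<in> M"
begin

lemma lip0I: "f z = 0 \<Longrightarrow> (\<And>x. x \<notin> M \<Longrightarrow> f x = 0) \<Longrightarrow> lip_on M d L f \<Longrightarrow> f \<in> lip0 M d z"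
  by (auto simp: lip0_def lip_on_def)

lemma lip_norm_bdd:
  assumes "lip_on M d L f"
  shows "bdd_above (insert 0 {(f x - f y) / d x y |x y. x \<in> M \<and> y \<in> M \<and> x \<noteq> y})"
proof -
  have "(f x - f y) / d x y \<le> L" if "x \<in> M" "y \<in> M" "x \<noteq> y" for x y
  proof -
    have "f x - f y \<le> L * d x y"
      using assms that unfolding lip_on_def by (meson abs_le_D1)
    then show ?thesis
      using that by (simp add: divide_le_eq mdist_pos_eq)
  qed
  then show ?thesis
    unfolding bdd_above_def by (intro exI[of _ "max 0 L"]) force
qed

lemma lip_norm_nonneg: "lip_on M d L f \<Longrightarrow> 0 \<le> lip_norm M d f"
  unfolding lip_norm_def by (intro cSup_upper lip_norm_bdd) auto

lemma lip_on_lip_norm: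
  assumes "lip_on M d L f"
  shows "lip_on M d (lip_norm M d f) f"
  unfolding lip_on_def
proof (intro ballI)
  fix x y assume xy: "x \<in> M" "y \<in> M"
  have le: "f x - f y \<le> lip_norm M d f * d x y" if "x \<in> M" "y \<in> M" for x y
  proof (cases "x = y")
    case True
    then show ?thesis
      using that by simp
  next
    case False
    then have "(f x - f y) / d x y \<le> lip_norm M d f"
      unfolding lip_norm_def using that by (intro cSup_upper lip_norm_bdd[OF assms]) auto
    then show ?thesis
      using False that by (simp add: divide_le_eq mdist_pos_eq)
  qed
  show "\<bar>f x - f y\<bar> \<le> lip_norm M d f * d x y"
    using le[OF xy] le[OF xy(2,1)] commute[of x y] by simp
qed

lemma lip_norm_le:
  assumes "0 \<le> L" "lip_on M d L f"
  shows "lip_norm M d f \<le> L"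
  unfolding lip_norm_def
proof (rule cSup_least)
  fix s assume "s \<in> insert 0 {(f x - f y) / d x y |x y. x \<in> M \<and> y \<in> M \<and> x \<noteq> y}"
  then consider "s = 0" | x y where "s = (f x - f y) / d x y" "x \<in> M" "y \<in> M" "x \<noteq> y"
    by blast
  then show "s \<le> L"
  proof cases
    case 2
    moreover from this have "f x - f y \<le> L * d x y"
      using assms(2) unfolding lip_on_def by (meson abs_le_D1)
    ultimately show ?thesis
      by (simp add: divide_le_eq mdist_pos_eq)
  qed (use assms in auto)
qed auto

lemma lip0_lip_on: "f \<in> lip0 M d z \<Longrightarrow> lip_on M d (lip_norm M d f) f"
  unfolding lip0_def using lip_on_lip_norm by (auto simp: lip_on_def)

lemma lip0_base: "f \<in> lip0 M d z \<Longrightarrow> f z = 0"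
  by (simp add: lip0_def)

lemma lip0_add: "f \<in> lip0 M d z \<Longrightarrow> g \<in> lip0 M d z \<Longrightarrow> (\<lambda>x. f x + g x) \<in> lip0 M d z"
  using lip_on_add[OF lip0_lip_on lip0_lip_on] by (intro lip0I) (auto simp: lip0_def)

lemma lip0_scale: "f \<in> lip0 M d z \<Longrightarrow> (\<lambda>x. c * f x) \<in> lip0 M d z"
  using lip_on_scale[OF lip0_lip_on] by (intro lip0I) (auto simp: lip0_def)

lemma lip0_zero: "(\<lambda>x. 0) \<in> lip0 M d z"
  by (rule lip0I[where L = 0]) (auto simp: lip_on_def)

lemma lip_norm_scale_le:
  assumes "f \<in> lip0 M d z"
  shows "lip_norm M d (\<lambda>x. c * f x) \<le> \<bar>c\<bar> * lip_norm M d f"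
  using lip_norm_le lip_on_scale[OF lip0_lip_on[OF assms]] lip_norm_nonneg[OF lip0_lip_on[OF assms]]
  by simp

definition recenter :: "('a \<Rightarrow> real) \<Rightarrow> 'a \<Rightarrow> real" where
  "recenter f = (\<lambda>x. if x \<in> M then f x - f z else 0)"

lemma lip_on_recenter: "lip_on M d L f \<Longrightarrow> lip_on M d L (recenter f)"
  by (auto simp: lip_on_def recenter_def)

lemma recenter_lip0: "lip_on M d L f \<Longrightarrow> recenter f \<in> lip0 M d z"
  using base_point by (intro lip0I[OF _ _ lip_on_recenter]) (auto simp: recenter_def)

lemma dual_unit_bound:
  assumes "\<phi> \<in> lip0_dual M d z" "f \<in> lip0 M d z" "lip_norm M d f \<le> 1"
  shows "\<bar>\<phi> f\<bar> \<le> lip0_dual_norm M d z \<phi>"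
proof -
  obtain C where C: "\<And>f. f \<in> lip0 M d z \<Longrightarrow> \<bar>\<phi> f\<bar> \<le> C * lip_norm M d f"
    using assms(1) unfolding lip0_dual_def by blast
  have "\<bar>\<phi> g\<bar> \<le> \<bar>C\<bar>" if "g \<in> lip0 M d z" "lip_norm M d g \<le> 1" for g
  proof -
    have "\<bar>\<phi> g\<bar> \<le> \<bar>C\<bar> * lip_norm M d g"
      using C[OF that(1)] mult_right_mono[OF abs_ge_self lip_norm_nonneg[OF lip0_lip_on[OF that(1)]], of C]
      by linarith
    also have "\<dots> \<le> \<bar>C\<bar> * 1"
      using that(2) by (intro mult_left_mono) auto
    finally show ?thesis
      by simp
  qed
  then have "bdd_above {\<bar>\<phi> f\<bar> |f. f \<in> lip0 M d z \<and> lip_norm M d f \<le> 1}"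
    unfolding bdd_above_def by blast
  then show ?thesis
    unfolding lip0_dual_norm_def using assms by (intro cSup_upper) auto
qed

lemma lip_norm_zero: "lip_norm M d (\<lambda>x. 0) = 0"
  using lip_norm_le[of 0 "\<lambda>x. 0"] lip_norm_nonneg[of 0 "\<lambda>x. 0"] by (simp add: lip_on_def)

lemma dual_norm_nonneg: "\<phi> \<in> lip0_dual M d z \<Longrightarrow> 0 \<le> lip0_dual_norm M d z \<phi>"
  using dual_unit_bound[OF _ lip0_zero] lip_norm_zero by fastforce

lemma dual_add: "\<phi> \<in> lip0_dual M d z \<Longrightarrow> f \<in> lip0 M d z \<Longrightarrow> g \<in> lip0 M d z \<Longrightarrow>
    \<phi> (\<lambda>x. f x + g x) = \<phi> f + \<phi> g"
  unfolding lip0_dual_def by blast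

lemma dual_scale: "\<phi> \<in> lip0_dual M d z \<Longrightarrow> f \<in> lip0 M d z \<Longrightarrow> \<phi> (\<lambda>x. c * f x) = c * \<phi> f"
  unfolding lip0_dual_def by blast

lemma dual_bound:
  assumes \<phi>: "\<phi> \<in> lip0_dual M d z" and f: "f \<in> lip0 M d z" "lip_on M d L f" and "0 \<le> L"
  shows "\<bar>\<phi> f\<bar> \<le> lip0_dual_norm M d z \<phi> * L"
\<comment> \<open>A function of norm 0 cannot be normalized; there boundedness of the functional
  gives the value 0.\<close>
proof (cases "lip_norm M d f = 0")
  case True
  obtain C where "\<bar>\<phi> f\<bar> \<le> C * lip_norm M d f"
    using \<phi> f(1) unfolding lip0_dual_def by blast
  then show ?thesis
    using True dual_norm_nonneg[OF \<phi>] \<open>0 \<le> L\<close> by simp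
next
  case False
  define n where "n = lip_norm M d f"
  have n: "n > 0" "n \<le> L"
    using False lip_norm_nonneg[OF f(2)] lip_norm_le[OF \<open>0 \<le> L\<close> f(2)] by (auto simp: n_def)
  have "\<bar>\<phi> (\<lambda>x. inverse n * f x)\<bar> \<le> lip0_dual_norm M d z \<phi>"
    using lip_norm_scale_le[OF f(1), of "inverse n"] n(1)
    by (intro dual_unit_bound \<phi> lip0_scale f(1)) (simp add: n_def)
  then have "\<bar>\<phi> f\<bar> \<le> lip0_dual_norm M d z \<phi> * n"
    unfolding dual_scale[OF \<phi> f(1)] using n(1) by (simp add: abs_mult divide_simps mult.commute)
  also have "\<dots> \<le> lip0_dual_norm M d z \<phi> * L"
    using n(2) dual_norm_nonneg[OF \<phi>] by (intro mult_left_mono)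
  finally show ?thesis .
qed

lemma dual_norm_le:
  assumes "\<And>f. f \<in> lip0 M d z \<Longrightarrow> lip_on M d 1 f \<Longrightarrow> \<bar>\<phi> f\<bar> \<le> C"
  shows "lip0_dual_norm M d z \<phi> \<le> C"
  unfolding lip0_dual_norm_def
proof (rule cSup_least)
  show "{\<bar>\<phi> f\<bar> |f. f \<in> lip0 M d z \<and> lip_norm M d f \<le> 1} \<noteq> {}"
    using lip0_zero lip_norm_zero by force
next
  fix s assume "s \<in> {\<bar>\<phi> f\<bar> |f. f \<in> lip0 M d z \<and> lip_norm M d f \<le> 1}"
  then obtain f where f: "s = \<bar>\<phi> f\<bar>" "f \<in> lip0 M d z" "lip_norm M d f \<le> 1"
    by blast
  have "lip_on M d 1 f"
    unfolding lip_on_def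
  proof (intro ballI)
    fix x y assume "x \<in> M" "y \<in> M"
    then have "\<bar>f x - f y\<bar> \<le> lip_norm M d f * d x y"
      using lip0_lip_on[OF f(2)] by (auto simp: lip_on_def)
    also have "\<dots> \<le> 1 * d x y"
      using f(3) by (intro mult_right_mono) auto
    finally show "\<bar>f x - f y\<bar> \<le> 1 * d x y" .
  qed
  then show "s \<le> C"
    using assms f by blast
qed

lemma dualI:
  assumes "\<And>f g. f \<in> lip0 M d z \<Longrightarrow> g \<in> lip0 M d z \<Longrightarrow> \<phi> (\<lambda>x. f x + g x) = \<phi> f + \<phi> g"
    and "\<And>c f. f \<in> lip0 M d z \<Longrightarrow> \<phi> (\<lambda>x. c * f x) = c * \<phi> f"
    and "\<And>f. f \<notin> lip0 M d z \<Longrightarrow> \<phi> f = 0"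
    and "\<And>f L. f \<in> lip0 M d z \<Longrightarrow> lip_on M d L f \<Longrightarrow> 0 \<le> L \<Longrightarrow> \<bar>\<phi> f\<bar> \<le> C * L"
  shows "\<phi> \<in> lip0_dual M d z"
  using assms lip0_lip_on lip_norm_nonneg unfolding lip0_dual_def by blast

lemma dual_lincomb:
  assumes \<phi>: "\<phi> \<in> lip0_dual M d z" and \<psi>: "\<psi> \<in> lip0_dual M d z"
  shows "(\<lambda>f. c * \<phi> f + e * \<psi> f) \<in> lip0_dual M d z"
proof (rule dualI)
  fix f L assume f: "f \<in> lip0 M d z" "lip_on M d L f" "0 \<le> L"
  have "\<bar>c * \<phi> f + e * \<psi> f\<bar> \<le> \<bar>c\<bar> * \<bar>\<phi> f\<bar> + \<bar>e\<bar> * \<bar>\<psi> f\<bar>"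
    by (metis abs_mult abs_triangle_ineq)
  also have "\<dots> \<le> \<bar>c\<bar> * (lip0_dual_norm M d z \<phi> * L) + \<bar>e\<bar> * (lip0_dual_norm M d z \<psi> * L)"
    using dual_bound[OF \<phi> f] dual_bound[OF \<psi> f] by (intro add_mono mult_left_mono) auto
  also have "\<dots> = (\<bar>c\<bar> * lip0_dual_norm M d z \<phi> + \<bar>e\<bar> * lip0_dual_norm M d z \<psi>) * L"
    by (simp add: algebra_simps)
  finally show "\<bar>c * \<phi> f + e * \<psi> f\<bar> \<le> \<dots>" .
next
  show "c * \<phi> f + e * \<psi> f = 0" if "f \<notin> lip0 M d z" for f
    using \<phi> \<psi> that by (simp add: lip0_dual_def)
qed (simp_all add: dual_add[OF \<phi>] dual_add[OF \<psi>] dual_scale[OF \<phi>] dual_scale[OF \<psi>] algebra_simps)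

lemma lip_delta_dual:
  assumes "x \<in> M"
  shows "lip_delta M d z x \<in> lip0_dual M d z"
proof (rule dualI)
  fix f L assume f: "f \<in> lip0 M d z" "lip_on M d L f" "0 \<le> L"
  then have "\<bar>f x - f z\<bar> \<le> L * d x z"
    using assms base_point by (auto simp: lip_on_def)
  then show "\<bar>lip_delta M d z x f\<bar> \<le> d x z * L"
    using f(1) lip0_base[OF f(1)] by (simp add: lip_delta_def mult.commute)
qed (auto simp: lip_delta_def lip0_add lip0_scale)

lemma lip_delta_apply: "f \<in> lip0 M d z \<Longrightarrow> lip_delta M d z x f = f x"
  by (simp add: lip_delta_def)

lemma delta_span_dual:
  assumes "\<psi> \<in> delta_span M d z"
  shows "\<psi> \<in> lip0_dual M d z"
proof -
  obtain A c where \<psi>: "\<psi> = (\<lambda>f. \<Sum>x\<in>A. c x * lip_delta M d z x f)" and "finite A" "A \<subseteq> M"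
    using assms unfolding delta_span_def by blast
  have "(\<lambda>f. \<Sum>x\<in>A. c x * lip_delta M d z x f) \<in> lip0_dual M d z"
    using \<open>finite A\<close> \<open>A \<subseteq> M\<close>
  proof (induction A)
    case empty
    show ?case
      by (rule dualI[where C = 0]) auto
  next
    case (insert x A)
    then show ?case
      using dual_lincomb[of "lip_delta M d z x" "\<lambda>f. \<Sum>x\<in>A. c x * lip_delta M d z x f" "c x" 1]
        lip_delta_dual by simp
  qed
  then show ?thesis
    by (simp add: \<psi>)
qed

lemma delta_span_lincomb:
  assumes "\<phi> \<in> delta_span M d z" "\<psi> \<in> delta_span M d z"
  shows "(\<lambda>f. c * \<phi> f + e * \<psi> f) \<in> delta_span M d z"
proof -
  obtain A a where \<phi>: "\<phi> = (\<lambda>f. \<Sum>x\<in>A. a x * lip_delta M d z x f)" and A: "finite A" "A \<subseteq> M"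
    using assms unfolding delta_span_def by blast
  obtain B b where \<psi>: "\<psi> = (\<lambda>f. \<Sum>x\<in>B. b x * lip_delta M d z x f)" and B: "finite B" "B \<subseteq> M"
    using assms unfolding delta_span_def by blast
  define a' where "a' x = (if x \<in> A then a x else 0)" for x
  define b' where "b' x = (if x \<in> B then b x else 0)" for x
  have "\<phi> f = (\<Sum>x\<in>A \<union> B. a' x * lip_delta M d z x f)" "\<psi> f = (\<Sum>x\<in>A \<union> B. b' x * lip_delta M d z x f)" for f
    unfolding \<phi> \<psi> a'_def b'_def using A B by (auto intro!: sum.mono_neutral_cong_left)
  then have "(\<lambda>f. c * \<phi> f + e * \<psi> f) = (\<lambda>f. \<Sum>x\<in>A \<union> B. (c * a' x + e * b' x) * lip_delta M d z x f)"
    by (simp add: algebra_simps sum_distrib_left sum.distrib)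
  moreover have "finite (A \<union> B)" "A \<union> B \<subseteq> M"
    using A B by auto
  ultimately show ?thesis
    unfolding delta_span_def mem_Collect_eq
    by (intro exI[of _ "A \<union> B"] exI[of _ "\<lambda>x. c * a' x + e * b' x"] conjI)
qed

lemma lip_delta_span: "x \<in> M \<Longrightarrow> lip_delta M d z x \<in> delta_span M d z"
  unfolding delta_span_def by (rule CollectI, rule exI[of _ "{x}"], rule exI[of _ "\<lambda>_. 1"]) auto

lemma dual_norm_lincomb:
  assumes \<phi>: "\<phi> \<in> lip0_dual M d z" and \<psi>: "\<psi> \<in> lip0_dual M d z"
  shows "lip0_dual_norm M d z (\<lambda>f. c * \<phi> f + e * \<psi> f)
    \<le> \<bar>c\<bar> * lip0_dual_norm M d z \<phi> + \<bar>e\<bar> * lip0_dual_norm M d z \<psi>"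
proof (rule dual_norm_le)
  fix f assume f: "f \<in> lip0 M d z" "lip_on M d 1 f"
  have "\<bar>c * \<phi> f + e * \<psi> f\<bar> \<le> \<bar>c\<bar> * \<bar>\<phi> f\<bar> + \<bar>e\<bar> * \<bar>\<psi> f\<bar>"
    by (metis abs_mult abs_triangle_ineq)
  also have "\<dots> \<le> \<bar>c\<bar> * lip0_dual_norm M d z \<phi> + \<bar>e\<bar> * lip0_dual_norm M d z \<psi>"
    using dual_bound[OF \<phi> f] dual_bound[OF \<psi> f] by (intro add_mono mult_left_mono) auto
  finally show "\<bar>c * \<phi> f + e * \<psi> f\<bar> \<le> \<dots>" .
qed

lemma delta_span_free: "\<psi> \<in> delta_span M d z \<Longrightarrow> \<psi> \<in> lip_free M d z"
  using delta_span_dual dual_norm_le[of "\<lambda>f. \<psi> f - \<psi> f" 0]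
  by (auto simp: lip_free_def intro!: bexI[of _ \<psi>])

lemma free_dual: "\<phi> \<in> lip_free M d z \<Longrightarrow> \<phi> \<in> lip0_dual M d z"
  by (simp add: lip_free_def)

lemma free_lincomb:
  assumes \<phi>: "\<phi> \<in> lip_free M d z" and \<psi>: "\<psi> \<in> lip_free M d z"
  shows "(\<lambda>f. c * \<phi> f + e * \<psi> f) \<in> lip_free M d z"
proof -
  have "\<exists>\<eta>\<in>delta_span M d z. lip0_dual_norm M d z (\<lambda>f. (c * \<phi> f + e * \<psi> f) - \<eta> f) < r" if "r > 0" for r
  proof -
    \<comment> \<open>The summand 1 keeps the denominator positive and makes the final estimate
      strict.\<close>
    define s where "s = r / (\<bar>c\<bar> + \<bar>e\<bar> + 1)"
    have s: "s > 0"
      using that by (simp add: s_def add_nonneg_pos)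
    obtain \<phi>' \<psi>' where span: "\<phi>' \<in> delta_span M d z" "\<psi>' \<in> delta_span M d z"
      and close: "lip0_dual_norm M d z (\<lambda>f. \<phi> f - \<phi>' f) < s" "lip0_dual_norm M d z (\<lambda>f. \<psi> f - \<psi>' f) < s"
      using \<phi> \<psi> s unfolding lip_free_def by blast
    have dual: "(\<lambda>f. \<phi> f - \<phi>' f) \<in> lip0_dual M d z" "(\<lambda>f. \<psi> f - \<psi>' f) \<in> lip0_dual M d z"
      using dual_lincomb[OF free_dual[OF \<phi>] delta_span_dual[OF span(1)], of 1 "-1"]
        dual_lincomb[OF free_dual[OF \<psi>] delta_span_dual[OF span(2)], of 1 "-1"] by simp_all
    have "lip0_dual_norm M d z (\<lambda>f. c * (\<phi> f - \<phi>' f) + e * (\<psi> f - \<psi>' f))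
      \<le> \<bar>c\<bar> * lip0_dual_norm M d z (\<lambda>f. \<phi> f - \<phi>' f) + \<bar>e\<bar> * lip0_dual_norm M d z (\<lambda>f. \<psi> f - \<psi>' f)"
      by (rule dual_norm_lincomb[OF dual])
    also have "\<dots> \<le> \<bar>c\<bar> * s + \<bar>e\<bar> * s"
      using close by (intro add_mono mult_left_mono) auto
    also have "\<dots> < (\<bar>c\<bar> + \<bar>e\<bar> + 1) * s"
      using s by (simp add: algebra_simps)
    also have "\<dots> = r"
      by (simp add: s_def)
    finally have "lip0_dual_norm M d z (\<lambda>f. (c * \<phi> f + e * \<psi> f) - (c * \<phi>' f + e * \<psi>' f)) < r"
      by (simp add: algebra_simps)
    then show ?thesis
      using delta_span_lincomb[OF span, of c e] by (intro bexI[of _ "\<lambda>f. c * \<phi>' f + e * \<psi>' f"])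
  qed
  then show ?thesis
    using dual_lincomb[OF free_dual[OF \<phi>] free_dual[OF \<psi>]] by (simp add: lip_free_def)
qed

lemma free_diff:
  "\<phi> \<in> lip_free M d z \<Longrightarrow> \<psi> \<in> lip_free M d z \<Longrightarrow> (\<lambda>f. \<phi> f - \<psi> f) \<in> lip_free M d z"
  using free_lincomb[of \<phi> \<psi> 1 "-1"] by simp

lemma lip_delta_free: "x \<in> M \<Longrightarrow> lip_delta M d z x \<in> lip_free M d z"
  by (intro delta_span_free lip_delta_span)

lemma lip_delta_dist:
  assumes "x \<in> M" "y \<in> M"
  shows "lip0_dual_norm M d z (\<lambda>f. lip_delta M d z x f - lip_delta M d z y f) = d x y"
proof (rule antisym)
  show "lip0_dual_norm M d z (\<lambda>f. lip_delta M d z x f - lip_delta M d z y f) \<le> d x y"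
    using assms by (intro dual_norm_le) (auto simp: lip_delta_def lip_on_def)
  \<comment> \<open>The distance to \<open>y\<close> is 1-Lipschitz with slope 1 between
    \<open>x\<close> and \<open>y\<close>, so it attains the bound.\<close>
  let ?f = "recenter (\<lambda>w. d w y)"
  have "lip_on M d 1 (\<lambda>w. d w y)"
    unfolding lip_on_def
  proof (intro ballI)
    fix v w assume "v \<in> M" "w \<in> M"
    then show "\<bar>d v y - d w y\<bar> \<le> 1 * d v w"
      using triangle[of v w y] triangle[of w v y] commute[of v w] assms by simp
  qed
  then have f: "?f \<in> lip0 M d z" "lip_on M d 1 ?f"
    by (auto intro: recenter_lip0 lip_on_recenter)
  have "(\<lambda>f. lip_delta M d z x f - lip_delta M d z y f) \<in> lip0_dual M d z"
    using assms by (intro free_dual free_diff lip_delta_free)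
  from dual_bound[OF this f] show "d x y \<le> lip0_dual_norm M d z (\<lambda>f. lip_delta M d z x f - lip_delta M d z y f)"
    using assms f(1) by (simp add: lip_delta_def) (simp add: recenter_def)
qed

end

section \<open>Metric spaces represented in \<open>\<ell>\<^sub>1\<close>\<close>

text \<open>\<open>u x\<close> is the image of the evaluation at \<open>x\<close>, and
  \<open>coef f\<close> is \<open>f\<close> viewed as a bounded family on \<Gamma>. Only differences
  of \<open>u\<close> are represented, so distance functions can be used without recentering. The
  last assumption makes each coordinate nonconstant on \<open>M\<close> and thereby ties the size of
  \<Gamma> to \<open>M\<close>.\<close>

locale ell1_rep = Metric_space M d for M :: "'a set" and d +
  fixes \<Gamma> :: "'g set" and u :: "'a \<Rightarrow> 'g \<Rightarrow> real" and coef :: "('a \<Rightarrow> real) \<Rightarrow> 'g \<Rightarrow> real"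
  assumes nonempty: "M \<noteq> {}"
    and u_summable: "x \<in> M \<Longrightarrow> (\<lambda>i. \<bar>u x i\<bar>) summable_on \<Gamma>"
    and u_dist: "x \<in> M \<Longrightarrow> y \<in> M \<Longrightarrow> ((\<lambda>i. \<bar>u x i - u y i\<bar>) has_sum d x y) \<Gamma>"
    and coef_bound: "lip_on M d L f \<Longrightarrow> 0 \<le> L \<Longrightarrow> i \<in> \<Gamma> \<Longrightarrow> \<bar>coef f i\<bar> \<le> L"
    and coef_repr: "lip_on M d L f \<Longrightarrow> x \<in> M \<Longrightarrow> y \<in> M \<Longrightarrow>
      ((\<lambda>i. coef f i * (u x i - u y i)) has_sum (f x - f y)) \<Gamma>"
    and coef_add: "lip_on M d L f \<Longrightarrow> lip_on M d K g \<Longrightarrow> i \<in> \<Gamma> \<Longrightarrow>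
      coef (\<lambda>x. f x + g x) i = coef f i + coef g i"
    and coef_scale: "lip_on M d L f \<Longrightarrow> i \<in> \<Gamma> \<Longrightarrow> coef (\<lambda>x. c * f x) i = c * coef f i"
    and coef_coordinate: "i \<in> \<Gamma> \<Longrightarrow> j \<in> \<Gamma> \<Longrightarrow> coef (\<lambda>x. u x j) i = (if i = j then 1 else 0)"
begin

lemma lip_on_dist: "p \<in> M \<Longrightarrow> lip_on M d 1 (d p)"
  unfolding lip_on_def
proof (intro ballI)
  fix x y assume "p \<in> M" "x \<in> M" "y \<in> M"
  then show "\<bar>d p x - d p y\<bar> \<le> 1 * d x y"
    using triangle[of p x y] triangle[of p y x] commute[of x y] by simp
qed

lemma coordinate_dist_le:
  assumes "x \<in> M" "y \<in> M" "F \<subseteq> \<Gamma>" "finite F"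
  shows "(\<Sum>i\<in>F. \<bar>u x i - u y i\<bar>) \<le> d x y"
  using has_sum_mono2[OF has_sum_finite[OF assms(4)] u_dist[OF assms(1,2)] assms(3)] by simp

lemma lip_on_coordinate:
  assumes "i \<in> \<Gamma>"
  shows "lip_on M d 1 (\<lambda>x. u x i)"
  using coordinate_dist_le[where F = "{i}"] assms by (simp add: lip_on_def)

lemma coef_constant:
  assumes "lip_on M d 0 f" "i \<in> \<Gamma>"
  shows "coef f i = 0"
  using coef_bound[OF assms(1) _ assms(2)] by simp

text \<open>Both series have the sum \<open>d x y\<close>, and the terms of one dominate those of
  the other, so all terms agree.\<close>

lemma coef_sign:
  assumes f: "lip_on M d 1 f" and xy: "x \<in> M" "y \<in> M" "f x - f y = d x y" and i: "i \<in> \<Gamma>"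
  shows "coef f i * (u x i - u y i) = \<bar>u x i - u y i\<bar>"
proof -
  let ?g = "\<lambda>i. \<bar>u x i - u y i\<bar> + - (coef f i * (u x i - u y i))"
  have sum: "(?g has_sum (d x y + - (f x - f y))) \<Gamma>"
    using coef_repr[OF f xy(1,2)] u_dist[OF xy(1,2)] by (intro has_sum_add) (simp_all only: has_sum_uminus minus_minus)
  have nonneg: "0 \<le> ?g j" if "j \<in> \<Gamma>" for j
  proof -
    have "coef f j * (u x j - u y j) \<le> \<bar>coef f j\<bar> * \<bar>u x j - u y j\<bar>"
      by (metis abs_ge_self abs_mult)
    also have "\<dots> \<le> 1 * \<bar>u x j - u y j\<bar>"
      using coef_bound[OF f _ that] by (intro mult_right_mono) auto
    finally show ?thesis
      by simp
  qed
  have "?g i = 0"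
    using nonneg_has_sum_le_0D[OF sum _ nonneg i] xy(3) by simp
  then show ?thesis
    by simp
qed

text \<open>Two pairs on which a single 1-Lipschitz function attains slope 1 have differences of the same
  sign in every coordinate, because the coefficient of that function is this sign.\<close>

lemma common_slope_sign:
  assumes f: "lip_on M d 1 f" and i: "i \<in> \<Gamma>"
    and "x \<in> M" "y \<in> M" "f x - f y = d x y" "x' \<in> M" "y' \<in> M" "f x' - f y' = d x' y'"
  shows "0 \<le> (u x i - u y i) * (u x' i - u y' i)"
proof -
  have "coef f i * (u x i - u y i) = \<bar>u x i - u y i\<bar>"
    "coef f i * (u x' i - u y' i) = \<bar>u x' i - u y' i\<bar>"
    using coef_sign[OF f _ _ _ i] assms by auto
  then show ?thesis
    by (smt (verit) mult_nonneg_nonneg mult_nonneg_nonpos mult_nonneg_nonpos2 mult_nonpos_nonpos)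
qed

text \<open>The Lipschitz bounds for the crossed pairs \<open>p\<close>, \<open>s\<close> and
  \<open>q\<close>, \<open>r\<close> add up to the hypothesis \<open>le\<close>, so it is necessary;
  a minimum of two cones shows that it suffices.\<close>

lemma common_slope_exists:
  assumes mem: "p \<in> M" "q \<in> M" "r \<in> M" "s \<in> M" and le: "d p r + d q s \<le> d p s + d q r"
  obtains f where "lip_on M d 1 f" "f p - f r = d p r" "f q - f s = d q s"
proof -
  \<comment> \<open>Both cones take the value \<open>d p r\<close> at \<open>p\<close>. By the
    triangle inequality \<bar>t\<bar> \<le> \<open>d r s\<close>, so \<open>f\<close> is 0 at
    \<open>r\<close> and \<open>t\<close> at \<open>s\<close>; \<open>le\<close> makes the second
    cone the lower one at \<open>q\<close>.\<close>
  define t where "t = d p r - d p s"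
  define f where "f = (\<lambda>w. min (d r w) (d s w + t))"
  have "\<bar>f x - f y\<bar> \<le> 1 * d x y" if "x \<in> M" "y \<in> M" for x y
    using lip_on_dist[OF mem(3)] lip_on_dist[OF mem(4)] that unfolding lip_on_def f_def
    by (smt (verit))
  then have "lip_on M d 1 f"
    by (simp add: lip_on_def)
  moreover have "f p - f r = d p r" "f q - f s = d q s"
    using triangle[of p s r] triangle[of p r s] mem le commute
    unfolding f_def t_def by (auto simp: min_def)
  ultimately show ?thesis
    using that by blast
qed

text \<open>When \<open>d p r + d q s\<close> is the smallest of the three sums, slope 1 from
  \<open>r\<close> to \<open>p\<close> can be combined with slope 1 on \<open>q\<close>,
  \<open>s\<close> in either orientation. In each coordinate the product of the two differences is
  then both nonnegative and nonpositive, so one of them vanishes and the other two sums agree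
  coordinatewise.\<close>

lemma four_point_le:
  assumes mem: "p \<in> M" "q \<in> M" "r \<in> M" "s \<in> M"
    and small: "d p r + d q s \<le> d q r + d p s" "d p r + d q s \<le> d p q + d r s"
  shows "d p q + d r s \<le> d q r + d p s"
proof -
  obtain f where f: "lip_on M d 1 f" "f p - f r = d p r" "f q - f s = d q s"
    using common_slope_exists[of p q r s] mem small(1) by (auto simp: add.commute)
  obtain g where g: "lip_on M d 1 g" "g p - g r = d p r" "g s - g q = d s q"
    using common_slope_exists[of p s r q] mem small(2) commute by (metis (no_types, lifting))
  have "\<bar>u p i - u q i\<bar> + \<bar>u r i - u s i\<bar> = \<bar>u q i - u r i\<bar> + \<bar>u p i - u s i\<bar>" if i: "i \<in> \<Gamma>" for i
  proof -
    have "0 \<le> (u p i - u r i) * (u q i - u s i)" "0 \<le> (u p i - u r i) * (u s i - u q i)"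
      using common_slope_sign[OF f(1) i] common_slope_sign[OF g(1) i] f(2,3) g(2,3) mem by auto
    then have "(u p i - u r i) * (u q i - u s i) = 0"
      by (simp add: algebra_simps)
    then show ?thesis
      by auto
  qed
  then have "((\<lambda>i. \<bar>u p i - u q i\<bar> + \<bar>u r i - u s i\<bar>) has_sum (d q r + d p s)) \<Gamma>"
    using has_sum_add[OF u_dist[OF mem(2,3)] u_dist[OF mem(1,4)]] by (simp cong: has_sum_cong)
  then show ?thesis
    using has_sum_add[OF u_dist[OF mem(1,2)] u_dist[OF mem(3,4)]] has_sum_unique by fastforce
qed

lemma four_point_space: "four_point_space M d"
proof
  fix p q r s assume mem: "p \<in> M" "q \<in> M" "r \<in> M" "s \<in> M"
  show "d p q + d r s \<le> max (d p r + d q s) (d q r + d p s)"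
    using four_point_le[of p q r s] four_point_le[of q p r s] mem commute[of p q] by linarith
qed

end

section \<open>Paths in \<open>M\<close> have measure zero\<close>

context ell1_rep
begin

context
  fixes K :: "real set" and D and \<kappa> :: "real \<Rightarrow> 'a"
  assumes K: "K \<subseteq> {0..D}" "0 \<in> K" "D \<in> K" "\<kappa> ` K \<subseteq> M"
    and iso: "\<And>s t. s \<in> K \<Longrightarrow> t \<in> K \<Longrightarrow> d (\<kappa> s) (\<kappa> t) = \<bar>s - t\<bar>"
begin

text \<open>\<open>K\<close> stands for the parameters at which a segment of the tree meets
  \<open>M\<close>, and \<open>\<kappa>\<close> for the points met. The distance from the starting
  point has slope 1 along the path, so every coordinate is monotone on it.\<close>

lemma path_sign:
  assumes "s \<in> K" "t \<in> K" "s' \<in> K" "t' \<in> K" "s \<le> t" "s' \<le> t'" "i \<in> \<Gamma>"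
  shows "0 \<le> (u (\<kappa> t) i - u (\<kappa> s) i) * (u (\<kappa> t') i - u (\<kappa> s') i)"
proof (rule common_slope_sign)
  show "lip_on M d 1 (d (\<kappa> 0))"
    using K by (intro lip_on_dist) auto
  have "0 \<le> r" if "r \<in> K" for r
    using that K by auto
  then show "d (\<kappa> 0) (\<kappa> t) - d (\<kappa> 0) (\<kappa> s) = d (\<kappa> t) (\<kappa> s)"
    "d (\<kappa> 0) (\<kappa> t') - d (\<kappa> 0) (\<kappa> s') = d (\<kappa> t') (\<kappa> s')"
    using iso K(2) assms by auto
qed (use assms K in auto)

lemma path_additive:
  assumes "r \<in> K" "s \<in> K" "t \<in> K" "r \<le> s" "s \<le> t" "i \<in> \<Gamma>"
  shows "\<bar>u (\<kappa> t) i - u (\<kappa> r) i\<bar> = \<bar>u (\<kappa> s) i - u (\<kappa> r) i\<bar> + \<bar>u (\<kappa> t) i - u (\<kappa> s) i\<bar>"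
  using path_sign[of r s s t i] assms by (auto simp: zero_le_mult_iff)

text \<open>The distance from \<open>\<kappa> s\<close> has slope 1 towards both ends, while the
  distance from the starting point increases throughout. The first gives the two increments of the
  coordinate opposite signs, the second equal ones.\<close>

lemma path_two_valued:
  assumes "r \<in> K" "s \<in> K" "t \<in> K" "r \<le> s" "s \<le> t" "i \<in> \<Gamma>"
  shows "u (\<kappa> s) i = u (\<kappa> r) i \<or> u (\<kappa> s) i = u (\<kappa> t) i"
proof -
  have "lip_on M d 1 (d (\<kappa> s))"
    using assms K by (intro lip_on_dist) auto
  then have "0 \<le> (u (\<kappa> r) i - u (\<kappa> s) i) * (u (\<kappa> t) i - u (\<kappa> s) i)"
    using assms K(4) iso by (intro common_slope_sign) auto
  moreover have "0 \<le> (u (\<kappa> s) i - u (\<kappa> r) i) * (u (\<kappa> t) i - u (\<kappa> s) i)"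
    using path_sign[of r s s t i] assms by simp
  ultimately have "(u (\<kappa> s) i - u (\<kappa> r) i) * (u (\<kappa> t) i - u (\<kappa> s) i) = 0"
    by (simp add: algebra_simps)
  then show ?thesis
    by auto
qed

text \<open>A coordinate \<open>i\<close> that changes between \<open>s\<close> and \<open>t\<close> is two-valued there, so it jumps
  across a gap of \<open>K\<close> at least as long as the jump; removing the gap reduces the number of coordinates.\<close>

lemma path_cover:
  assumes "finite F" "F \<subseteq> \<Gamma>" "s \<in> K" "t \<in> K" "s \<le> t" "0 < \<delta>"
  shows "\<exists>C. C \<in> lmeasurable \<and> K \<inter> {s..t} \<subseteq> C \<and>
    measure lebesgue C \<le> (t - s) - (\<Sum>i\<in>F. \<bar>u (\<kappa> t) i - u (\<kappa> s) i\<bar>) + \<delta>"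
  using assms
proof (induction F arbitrary: s t \<delta>)
  case empty
  then show ?case
    by (intro exI[of _ "{s..t}"]) auto
next
  case (insert i F)
  show ?case
  proof (cases "u (\<kappa> t) i = u (\<kappa> s) i")
    case True
    then show ?thesis
      using insert.IH[of s t \<delta>] insert.hyps insert.prems by simp
  next
    case False
    have i: "i \<in> \<Gamma>"
      using insert.prems by simp
    define A where "A = {r \<in> K \<inter> {s..t}. u (\<kappa> r) i = u (\<kappa> s) i}"
    define B where "B = {r \<in> K \<inter> {s..t}. u (\<kappa> r) i = u (\<kappa> t) i}"
    have A: "s \<in> A" "bdd_above A" and B: "t \<in> B" "bdd_below B"
      using insert.prems by (auto simp: A_def B_def intro!: bdd_aboveI[of _ t] bdd_belowI[of _ s])
    have AB: "K \<inter> {s..t} \<subseteq> A \<union> B"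
      using path_two_valued[OF insert.prems(2) _ insert.prems(3) _ _ i] unfolding A_def B_def by fastforce
    \<comment> \<open>Supremum and infimum need not be attained, so the gap is located up to
      \<delta>/4 at either end. Two intervals of this length and two inductive covers with error
      \<delta>/4 use up \<delta>.\<close>
    obtain a where a: "a \<in> A" "Sup A - \<delta> / 4 < a"
      using less_cSup_iff[of A "Sup A - \<delta> / 4"] A insert.prems(5) by auto
    obtain b where b: "b \<in> B" "b < Inf B + \<delta> / 4"
      using cInf_less_iff[of B "Inf B + \<delta> / 4"] B insert.prems(5) by auto
    have mem: "a \<in> K" "b \<in> K" "s \<le> a" "a \<le> t" "s \<le> b" "b \<le> t"
      and vals: "u (\<kappa> a) i = u (\<kappa> s) i" "u (\<kappa> b) i = u (\<kappa> t) i"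
      using a(1) b(1) by (auto simp: A_def B_def)
    \<comment> \<open>Otherwise the coordinate would change and return to its initial value, against
      monotonicity.\<close>
    have ab: "a \<le> b"
    proof (rule ccontr)
      assume "\<not> a \<le> b"
      then show False
        using path_additive[of s b a i] mem vals insert.prems(2) False i by auto
    qed
    obtain C1 where C1: "C1 \<in> lmeasurable" "K \<inter> {s..a} \<subseteq> C1"
      "measure lebesgue C1 \<le> (a - s) - (\<Sum>i\<in>F. \<bar>u (\<kappa> a) i - u (\<kappa> s) i\<bar>) + \<delta> / 4"
      using insert.IH[of s a "\<delta> / 4"] insert.prems mem by auto
    obtain C2 where C2: "C2 \<in> lmeasurable" "K \<inter> {b..t} \<subseteq> C2"
      "measure lebesgue C2 \<le> (t - b) - (\<Sum>i\<in>F. \<bar>u (\<kappa> t) i - u (\<kappa> b) i\<bar>) + \<delta> / 4"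
      using insert.IH[of b t "\<delta> / 4"] insert.prems mem by auto
    let ?C = "(C1 \<union> C2) \<union> ({a..a + \<delta> / 4} \<union> {b - \<delta> / 4..b})"
    have "?C \<in> lmeasurable"
      using C1 C2 by (intro fmeasurable.Un) auto
    moreover have "K \<inter> {s..t} \<subseteq> ?C"
    proof
      fix r assume r: "r \<in> K \<inter> {s..t}"
      then consider "r \<in> A" | "r \<in> B"
        using AB by auto
      then show "r \<in> ?C"
      proof cases
        case 1
        then have "r \<le> a + \<delta> / 4"
          using cSup_upper[OF _ A(2)] a(2) by fastforce
        then show ?thesis
          using r C1(2) by force
      next
        case 2
        then have "b - \<delta> / 4 \<le> r"
          using cInf_lower[OF _ B(2)] b(2) by fastforce
        then show ?thesis
          using r C2(2) by force
      qed
    qed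
    moreover have "measure lebesgue ?C \<le> (t - s) - (\<Sum>j\<in>insert i F. \<bar>u (\<kappa> t) j - u (\<kappa> s) j\<bar>) + \<delta>"
    proof -
      have "measure lebesgue ?C \<le> measure lebesgue (C1 \<union> C2) + measure lebesgue ({a..a + \<delta> / 4} \<union> {b - \<delta> / 4..b})"
        using C1 C2 by (intro measure_Un_le) auto
      also have "\<dots> \<le> (measure lebesgue C1 + measure lebesgue C2)
          + (measure lebesgue {a..a + \<delta> / 4} + measure lebesgue {b - \<delta> / 4..b})"
        using C1 C2 by (intro add_mono measure_Un_le) auto
      also have "\<dots> = measure lebesgue C1 + measure lebesgue C2 + \<delta> / 2"
        using insert.prems(5) by simp
      finally have "measure lebesgue ?C \<le> measure lebesgue C1 + measure lebesgue C2 + \<delta> / 2" .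
      moreover have "(\<Sum>j\<in>F. \<bar>u (\<kappa> t) j - u (\<kappa> s) j\<bar>) = (\<Sum>j\<in>F. \<bar>u (\<kappa> a) j - u (\<kappa> s) j\<bar>)
          + (\<Sum>j\<in>F. \<bar>u (\<kappa> b) j - u (\<kappa> a) j\<bar>) + (\<Sum>j\<in>F. \<bar>u (\<kappa> t) j - u (\<kappa> b) j\<bar>)"
      proof -
        have "\<bar>u (\<kappa> t) j - u (\<kappa> s) j\<bar> = \<bar>u (\<kappa> a) j - u (\<kappa> s) j\<bar> + \<bar>u (\<kappa> b) j - u (\<kappa> a) j\<bar>
            + \<bar>u (\<kappa> t) j - u (\<kappa> b) j\<bar>" if "j \<in> F" for j
        proof -
          have "j \<in> \<Gamma>"
            using that insert.prems(1) by auto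
          then show ?thesis
            using path_additive[of s a t j] path_additive[of a b t j] mem ab insert.prems by simp
        qed
        then show ?thesis
          by (simp add: sum.distrib)
      qed
      \<comment> \<open>The stretch from \<open>a\<close> to \<open>b\<close> needs no cover beyond
        the two short intervals, so its length pays for the jump of coordinate \<open>i\<close> and
        for the increments in \<open>F\<close>.\<close>
      moreover have "(\<Sum>j\<in>insert i F. \<bar>u (\<kappa> b) j - u (\<kappa> a) j\<bar>) \<le> b - a"
        using coordinate_dist_le[of "\<kappa> b" "\<kappa> a" "insert i F"] insert.hyps insert.prems mem K(4) iso[of b a] ab
        by auto
      ultimately show ?thesis
        using C1(3) C2(3) insert.hyps vals by simp
    qed
    ultimately show ?thesis
      by blast
  qed
qed

text \<open>The increments of the coordinates add up to the full length \<open>D\<close>, so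
  finitely many of them make the bound of \<open>path_cover\<close> arbitrarily small.\<close>

lemma path_negligible: "negligible K"
  unfolding negligible_outer_le
proof (intro allI impI)
  fix e :: real assume e: "e > 0"
  have D: "0 \<le> D" "K \<inter> {0..D} = K"
    using K by auto
  have "((\<lambda>i. \<bar>u (\<kappa> D) i - u (\<kappa> 0) i\<bar>) has_sum D) \<Gamma>"
    using u_dist[of "\<kappa> D" "\<kappa> 0"] iso[of D 0] K D(1) by (simp add: image_subset_iff)
  then obtain F where F: "finite F" "F \<subseteq> \<Gamma>" "dist (\<Sum>i\<in>F. \<bar>u (\<kappa> D) i - u (\<kappa> 0) i\<bar>) D \<le> e / 2"
    using has_sum_finite_approximation[of "\<lambda>i. \<bar>u (\<kappa> D) i - u (\<kappa> 0) i\<bar>" \<Gamma> D "e / 2"] e by auto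
  obtain C where "C \<in> lmeasurable" "K \<inter> {0..D} \<subseteq> C"
    "measure lebesgue C \<le> (D - 0) - (\<Sum>i\<in>F. \<bar>u (\<kappa> D) i - u (\<kappa> 0) i\<bar>) + e / 2"
    using path_cover[OF F(1,2) K(2,3) D(1), of "e / 2"] e by auto
  moreover have "D - (\<Sum>i\<in>F. \<bar>u (\<kappa> D) i - u (\<kappa> 0) i\<bar>) \<le> e / 2"
    using F(3) unfolding dist_real_def by linarith
  ultimately have "K \<subseteq> C" "C \<in> lmeasurable" "measure lebesgue C \<le> e"
    unfolding D(2) by linarith+
  then show "\<exists>T. K \<subseteq> T \<and> T \<in> lmeasurable \<and> measure lebesgue T \<le> e"
    by blast
qed

end

section \<open>Branching points outside \<open>M\<close>\<close>

context
  fixes \<beta> :: "'a \<Rightarrow> real" and \<epsilon> :: real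
  assumes \<epsilon>: "\<epsilon> > 0" "\<And>x. x \<in> M \<Longrightarrow> \<epsilon> \<le> \<beta> x"
    and \<beta>: "lip_on M d 1 \<beta>"
begin

text \<open>\<open>\<beta>\<close> stands for the distance to a point outside \<open>M\<close>,
  which stays above \<open>\<epsilon>\<close>. Points on different sides of it are therefore far
  apart, so a sum of branches has a Lipschitz indicator.\<close>

lemma branch_indicator_lip:
  assumes "R \<subseteq> M" and cross: "\<And>x y. x \<in> R \<Longrightarrow> y \<in> M - R \<Longrightarrow> d x y = \<beta> x + \<beta> y"
  shows "lip_on M d (1 / \<epsilon>) (indicator R)"
proof -
  have ge: "\<epsilon> \<le> d x y \<and> \<epsilon> \<le> d y x" if "x \<in> R" "y \<in> M - R" for x y
    using cross[OF that] \<epsilon> that assms(1) commute[of x y] by (smt (verit) Diff_iff subsetD)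
  have "1 \<le> 1 / \<epsilon> * d x y" if "x \<in> R" "y \<in> M - R" for x y
    using ge[of x y] that \<epsilon>(1) by (simp add: divide_simps)
  moreover have "1 \<le> 1 / \<epsilon> * d y x" if "x \<in> R" "y \<in> M - R" for x y
    using ge[of x y] that \<epsilon>(1) by (simp add: divide_simps)
  ultimately show ?thesis
    using \<epsilon>(1) by (auto simp: lip_on_def indicator_def)
qed

text \<open>\<open>f\<close> is the distance to the missing point, counted negatively on
  \<open>P\<close>. There is room to lower it by \<open>\<epsilon>\<close> on \<open>R\<close>
  without losing the Lipschitz constant 1. Both functions have slope 1 from \<open>p\<close> to
  \<open>q\<close>, so their coefficients agree wherever \<open>u p\<close> and \<open>u q\<close>
  differ.\<close>

lemma branch_indicator_coef:
  assumes M: "M = P \<union> Q \<union> R" "P \<inter> Q = {}" "P \<inter> R = {}" "Q \<inter> R = {}"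
    and cross: "\<And>x y. x \<in> P \<Longrightarrow> y \<in> Q \<union> R \<Longrightarrow> d x y = \<beta> x + \<beta> y"
      "\<And>x y. x \<in> Q \<Longrightarrow> y \<in> R \<Longrightarrow> d x y = \<beta> x + \<beta> y"
    and pq: "p \<in> P" "q \<in> Q" and i: "i \<in> \<Gamma>" "u p i \<noteq> u q i"
  shows "coef (indicator R) i = 0"
proof -
  define f where "f = (\<lambda>x. if x \<in> P then - \<beta> x else \<beta> x)"
  define g where "g = (\<lambda>x. f x + (- \<epsilon>) * indicator R x)"
  have lip: "\<bar>\<beta> x - \<beta> y\<bar> \<le> d x y" if "x \<in> M" "y \<in> M" for x y
    using \<beta> that by (auto simp: lip_on_def)
  have cross': "d x y = \<beta> x + \<beta> y" "d y x = \<beta> x + \<beta> y"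
    if "x \<in> P \<and> y \<in> Q \<or> x \<in> P \<and> y \<in> R \<or> x \<in> Q \<and> y \<in> R" for x y
    using that cross commute[of x y] by auto
  have "\<bar>f x - f y\<bar> \<le> 1 * d x y \<and> \<bar>g x - g y\<bar> \<le> 1 * d x y" if xy: "x \<in> M" "y \<in> M" for x y
  proof -
    have x: "x \<in> P \<and> x \<notin> Q \<and> x \<notin> R \<or> x \<in> Q \<and> x \<notin> P \<and> x \<notin> R \<or> x \<in> R \<and> x \<notin> P \<and> x \<notin> Q"
      and y: "y \<in> P \<and> y \<notin> Q \<and> y \<notin> R \<or> y \<in> Q \<and> y \<notin> P \<and> y \<notin> R \<or> y \<in> R \<and> y \<notin> P \<and> y \<notin> Q"
      using xy M by auto
    show ?thesis
      using x y
      by (elim disjE conjE) (use lip[OF xy] \<epsilon>(1) \<epsilon>(2)[OF xy(1)] \<epsilon>(2)[OF xy(2)]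
        cross'(1)[of x y] cross'(2)[of y x] in \<open>auto simp: f_def g_def abs_le_iff\<close>)
  qed
  then have fg: "lip_on M d 1 f" "lip_on M d 1 g"
    by (auto simp: lip_on_def)
  have "R \<subseteq> M" "\<And>x y. x \<in> R \<Longrightarrow> y \<in> M - R \<Longrightarrow> d x y = \<beta> x + \<beta> y"
    using M(1) cross'(2) by fastforce+
  then have ind: "lip_on M d (1 / \<epsilon>) (indicator R)"
    by (rule branch_indicator_lip)
  have mem: "p \<in> M" "q \<in> M" "p \<notin> R" "q \<notin> R" "q \<notin> P"
    using pq M by auto
  then have slope: "f q - f p = d q p" "g q - g p = d q p"
    using pq cross'(2)[of p q] by (auto simp: f_def g_def)
  have "coef f i * (u q i - u p i) = coef g i * (u q i - u p i)"
    using coef_sign[OF fg(1) mem(2,1) slope(1) i(1)] coef_sign[OF fg(2) mem(2,1) slope(2) i(1)] by simp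
  then have "coef f i = coef g i"
    using i(2) by simp
  also have "\<dots> = coef f i + (- \<epsilon>) * coef (indicator R) i"
    unfolding g_def coef_add[OF fg(1) lip_on_scale[OF ind] i(1)] coef_scale[OF ind i(1)] ..
  finally show ?thesis
    using \<epsilon>(1) by simp
qed

text \<open>The coefficients of the indicators of the three branches have disjoint supports, but they add
  up to the coefficients of a constant function, which vanish.\<close>

lemma no_missing_branching_point:
  assumes M: "M = P \<union> Q \<union> R" "P \<inter> Q = {}" "P \<inter> R = {}" "Q \<inter> R = {}"
    and cross: "\<And>x y. x \<in> P \<Longrightarrow> y \<in> Q \<union> R \<Longrightarrow> d x y = \<beta> x + \<beta> y"
      "\<And>x y. x \<in> Q \<Longrightarrow> y \<in> R \<Longrightarrow> d x y = \<beta> x + \<beta> y"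
    and ne: "p \<in> P" "q \<in> Q" "r \<in> R"
  shows False
proof -
  have cross': "d x y = \<beta> x + \<beta> y"
    if "x \<in> P \<and> y \<in> Q \<or> x \<in> P \<and> y \<in> R \<or> x \<in> Q \<and> y \<in> R \<or> y \<in> P \<and> x \<in> Q \<or> y \<in> P \<and> x \<in> R \<or> y \<in> Q \<and> x \<in> R"
    for x y
    using that cross(1)[of x y] cross(1)[of y x] cross(2)[of x y] cross(2)[of y x] commute[of x y] by auto
  have ind: "lip_on M d (1 / \<epsilon>) (indicator P)" "lip_on M d (1 / \<epsilon>) (indicator Q)"
    "lip_on M d (1 / \<epsilon>) (indicator R)"
  proof -
    show "lip_on M d (1 / \<epsilon>) (indicator P)"
      by (rule branch_indicator_lip) (use M(1) cross' in blast)+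
    show "lip_on M d (1 / \<epsilon>) (indicator Q)"
      by (rule branch_indicator_lip) (use M(1) cross' in blast)+
    show "lip_on M d (1 / \<epsilon>) (indicator R)"
      by (rule branch_indicator_lip) (use M(1) cross' in blast)+
  qed
  have zero: "coef (indicator P) i = 0 \<and> coef (indicator Q) i = 0 \<and> coef (indicator R) i = 0" if i: "i \<in> \<Gamma>" for i
  proof -
    have "coef (\<lambda>x. (indicator P x + indicator Q x) + indicator R x) i
        = (coef (indicator P) i + coef (indicator Q) i) + coef (indicator R) i"
      using coef_add[OF lip_on_add[OF ind(1,2)] ind(3) i] coef_add[OF ind(1,2) i] by simp
    moreover have "lip_on M d 0 (\<lambda>x. (indicator P x + indicator Q x) + indicator R x :: real)"
      unfolding lip_on_def using M by (auto simp: indicator_def)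
    ultimately have sum: "coef (indicator P) i + coef (indicator Q) i + coef (indicator R) i = 0"
      using coef_constant[OF _ i] by fastforce
    have R: "u x i = u y i" if "coef (indicator R) i \<noteq> 0" "x \<in> P" "y \<in> Q" for x y
      using branch_indicator_coef[of P Q R x y i] M cross' that i by blast
    have Q: "u x i = u y i" if "coef (indicator Q) i \<noteq> 0" "x \<in> P" "y \<in> R" for x y
      using branch_indicator_coef[of P R Q x y i] M cross' that i by blast
    have P: "u x i = u y i" if "coef (indicator P) i \<noteq> 0" "x \<in> Q" "y \<in> R" for x y
      using branch_indicator_coef[of Q R P x y i] M cross' that i by blast
    \<comment> \<open>A constant coordinate would have coefficient 0 at \<open>i\<close> instead of
      1.\<close>
    have "\<not> (\<forall>x\<in>M. u x i = u p i)"
    proof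
      assume "\<forall>x\<in>M. u x i = u p i"
      then have "lip_on M d 0 (\<lambda>x. u x i)"
        by (simp add: lip_on_def)
      then show False
        using coef_constant[OF _ i] coef_coordinate[OF i i] by fastforce
    qed
    then obtain w where "w \<in> M" "u w i \<noteq> u p i"
      by blast
    then have w: "w \<in> P \<or> w \<in> Q \<or> w \<in> R" "u w i \<noteq> u p i"
      using M(1) by auto
    \<comment> \<open>A nonzero coefficient for one part makes the coordinate constant on the union
      of the other two; two of them would make it constant on \<open>M\<close>.\<close>
    have False if c: "coef (indicator R) i \<noteq> 0" "coef (indicator Q) i \<noteq> 0"
      using R[OF c(1) _ ne(2), of w] R[OF c(1) ne(1,2)] R[OF c(1) ne(1), of w] Q[OF c(2) ne(1), of w] w
      by argo
    moreover have False if c: "coef (indicator R) i \<noteq> 0" "coef (indicator P) i \<noteq> 0"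
      using R[OF c(1) _ ne(2), of w] R[OF c(1) ne(1,2)] R[OF c(1) ne(1), of w] P[OF c(2) ne(2), of w] w
      by argo
    moreover have False if c: "coef (indicator Q) i \<noteq> 0" "coef (indicator P) i \<noteq> 0"
      using Q[OF c(1) _ ne(3), of w] Q[OF c(1) ne(1,3)] Q[OF c(1) ne(1), of w] P[OF c(2) _ ne(3), of w] w
      by argo
    ultimately have "coef (indicator R) i = 0 \<or> coef (indicator Q) i = 0"
      "coef (indicator R) i = 0 \<or> coef (indicator P) i = 0"
      "coef (indicator Q) i = 0 \<or> coef (indicator P) i = 0"
      by blast+
    then show ?thesis
      using sum by linarith
  qed
  have "((\<lambda>i. coef (indicator R) i * (u r i - u p i)) has_sum (indicator R r - indicator R p)) \<Gamma>"
    using coef_repr[OF ind(3)] ne M(1) by blast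
  then have "((\<lambda>i. 0) has_sum (indicator R r - indicator R p :: real)) \<Gamma>"
    using zero by (simp cong: has_sum_cong)
  then have "indicator R r - indicator R p = (0 :: real)"
    using has_sum_unique has_sum_0_simp by blast
  then show False
    using ne M(3) by (auto simp: indicator_def)
qed

end

end

section \<open>Density\<close>

lemma has_sum_finite_sum:
  fixes f :: "'x \<Rightarrow> 'i \<Rightarrow> real"
  assumes "finite N" "\<And>x. x \<in> N \<Longrightarrow> (f x has_sum s x) A"
  shows "((\<lambda>i. \<Sum>x\<in>N. f x i) has_sum (\<Sum>x\<in>N. s x)) A"
  using assms
proof (induction N)
  case empty
  then show ?case
    by simp
next
  case (insert x N)
  then show ?case
    by (simp add: has_sum_add)
qed

text \<open>Gaussian elimination with pivot \<open>y\<close> in coordinate \<open>i\<close>.\<close>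

lemma exists_linear_relation:
  fixes w :: "'x \<Rightarrow> 'g \<Rightarrow> real"
  assumes "finite G" "finite N" "card G < card N"
  shows "\<exists>c. (\<exists>x\<in>N. c x \<noteq> 0) \<and> (\<forall>i\<in>G. (\<Sum>x\<in>N. c x * w x i) = 0)"
  using assms
proof (induction G arbitrary: N w)
  case empty
  then show ?case
    by (intro exI[of _ "\<lambda>_. 1"]) (auto simp: card_gt_0_iff)
next
  case (insert i G)
  show ?case
  proof (cases "\<forall>x\<in>N. w x i = 0")
    case True
    then show ?thesis
      using insert.IH[of N w] insert.prems insert.hyps by auto
  next
    case False
    then obtain y where y: "y \<in> N" "w y i \<noteq> 0"
      by blast
    define v where "v = (\<lambda>x j. w x j - w x i / w y i * w y j)"
    have "card G < card (N - {y})"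
      using insert.prems insert.hyps y by simp
    then obtain c where c: "\<exists>x\<in>N - {y}. c x \<noteq> 0" "\<forall>j\<in>G. (\<Sum>x\<in>N - {y}. c x * v x j) = 0"
      using insert.IH[of "N - {y}" v] insert.prems by auto
    \<comment> \<open>The coefficient of the pivot collects the multiples of \<open>w y\<close> that
      were subtracted in \<open>v\<close>.\<close>
    define e where "e = (\<lambda>x. if x = y then - (\<Sum>x\<in>N - {y}. c x * w x i / w y i) else c x)"
    have "(\<Sum>x\<in>N. e x * w x j) = (\<Sum>x\<in>N - {y}. c x * v x j)" for j
    proof -
      have "(\<Sum>x\<in>N. e x * w x j) = e y * w y j + (\<Sum>x\<in>N - {y}. e x * w x j)"
        using y insert.prems by (simp add: sum.remove)
      also have "(\<Sum>x\<in>N - {y}. e x * w x j) = (\<Sum>x\<in>N - {y}. c x * w x j)"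
        by (intro sum.cong) (auto simp: e_def)
      also have "e y * w y j + \<dots> = (\<Sum>x\<in>N - {y}. c x * v x j)"
        by (simp add: e_def v_def right_diff_distrib sum_subtractf sum_distrib_right mult.assoc)
      finally show ?thesis .
    qed
    moreover have "v x i = 0" for x
      using y by (simp add: v_def)
    moreover have "\<exists>x\<in>N. e x \<noteq> 0"
      using c(1) by (auto simp: e_def)
    ultimately show ?thesis
      using c(2) by (intro exI[of _ e]) auto
  qed
qed

unbundle cardinal_syntax

lemma card_of_lists_infinite:
  assumes "infinite B"
  shows "|lists B| \<le>o |B|"
proof -
  define L where "L = (\<lambda>n. {xs \<in> lists B. length xs = n})"
  have "|L n| \<le>o |B|" for n
  proof (induction n)
    case 0
    have "L 0 = {[]}"
      by (auto simp: L_def)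
    then show ?case
      using assms by (metis card_of_singl_ordLeq finite.emptyI)
  next
    case (Suc n)
    have "L (Suc n) \<subseteq> (\<lambda>(x, xs). x # xs) ` (B \<times> L n)"
      by (force simp: L_def length_Suc_conv)
    then have "|L (Suc n)| \<le>o |B \<times> L n|"
      by (meson card_of_image card_of_mono1 ordLeq_transitive)
    also have "|B \<times> L n| \<le>o |B|"
      using card_of_Sigma_ordLeq_infinite[OF assms, of B "\<lambda>_. L n"] Suc card_of_mono1[OF subset_refl] by blast
    finally show ?case .
  qed
  moreover have "|UNIV :: nat set| \<le>o |B|"
    using assms infinite_iff_card_of_nat by blast
  moreover have "lists B = (\<Union>n. L n)"
    by (auto simp: L_def)
  ultimately show ?thesis
    using card_of_UNION_ordLeq_infinite[OF assms, of UNIV L] by simp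
qed

context ell1_rep
begin

text \<open>The difference of the functions is 0-Lipschitz on \<open>M\<close>, so additive
  constants and values outside \<open>M\<close> are invisible to \<open>coef\<close>.\<close>

lemma coef_cong:
  assumes f: "lip_on M d L f" and fg: "\<And>x. x \<in> M \<Longrightarrow> f x = g x + c" and i: "i \<in> \<Gamma>"
  shows "coef g i = coef f i"
proof -
  have "lip_on M d 0 (\<lambda>x. g x - f x)"
    using fg by (simp add: lip_on_def)
  then show ?thesis
    using coef_add[OF f _ i, of 0 "\<lambda>x. g x - f x"] coef_constant[OF _ i] by simp
qed

lemma lip_on_sum:
  assumes "finite N" "\<And>x. x \<in> N \<Longrightarrow> \<exists>L. lip_on M d L (h x)"
  shows "\<exists>L. lip_on M d L (\<lambda>w. \<Sum>x\<in>N. c x * h x w)"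
  using assms
proof (induction N)
  case empty
  then show ?case
    by (intro exI[of _ 0]) (simp add: lip_on_def)
next
  case (insert x N)
  then obtain L K where "lip_on M d L (h x)" "lip_on M d K (\<lambda>w. \<Sum>x\<in>N. c x * h x w)"
    by blast
  from lip_on_add[OF lip_on_scale[OF this(1)] this(2)] show ?case
    using insert.hyps by auto
qed

lemma coef_sum:
  assumes "finite N" "\<And>x. x \<in> N \<Longrightarrow> \<exists>L. lip_on M d L (h x)" "i \<in> \<Gamma>"
  shows "coef (\<lambda>w. \<Sum>x\<in>N. c x * h x w) i = (\<Sum>x\<in>N. c x * coef (h x) i)"
  using assms(1,2)
proof (induction N)
  case empty
  then show ?case
    using coef_constant[of "\<lambda>_. 0" i] assms(3) by (simp add: lip_on_def)
next
  case (insert x N)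
  then obtain L K where lip: "lip_on M d L (h x)" "lip_on M d K (\<lambda>w. \<Sum>x\<in>N. c x * h x w)"
    using lip_on_sum[of N h c] by blast
  have "coef (\<lambda>w. c x * h x w + (\<Sum>x\<in>N. c x * h x w)) i
      = c x * coef (h x) i + coef (\<lambda>w. \<Sum>x\<in>N. c x * h x w) i"
    using coef_add[OF lip_on_scale[OF lip(1)] lip(2) assms(3)] coef_scale[OF lip(1) assms(3)] by simp
  then show ?case
    using insert by simp
qed

lemma bump_function:
  assumes "finite N" "N \<subseteq> M" "x \<in> M"
  shows "\<exists>f. lip_on M d 1 f \<and> 0 < f x \<and> (\<forall>y\<in>N - {x}. f y = 0)"
proof -
  \<comment> \<open>Inserting 1 keeps the minimum defined and positive when \<open>N\<close>
    contains no point other than \<open>x\<close>.\<close>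
  define r where "r = Min (insert 1 (d x ` (N - {x})))"
  define f where "f = (\<lambda>w. max 0 (r - d x w))"
  have r: "0 < r" "\<And>y. y \<in> N - {x} \<Longrightarrow> r \<le> d x y"
    using assms by (auto simp: r_def mdist_pos_eq subset_iff)
  have "lip_on M d 1 f"
    using lip_on_dist[OF assms(3)] unfolding lip_on_def f_def by (smt (verit))
  moreover have "0 < f x" "\<forall>y\<in>N - {x}. f y = 0"
    using r assms(3) by (auto simp: f_def)
  ultimately show ?thesis
    by blast
qed

text \<open>Comparing the trace of the product of the matrices \<open>coef (h x) i\<close> and
  \<open>u x i - u z i\<close> computed in both orders.\<close>

lemma card_if_finite:
  assumes "finite M"
  shows "finite \<Gamma> \<and> card M = Suc (card \<Gamma>)"
proof -
  obtain z where z: "z \<in> M"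
    using nonempty by blast
  \<comment> \<open>Lipschitz functions matter only up to constants, so one point carries no
    indicator; this is the source of \<open>Suc\<close>.\<close>
  define N where "N = M - {z}"
  have N: "finite N" "N \<subseteq> M" "card M = Suc (card N)"
    using assms card_Suc_Diff1[OF assms z] unfolding N_def by auto
  have "\<exists>h L. lip_on M d L h \<and> (\<forall>y\<in>M. h y = (if y = x then 1 else 0))" if x: "x \<in> N" for x
  proof -
    have "x \<in> M"
      using x N by blast
    obtain f where f: "lip_on M d 1 f" "0 < f x" "\<forall>y\<in>M - {x}. f y = 0"
      using bump_function[OF assms subset_refl \<open>x \<in> M\<close>] by blast
    have "lip_on M d (\<bar>1 / f x\<bar> * 1) (\<lambda>w. 1 / f x * f w)"
      by (rule lip_on_scale[OF f(1)])
    moreover have "\<forall>y\<in>M. 1 / f x * f y = (if y = x then 1 else 0)"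
      using f by auto
    ultimately show ?thesis
      by (intro exI[of _ "\<lambda>w. 1 / f x * f w"]) blast
  qed
  then obtain h where h: "\<And>x. x \<in> N \<Longrightarrow> \<exists>L. lip_on M d L (h x)"
    "\<And>x y. x \<in> N \<Longrightarrow> y \<in> M \<Longrightarrow> h x y = (if y = x then 1 else 0)"
    by metis
  have "((\<lambda>i. \<Sum>x\<in>N. coef (h x) i * (u x i - u z i)) has_sum (\<Sum>x\<in>N. 1)) \<Gamma>"
  proof (rule has_sum_finite_sum[OF N(1)])
    fix x assume x: "x \<in> N"
    then obtain L where "lip_on M d L (h x)"
      using h(1) by blast
    then show "((\<lambda>i. coef (h x) i * (u x i - u z i)) has_sum 1) \<Gamma>"
      using coef_repr[of L "h x" x z] h(2)[OF x z] h(2)[OF x, of x] x z by (auto simp: N_def)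
  qed
  \<comment> \<open>The i-th coordinate function is, up to a constant, the combination of the
    indicators \<open>h x\<close> with weights \<open>u x i - u z i\<close>; its coefficient at
    \<open>i\<close> is 1.\<close>
  moreover have "(\<Sum>x\<in>N. coef (h x) i * (u x i - u z i)) = 1" if i: "i \<in> \<Gamma>" for i
  proof -
    have "(\<Sum>x\<in>N. (u x i - u z i) * h x y) = u y i - u z i" if "y \<in> M" for y
    proof (cases "y = z")
      case True
      then show ?thesis
        using h(2) z by (auto simp: N_def intro!: sum.neutral split: if_splits)
    next
      case False
      then have "(\<Sum>x\<in>N. (u x i - u z i) * h x y) = (\<Sum>x\<in>N. if x = y then u x i - u z i else 0)"
        using h(2) that by (intro sum.cong) auto
      then show ?thesis
        using False that N by (simp add: N_def)
    qed
    then have "coef (\<lambda>y. \<Sum>x\<in>N. (u x i - u z i) * h x y) i = coef (\<lambda>y. u y i) i"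
      by (intro coef_cong[OF lip_on_coordinate[OF i], where c = "u z i"] i) simp
    moreover have "coef (\<lambda>y. \<Sum>x\<in>N. (u x i - u z i) * h x y) i = (\<Sum>x\<in>N. (u x i - u z i) * coef (h x) i)"
      using h(1) by (intro coef_sum[OF N(1) _ i])
    ultimately show ?thesis
      using coef_coordinate[OF i i] by (simp add: mult.commute)
  qed
  moreover have "(\<Sum>x\<in>N. 1) = real (card N)"
    by simp
  ultimately have sum: "((\<lambda>i. 1) has_sum real (card N)) \<Gamma>"
    by (metis (no_types, lifting) has_sum_cong)
  then have fin: "finite \<Gamma>"
    using infsum_diverge_constant[of \<Gamma> "1::real"] has_sum_imp_summable by fastforce
  then have "card \<Gamma> = card N"
    using sum by (auto simp: has_sum_finite_iff)
  then show ?thesis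
    using N(3) fin by simp
qed

text \<open>Over a finite index set, \<open>card \<Gamma> + 1\<close> differences
  \<open>u y - u z\<close> would be linearly dependent. A bump function at a point with nonzero
  weight in the relation contradicts this.\<close>

lemma infinite_index:
  assumes "infinite M"
  shows "infinite \<Gamma>"
proof
  assume fin: "finite \<Gamma>"
  obtain z where z: "z \<in> M"
    using nonempty by blast
  obtain N where N: "N \<subseteq> M - {z}" "finite N" "card N = Suc (card \<Gamma>)"
    using infinite_arbitrarily_large[of "M - {z}"] assms by (meson infinite_remove)
  obtain c x where c: "x \<in> N" "c x \<noteq> 0" "\<And>i. i \<in> \<Gamma> \<Longrightarrow> (\<Sum>y\<in>N. c y * (u y i - u z i)) = 0"
    using exists_linear_relation[OF fin N(2), of "\<lambda>y i. u y i - u z i"] N(3) by auto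
  have "finite (insert z N)" "insert z N \<subseteq> M" "x \<in> M"
    using N c z by auto
  then obtain f where f: "lip_on M d 1 f" "0 < f x" "\<forall>y\<in>insert z N - {x}. f y = 0"
    using bump_function by blast
  have "((\<lambda>i. \<Sum>y\<in>N. c y * (coef f i * (u y i - u z i))) has_sum (\<Sum>y\<in>N. c y * (f y - f z))) \<Gamma>"
    using N z by (intro has_sum_finite_sum has_sum_cmult_right coef_repr[OF f(1)]) auto
  moreover have "(\<Sum>y\<in>N. c y * (coef f i * (u y i - u z i))) = 0" if "i \<in> \<Gamma>" for i
  proof -
    have "(\<Sum>y\<in>N. c y * (coef f i * (u y i - u z i))) = coef f i * (\<Sum>y\<in>N. c y * (u y i - u z i))"
      by (simp add: sum_distrib_left algebra_simps)
    then show ?thesis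
      using c(3)[OF that] by simp
  qed
  moreover have "(\<Sum>y\<in>N. c y * (f y - f z)) = c x * f x"
  proof -
    have "f z = 0"
      using f(3) N c(1) by auto
    then have "(\<Sum>y\<in>N. c y * (f y - f z)) = (\<Sum>y\<in>N. if y = x then c x * f x else 0)"
      using f by (intro sum.cong) auto
    then show ?thesis
      using N c by simp
  qed
  ultimately have "((\<lambda>i. 0) has_sum (c x * f x)) \<Gamma>"
    by (metis (no_types, lifting) has_sum_cong)
  then have "c x * f x = 0"
    using has_sum_unique has_sum_0_simp by blast
  then show False
    using c f by simp
qed

lemma dense_iff:
  assumes "A \<subseteq> M"
  shows "mtopology closure_of A = M \<longleftrightarrow> (\<forall>x\<in>M. \<forall>r>0. \<exists>y\<in>A. d x y < r)"
  using assms unfolding metric_closure_of in_mball by blast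

lemma dense_separates_coordinates:
  assumes A: "A \<subseteq> M" "\<forall>x\<in>M. \<forall>r>0. \<exists>y\<in>A. d x y < r" and i: "i \<in> \<Gamma>"
  shows "\<exists>x\<in>A. u x i \<noteq> c"
proof (rule ccontr)
  assume c: "\<not> (\<exists>x\<in>A. u x i \<noteq> c)"
  have "u x i = c" if x: "x \<in> M" for x
  proof (rule ccontr)
    assume "u x i \<noteq> c"
    then obtain y where y: "y \<in> A" "d x y < \<bar>u x i - c\<bar>"
      using A x by (meson zero_less_abs_iff right_minus_eq)
    then have "\<bar>u x i - u y i\<bar> \<le> 1 * d x y" "u y i = c"
      using lip_on_coordinate[OF i] x A(1) c unfolding lip_on_def by blast+
    then show False
      using y(2) by simp
  qed
  then have "lip_on M d 0 (\<lambda>x. u x i)"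
    by (simp add: lip_on_def)
  then show False
    using coef_constant[OF _ i] coef_coordinate[OF i i] by fastforce
qed

text \<open>No coordinate is constant on the dense set, so each one lies in the support of
  \<open>u x - u z\<close> for some \<open>x\<close> in \<open>A\<close>. These supports are
  countable and \<open>A\<close> is infinite.\<close>

lemma index_lepoll_dense:
  assumes M: "infinite M" and A: "A \<subseteq> M" "mtopology closure_of A = M"
  shows "\<Gamma> \<lesssim> A"
proof -
  have dense: "\<forall>x\<in>M. \<forall>r>0. \<exists>y\<in>A. d x y < r"
    using A dense_iff by blast
  have "infinite A"
  proof
    assume fin: "finite A"
    obtain x where x: "x \<in> M - A"
      using M fin A(1) by (metis Diff_infinite_finite ex_in_conv finite.emptyI)
    have "A \<noteq> {}"
      using dense x by (metis DiffD1 empty_iff zero_less_one)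
    then have "0 < Min (d x ` A)" "\<And>y. y \<in> A \<Longrightarrow> Min (d x ` A) \<le> d x y"
      using fin x A(1) by (auto simp: mdist_pos_eq subset_iff)
    then show False
      using dense x by (meson DiffD1 leD)
  qed
  moreover have "|{i \<in> \<Gamma>. u x i - u z i \<noteq> 0}| \<le>o |A|" if "x \<in> M" "z \<in> M" for x z
  proof -
    have "countable {i \<in> \<Gamma>. \<bar>u x i - u z i\<bar> \<noteq> 0}"
      using u_dist[OF that] has_sum_imp_summable by (intro summable_countable_real) blast
    then have "|{i \<in> \<Gamma>. u x i - u z i \<noteq> 0}| \<le>o |UNIV :: nat set|"
      by (simp add: countable_card_of_nat)
    then show ?thesis
      using \<open>infinite A\<close> infinite_iff_card_of_nat ordLeq_transitive by blast
  qed
  moreover obtain z where "z \<in> M"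
    using nonempty by blast
  ultimately have "|\<Union>x\<in>A. {i \<in> \<Gamma>. u x i - u z i \<noteq> 0}| \<le>o |A|"
    using A(1) card_of_mono1[OF subset_refl, of A] by (intro card_of_UNION_ordLeq_infinite) blast+
  moreover have "\<Gamma> \<subseteq> (\<Union>x\<in>A. {i \<in> \<Gamma>. u x i - u z i \<noteq> 0})"
    using dense_separates_coordinates[OF A(1) dense] by force
  ultimately have "|\<Gamma>| \<le>o |A|"
    using card_of_mono1 ordLeq_transitive by blast
  then show ?thesis
    by (metis card_of_ordLeq lepoll_def)
qed

text \<open>Finitely supported rational families are dense in \<open>ell1\<close>, but need not come
  from \<open>M\<close>. For every such family, coded as an association list, and every radius 1/(n
  + 1), one point of \<open>M\<close> within that radius is picked if there is any.\<close>

lemma small_dense_set: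
  assumes M: "infinite M"
  obtains A where "A \<subseteq> M" "mtopology closure_of A = M" "A \<lesssim> \<Gamma>"
proof -
  define app where "app = (\<lambda>(l :: ('g \<times> rat) list) i. case map_of l i of None \<Rightarrow> 0 | Some q \<Rightarrow> real_of_rat q)"
  define close where "close = (\<lambda>x l (n::nat). \<exists>s. ((\<lambda>i. \<bar>u x i - app l i\<bar>) has_sum s) \<Gamma> \<and> s < 1 / Suc n)"
  define I where "I = lists (\<Gamma> \<times> (UNIV :: rat set)) \<times> (UNIV :: nat set)"
  define pick where "pick = (\<lambda>(l, n). SOME x. x \<in> M \<and> close x l n)"
  define A where "A = {pick j | j. j \<in> I \<and> (\<exists>x. x \<in> M \<and> close x (fst j) (snd j))}"
  have pick: "pick (l, n) \<in> M \<and> close (pick (l, n)) l n" if "x \<in> M" "close x l n" for x l n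
    unfolding pick_def using someI[of "\<lambda>x. x \<in> M \<and> close x l n" x] that by simp
  have A: "A \<subseteq> M"
    using pick by (auto simp: A_def)
  have two_close: "d x y < 2 / Suc n" if "x \<in> M" "y \<in> M" "close x l n" "close y l n" for x y l n
  proof -
    note close = that(3,4)
    obtain s t where st: "((\<lambda>i. \<bar>u x i - app l i\<bar>) has_sum s) \<Gamma>" "s < 1 / Suc n"
      "((\<lambda>i. \<bar>u y i - app l i\<bar>) has_sum t) \<Gamma>" "t < 1 / Suc n"
      using close unfolding close_def by blast
    have "d x y \<le> s + t"
      by (rule has_sum_mono[OF u_dist[OF that(1,2)] has_sum_add[OF st(1,3)]]) auto
    also have "\<dots> < 2 / Suc n"
      using st(2,4) by (simp add: field_simps)
    finally show ?thesis .
  qed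
  have ex_close: "\<exists>l\<in>lists (\<Gamma> \<times> UNIV). close x l n" if x: "x \<in> M" for x n
  proof -
    \<comment> \<open>Half the radius for the rounding error on \<open>F\<close>, half for the tail
      outside \<open>F\<close>.\<close>
    define e where "e = 1 / (2 * Suc n)"
    have e: "0 < e"
      by (simp add: e_def)
    obtain S where S: "((\<lambda>i. \<bar>u x i\<bar>) has_sum S) \<Gamma>"
      using u_summable[OF x] by (auto simp: summable_on_def)
    obtain F where F: "finite F" "F \<subseteq> \<Gamma>" "dist (\<Sum>i\<in>F. \<bar>u x i\<bar>) S \<le> e / 2"
      using has_sum_finite_approximation[OF S, of "e / 2"] e by auto
    define r where "r = e / (card F + 1)"
    have r: "0 < r" "card F * r < e"
      using e by (auto simp: r_def field_simps)
    have "\<exists>q. \<bar>u x i - real_of_rat q\<bar> < r" for i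
    proof -
      obtain q where "u x i - r < real_of_rat q" "real_of_rat q < u x i"
        using of_rat_dense[of "u x i - r" "u x i"] r(1) by auto
      then show ?thesis
        by (intro exI[of _ q]) linarith
    qed
    then obtain q where q: "\<And>i. \<bar>u x i - real_of_rat (q i)\<bar> < r"
      by metis
    obtain xs where xs: "set xs = F"
      using F(1) finite_list by blast
    let ?l = "map (\<lambda>i. (i, q i)) xs"
    have app: "app ?l i = (if i \<in> F then real_of_rat (q i) else 0)" for i
      by (auto simp: app_def map_of_map_restrict restrict_map_def xs)
    have "((\<lambda>i. \<bar>u x i - app ?l i\<bar>) has_sum
      ((\<Sum>i\<in>F. \<bar>u x i - app ?l i\<bar>) + (S - (\<Sum>i\<in>F. \<bar>u x i\<bar>)))) \<Gamma>"
    proof -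
      have "((\<lambda>i. \<bar>u x i\<bar>) has_sum (S - (\<Sum>i\<in>F. \<bar>u x i\<bar>))) (\<Gamma> - F)"
        using has_sum_Diff[OF S has_sum_finite[OF F(1)] F(2)] by simp
      then have "((\<lambda>i. \<bar>u x i - app ?l i\<bar>) has_sum (S - (\<Sum>i\<in>F. \<bar>u x i\<bar>))) (\<Gamma> - F)"
        by (rule has_sum_cong[THEN iffD1, rotated]) (simp add: app)
      then have "((\<lambda>i. \<bar>u x i - app ?l i\<bar>) has_sum
        ((\<Sum>i\<in>F. \<bar>u x i - app ?l i\<bar>) + (S - (\<Sum>i\<in>F. \<bar>u x i\<bar>)))) (F \<union> (\<Gamma> - F))"
        by (intro has_sum_Un_disjoint has_sum_finite F(1)) auto
      then show ?thesis
        using F(2) by (simp add: Un_absorb1)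
    qed
    moreover have "(\<Sum>i\<in>F. \<bar>u x i - app ?l i\<bar>) \<le> card F * r"
      using sum_bounded_above[of F "\<lambda>i. \<bar>u x i - app ?l i\<bar>" r] q by (auto simp: app less_imp_le)
    moreover have "S - (\<Sum>i\<in>F. \<bar>u x i\<bar>) < e"
      using F(3) e unfolding dist_real_def by linarith
    moreover have "e + e = 1 / Suc n"
      by (simp add: e_def field_simps)
    ultimately have "close x ?l n"
      unfolding close_def using r(2) by (intro exI conjI) (assumption, linarith)
    moreover have "?l \<in> lists (\<Gamma> \<times> UNIV)"
      using xs F(2) by auto
    ultimately show ?thesis
      by blast
  qed
  have "\<exists>y\<in>A. d x y < r" if x: "x \<in> M" and "0 < r" for x r
  proof -
    obtain n where n: "2 / Suc n < r"
      using reals_Archimedean[of "r / 2"] \<open>0 < r\<close> by (auto simp: field_simps)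
    obtain l where l: "l \<in> lists (\<Gamma> \<times> UNIV)" "close x l n"
      using ex_close[OF x] by blast
    then have "pick (l, n) \<in> A"
      unfolding A_def I_def using x by force
    then show ?thesis
      using two_close[OF x _ l(2)] pick[OF x l(2)] n by force
  qed
  then have dense: "mtopology closure_of A = M"
    using dense_iff[OF A] by blast
  have inf: "infinite \<Gamma>"
    by (rule infinite_index[OF M])
  have nat: "|UNIV :: nat set| \<le>o |\<Gamma>|"
    using inf infinite_iff_card_of_nat by blast
  have rat: "|UNIV :: rat set| \<le>o |\<Gamma>|"
    using countable_card_of_nat[of "UNIV :: rat set"] nat ordLeq_transitive by blast
  have prod: "|\<Gamma> \<times> (UNIV :: rat set)| \<le>o |\<Gamma>|"
    using card_of_Sigma_ordLeq_infinite[OF inf, of \<Gamma> "\<lambda>_. UNIV"] rat card_of_mono1[OF subset_refl] by blast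
  have "|lists (\<Gamma> \<times> (UNIV :: rat set))| \<le>o |\<Gamma> \<times> (UNIV :: rat set)|"
    using inf by (intro card_of_lists_infinite) (auto simp: finite_cartesian_product_iff)
  then have "|lists (\<Gamma> \<times> (UNIV :: rat set))| \<le>o |\<Gamma>|"
    using prod ordLeq_transitive by blast
  then have I: "|I| \<le>o |\<Gamma>|"
    unfolding I_def using card_of_Sigma_ordLeq_infinite[OF inf, of _ "\<lambda>_. UNIV"] nat by blast
  have "A \<subseteq> pick ` I"
    by (auto simp: A_def)
  then have "|A| \<le>o |\<Gamma>|"
    using card_of_mono1 card_of_image I ordLeq_transitive by metis
  then have "A \<lesssim> \<Gamma>"
    by (metis card_of_ordLeq lepoll_def)
  then show ?thesis
    using that A dense by blast
qed

lemma density: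
  "if finite M then finite \<Gamma> \<and> card M = Suc (card \<Gamma>) else has_density M d \<Gamma>"
proof (cases "finite M")
  case False
  obtain A where A: "A \<subseteq> M" "mtopology closure_of A = M" "A \<lesssim> \<Gamma>"
    using small_dense_set[OF False] by blast
  then show ?thesis
    using False index_lepoll_dense[OF False] lepoll_antisym unfolding has_density_def by metis
qed (use card_if_finite in simp)

end

section \<open>From an isometry to a representation\<close>

lemma linearly_isometric_ell1_eqpoll:
  fixes A :: "'i set" and B :: "'j set"
  assumes "linearly_isometric X nX (ell1 A) (ell1_norm A)" "A \<approx> B"
  shows "linearly_isometric X nX (ell1 B) (ell1_norm B)"
proof -
  obtain V where V: "bij_betw V X (ell1 A)"
    "\<forall>u\<in>X. \<forall>v\<in>X. V (\<lambda>i. u i + v i) = (\<lambda>j. V u j + V v j)"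
    "\<forall>c. \<forall>u\<in>X. V (\<lambda>i. c * u i) = (\<lambda>j. c * V u j)"
    "\<forall>u\<in>X. ell1_norm A (V u) = nX u"
    using assms(1) unfolding linearly_isometric_def by blast
  obtain h where h: "bij_betw h B A"
    using assms(2) eqpoll_sym unfolding eqpoll_def by blast
  define k where "k = inv_into B h"
  have k: "bij_betw k A B" "\<And>i. i \<in> A \<Longrightarrow> h (k i) = i" "\<And>j. j \<in> B \<Longrightarrow> k (h j) = j"
    "\<And>i. i \<in> A \<Longrightarrow> k i \<in> B" "\<And>j. j \<in> B \<Longrightarrow> h j \<in> A"
    using h bij_betw_inv_into[OF h] bij_betw_inv_into_right[OF h] bij_betw_inv_into_left[OF h]
    by (auto simp: k_def bij_betw_def)
  define W where "W = (\<lambda>u j. if j \<in> B then u (h j) else (0::real))"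
  define W' where "W' = (\<lambda>v i. if i \<in> A then v (k i) else (0::real))"
  have W: "W u \<in> ell1 B" "ell1_norm B (W u) = ell1_norm A u" if "u \<in> ell1 A" for u
  proof -
    have "(\<lambda>j. \<bar>u (h j)\<bar>) summable_on B"
      using that summable_on_reindex_bij_betw[OF h, of "\<lambda>i. \<bar>u i\<bar>"] by (simp add: ell1_def)
    then show "W u \<in> ell1 B"
      unfolding ell1_def W_def by (auto cong: summable_on_cong)
    have "(\<Sum>\<^sub>\<infinity>j\<in>B. \<bar>u (h j)\<bar>) = (\<Sum>\<^sub>\<infinity>i\<in>A. \<bar>u i\<bar>)"
      by (rule infsum_reindex_bij_betw[OF h])
    then show "ell1_norm B (W u) = ell1_norm A u"
      unfolding ell1_norm_def W_def by (simp cong: infsum_cong)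
  qed
  have W': "W' v \<in> ell1 A" if "v \<in> ell1 B" for v
  proof -
    have "(\<lambda>i. \<bar>v (k i)\<bar>) summable_on A"
      using that summable_on_reindex_bij_betw[OF k(1), of "\<lambda>j. \<bar>v j\<bar>"] by (simp add: ell1_def)
    then show ?thesis
      unfolding ell1_def W'_def by (auto cong: summable_on_cong)
  qed
  have "bij_betw W (ell1 A) (ell1 B)"
  proof (rule bij_betw_byWitness)
    show "\<forall>u\<in>ell1 A. W' (W u) = u"
      using k by (auto simp: W_def W'_def ell1_def)
    show "\<forall>v\<in>ell1 B. W (W' v) = v"
      using k by (auto simp: W_def W'_def ell1_def)
  qed (use W W' in auto)
  then have "bij_betw (W \<circ> V) X (ell1 B)"
    using V(1) bij_betw_trans by blast
  moreover have "V u \<in> ell1 A" if "u \<in> X" for u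
    using V(1) that by (auto simp: bij_betw_def)
  ultimately show ?thesis
    unfolding linearly_isometric_def using V(2-4) W(2)
    by (intro exI[of _ "W \<circ> V"]) (auto simp: W_def)
qed

lemma has_sum_term_le:
  fixes f :: "'i \<Rightarrow> real"
  assumes "((\<lambda>i. \<bar>f i\<bar>) has_sum S) A" "j \<in> A"
  shows "\<bar>f j\<bar> \<le> S"
  using has_sum_mono2[OF has_sum_finite[of "{j}"] assms(1)] assms(2) by simp

context pointed_metric_space
begin

text \<open>The preimages \<open>U i\<close> of the unit vectors are functionals of norm 1, and
  evaluating them at a function yields its coefficients.\<close>

lemma isometry_ell1_rep:
  fixes \<Gamma> :: "'g set"
  assumes "linearly_isometric (lip_free M d z) (lip0_dual_norm M d z) (ell1 \<Gamma>) (ell1_norm \<Gamma>)"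
  shows "\<exists>u coef. ell1_rep M d \<Gamma> u coef"
proof -
  let ?X = "lip_free M d z"
  let ?n = "lip0_dual_norm M d z"
  obtain V where bij: "bij_betw V ?X (ell1 \<Gamma>)"
    and V_add: "\<And>\<phi> \<psi>. \<phi> \<in> ?X \<Longrightarrow> \<psi> \<in> ?X \<Longrightarrow> V (\<lambda>f. \<phi> f + \<psi> f) = (\<lambda>j. V \<phi> j + V \<psi> j)"
    and V_scale: "\<And>c \<phi>. \<phi> \<in> ?X \<Longrightarrow> V (\<lambda>f. c * \<phi> f) = (\<lambda>j. c * V \<phi> j)"
    and V_norm: "\<And>\<phi>. \<phi> \<in> ?X \<Longrightarrow> ell1_norm \<Gamma> (V \<phi>) = ?n \<phi>"
    using assms unfolding linearly_isometric_def by blast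
  have scale: "(\<lambda>f. c * \<phi> f) \<in> ?X" if "\<phi> \<in> ?X" for c \<phi>
    using free_lincomb[OF that that, of c 0] by simp
  have V_lin: "V (\<lambda>f. c * \<phi> f + e * \<psi> f) = (\<lambda>j. c * V \<phi> j + e * V \<psi> j)"
    if "\<phi> \<in> ?X" "\<psi> \<in> ?X" for c e \<phi> \<psi>
    using V_add[OF scale scale] V_scale that by simp
  have V_diff: "V (\<lambda>f. \<phi> f - \<psi> f) = (\<lambda>j. V \<phi> j - V \<psi> j)" if "\<phi> \<in> ?X" "\<psi> \<in> ?X" for \<phi> \<psi>
    using V_lin[OF that, of 1 "-1"] by simp
  have zero: "(\<lambda>f. 0) \<in> ?X" "V (\<lambda>f. 0) = (\<lambda>j. 0)"
    using scale[OF lip_delta_free[OF base_point], of 0] V_scale[OF lip_delta_free[OF base_point], of 0]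
    by simp_all
  have V_sum: "(\<lambda>f. \<Sum>x\<in>A. c x * \<Phi> x f) \<in> ?X \<and>
      V (\<lambda>f. \<Sum>x\<in>A. c x * \<Phi> x f) = (\<lambda>j. \<Sum>x\<in>A. c x * V (\<Phi> x) j)"
    if "finite A" "\<And>x. x \<in> A \<Longrightarrow> \<Phi> x \<in> ?X" for A :: "'x set" and c \<Phi>
    using that
  proof (induction A)
    case empty
    then show ?case
      using zero by simp
  next
    case (insert x A)
    then show ?case
      using V_lin[of "\<Phi> x" "\<lambda>f. \<Sum>x\<in>A. c x * \<Phi> x f" "c x" 1]
        free_lincomb[of "\<Phi> x" "\<lambda>f. \<Sum>x\<in>A. c x * \<Phi> x f" "c x" 1] by simp
  qed
  have V_has_sum: "((\<lambda>i. \<bar>V \<phi> i\<bar>) has_sum ?n \<phi>) \<Gamma>" if "\<phi> \<in> ?X" for \<phi>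
  proof -
    have "V \<phi> \<in> ell1 \<Gamma>"
      using bij that by (auto simp: bij_betw_def)
    then show ?thesis
      using V_norm[OF that] has_sum_infsum unfolding ell1_def ell1_norm_def by fastforce
  qed
  define basis where "basis = (\<lambda>(i :: 'g) j. if j = i then 1 else (0::real))"
  have basis_sum: "((\<lambda>j. \<bar>basis i j\<bar>) has_sum 1) \<Gamma>" if "i \<in> \<Gamma>" for i
    using that by (intro has_sum_finite_neutralI[of "{i}"]) (auto simp: basis_def)
  have "basis i \<in> ell1 \<Gamma>" if "i \<in> \<Gamma>" for i
    using basis_sum[OF that] that by (auto simp: ell1_def summable_on_def basis_def)
  then have "\<exists>\<phi>. \<phi> \<in> ?X \<and> V \<phi> = basis i" if "i \<in> \<Gamma>" for i
    using bij that unfolding bij_betw_def by (metis imageE)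
  then obtain U where U: "\<And>i. i \<in> \<Gamma> \<Longrightarrow> U i \<in> ?X" "\<And>i. i \<in> \<Gamma> \<Longrightarrow> V (U i) = basis i"
    by metis
  have U_norm: "?n (U i) = 1" if "i \<in> \<Gamma>" for i
    using V_has_sum[OF U(1)[OF that]] basis_sum[OF that] has_sum_unique U(2)[OF that] by fastforce
  define u where "u = (\<lambda>x. V (lip_delta M d z x))"
  define coef where "coef = (\<lambda>f i. U i (recenter f))"
  \<comment> \<open>The truncation \<open>\<psi>\<close> to \<open>F\<close> misses
    \<open>\<phi>\<close> in the dual norm by exactly the tail of the series for the norm of
    \<open>\<phi>\<close>, so evaluation at \<open>g\<close> converges with remainders of that
    order.\<close>
  have repr: "((\<lambda>i. V \<phi> i * U i g) has_sum \<phi> g) \<Gamma>" if \<phi>: "\<phi> \<in> ?X" and g: "g \<in> lip0 M d z" for \<phi> g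
  proof (rule has_sum_dominated[OF V_has_sum[OF \<phi>]])
    fix F assume F: "finite F" "F \<subseteq> \<Gamma>"
    define \<psi> where "\<psi> = (\<lambda>f. \<Sum>i\<in>F. V \<phi> i * U i f)"
    have \<psi>: "\<psi> \<in> ?X" "V \<psi> = (\<lambda>j. \<Sum>i\<in>F. V \<phi> i * V (U i) j)"
      using V_sum[OF F(1), of U "V \<phi>"] U(1) F(2) unfolding \<psi>_def by auto
    have V\<psi>: "V \<psi> j = (if j \<in> F then V \<phi> j else 0)" for j
    proof -
      have "V \<psi> j = (\<Sum>i\<in>F. if i = j then V \<phi> i else 0)"
        unfolding \<psi>(2) using U(2) F(2) by (intro sum.cong) (auto simp: basis_def)
      then show ?thesis
        using F(1) by simp
    qed
    have "((\<lambda>i. if i \<in> F then - \<bar>V \<phi> i\<bar> else 0) has_sum (\<Sum>i\<in>F. - \<bar>V \<phi> i\<bar>)) \<Gamma>"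
      using F by (intro has_sum_finite_neutralI[of F]) auto
    from has_sum_add[OF V_has_sum[OF \<phi>] this]
    have "((\<lambda>i. \<bar>V \<phi> i\<bar> + (if i \<in> F then - \<bar>V \<phi> i\<bar> else 0)) has_sum (?n \<phi> - (\<Sum>i\<in>F. \<bar>V \<phi> i\<bar>))) \<Gamma>"
      by (simp add: sum_negf)
    moreover have "\<bar>V (\<lambda>f. \<phi> f - \<psi> f) i\<bar> = \<bar>V \<phi> i\<bar> + (if i \<in> F then - \<bar>V \<phi> i\<bar> else 0)" for i
      unfolding V_diff[OF \<phi> \<psi>(1)] V\<psi> by simp
    ultimately have "?n (\<lambda>f. \<phi> f - \<psi> f) = ?n \<phi> - (\<Sum>i\<in>F. \<bar>V \<phi> i\<bar>)"
      using V_has_sum[OF free_diff[OF \<phi> \<psi>(1)]] has_sum_unique by fastforce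
    moreover have "\<bar>\<phi> g - \<psi> g\<bar> \<le> ?n (\<lambda>f. \<phi> f - \<psi> f) * lip_norm M d g"
      using dual_bound[OF free_dual[OF free_diff[OF \<phi> \<psi>(1)]] g lip0_lip_on[OF g]]
        lip_norm_nonneg[OF lip0_lip_on[OF g]] by simp
    ultimately show "\<bar>\<phi> g - (\<Sum>i\<in>F. V \<phi> i * U i g)\<bar> \<le> lip_norm M d g * (?n \<phi> - (\<Sum>i\<in>F. \<bar>V \<phi> i\<bar>))"
      by (simp add: \<psi>_def mult.commute)
  qed
  have u_dist: "((\<lambda>i. \<bar>u x i - u y i\<bar>) has_sum d x y) \<Gamma>" if "x \<in> M" "y \<in> M" for x y
    using V_has_sum[OF free_diff[OF lip_delta_free[OF that(1)] lip_delta_free[OF that(2)]]]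
      lip_delta_dist[OF that] V_diff[OF lip_delta_free[OF that(1)] lip_delta_free[OF that(2)]]
    by (simp add: u_def)
  have "lip_delta M d z z = (\<lambda>f. 0)"
    by (auto simp: lip_delta_def lip0_base)
  then have u_base: "u z = (\<lambda>j. 0)"
    using zero by (simp add: u_def)
  \<comment> \<open>True on the span of the evaluations by linearity. Both sides change by at most
    the dual norm of a perturbation of \<open>\<phi>\<close>, so the identity passes to the
    closure.\<close>
  have coordinate: "\<phi> (recenter (\<lambda>x. u x j)) = V \<phi> j" if \<phi>: "\<phi> \<in> ?X" and j: "j \<in> \<Gamma>" for \<phi> j
  proof -
    define g where "g = recenter (\<lambda>x. u x j)"
    have lip: "lip_on M d 1 (\<lambda>x. u x j)"
      using has_sum_term_le[OF u_dist j] by (simp add: lip_on_def)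
    have g: "g \<in> lip0 M d z" "lip_on M d 1 g"
      using recenter_lip0[OF lip] lip_on_recenter[OF lip] by (simp_all add: g_def)
    have g_eq: "g x = u x j" if "x \<in> M" for x
      using that u_base by (simp add: g_def recenter_def)
    have "\<bar>\<phi> g - V \<phi> j\<bar> \<le> e" if e: "0 < e" for e
    proof -
      have "0 < e / 2"
        using e by simp
      then obtain \<psi> where \<psi>: "\<psi> \<in> delta_span M d z" "?n (\<lambda>f. \<phi> f - \<psi> f) < e / 2"
        using \<phi> unfolding lip_free_def by blast
      obtain A c where A: "\<psi> = (\<lambda>f. \<Sum>x\<in>A. c x * lip_delta M d z x f)" "finite A" "A \<subseteq> M"
        using \<psi>(1) unfolding delta_span_def by blast
      have "V \<psi> = (\<lambda>j. \<Sum>x\<in>A. c x * u x j)"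
        using V_sum[OF A(2), of "lip_delta M d z" c] A(3) lip_delta_free unfolding A(1) u_def by auto
      moreover have "\<psi> g = (\<Sum>x\<in>A. c x * u x j)"
        unfolding A(1) using A(3) g_eq lip_delta_apply[OF g(1)] by (intro sum.cong) auto
      ultimately have eq: "\<psi> g = V \<psi> j"
        by simp
      note \<psi>X = delta_span_free[OF \<psi>(1)]
      have "\<bar>\<phi> g - \<psi> g\<bar> \<le> ?n (\<lambda>f. \<phi> f - \<psi> f)"
        using dual_bound[OF free_dual[OF free_diff[OF \<phi> \<psi>X]] g] by simp
      moreover have "\<bar>V \<phi> j - V \<psi> j\<bar> \<le> ?n (\<lambda>f. \<phi> f - \<psi> f)"
        using has_sum_term_le[OF V_has_sum[OF free_diff[OF \<phi> \<psi>X]] j] V_diff[OF \<phi> \<psi>X] by simp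
      ultimately show ?thesis
        using eq \<psi>(2) by linarith
    qed
    then have "\<bar>\<phi> g - V \<phi> j\<bar> \<le> 0"
      by (rule field_le_epsilon) simp
    then show ?thesis
      by (simp add: g_def)
  qed
  have "ell1_rep M d \<Gamma> u coef"
  proof
    show "M \<noteq> {}"
      using base_point by blast
    show "(\<lambda>i. \<bar>u x i\<bar>) summable_on \<Gamma>" if "x \<in> M" for x
      using V_has_sum[OF lip_delta_free[OF that]] by (auto simp: u_def summable_on_def)
    show "((\<lambda>i. \<bar>u x i - u y i\<bar>) has_sum d x y) \<Gamma>" if "x \<in> M" "y \<in> M" for x y
      using u_dist that .
    show "\<bar>coef f i\<bar> \<le> L" if "lip_on M d L f" "0 \<le> L" "i \<in> \<Gamma>" for L f i
      using dual_bound[OF free_dual[OF U(1)[OF that(3)]] recenter_lip0[OF that(1)] lip_on_recenter[OF that(1)] that(2)]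
        U_norm[OF that(3)] by (simp add: coef_def)
    show "((\<lambda>i. coef f i * (u x i - u y i)) has_sum (f x - f y)) \<Gamma>"
      if "lip_on M d L f" "x \<in> M" "y \<in> M" for L f x y
      using repr[OF free_diff[OF lip_delta_free[OF that(2)] lip_delta_free[OF that(3)]] recenter_lip0[OF that(1)]]
        V_diff[OF lip_delta_free[OF that(2)] lip_delta_free[OF that(3)]]
        lip_delta_apply[OF recenter_lip0[OF that(1)]] that(2,3)
      by (simp add: coef_def u_def recenter_def mult.commute)
    show "coef (\<lambda>x. f x + g x) i = coef f i + coef g i"
      if "lip_on M d L f" "lip_on M d K g" "i \<in> \<Gamma>" for L f K g i
    proof -
      have "recenter (\<lambda>x. f x + g x) = (\<lambda>x. recenter f x + recenter g x)"
        by (auto simp: recenter_def)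
      then show ?thesis
        using dual_add[OF free_dual[OF U(1)[OF that(3)]] recenter_lip0[OF that(1)] recenter_lip0[OF that(2)]]
        by (simp add: coef_def)
    qed
    show "coef (\<lambda>x. c * f x) i = c * coef f i" if "lip_on M d L f" "i \<in> \<Gamma>" for L f i c
    proof -
      have "recenter (\<lambda>x. c * f x) = (\<lambda>x. c * recenter f x)"
        by (auto simp: recenter_def algebra_simps)
      then show ?thesis
        using dual_scale[OF free_dual[OF U(1)[OF that(2)]] recenter_lip0[OF that(1)]]
        by (simp add: coef_def)
    qed
    show "coef (\<lambda>x. u x j) i = (if i = j then 1 else 0)" if "i \<in> \<Gamma>" "j \<in> \<Gamma>" for i j
      using coordinate[OF U(1)[OF that(1)] that(2)] U(2)[OF that(1)] by (simp add: coef_def basis_def)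
  qed
  then show ?thesis
    by blast
qed

end

section \<open>The tree of a represented space\<close>

text \<open>The bound \<open>r m + r n\<close> arises when the sequence approaches something not yet
  known to be in \<open>M\<close>: a point of the tree or a height.\<close>

lemma (in Metric_space) mcomplete_limit:
  assumes "mcomplete" "\<And>n. \<sigma> n \<in> M" "\<And>m n. d (\<sigma> m) (\<sigma> n) \<le> r m + r n" "r \<longlonglongrightarrow> 0"
  obtains l where "l \<in> M" "(\<lambda>n. d (\<sigma> n) l) \<longlonglongrightarrow> 0"
proof -
  have "MCauchy \<sigma>"
    unfolding MCauchy_def
  proof (intro conjI allI impI)
    fix e :: real assume "e > 0"
    then obtain N where N: "\<And>n. n \<ge> N \<Longrightarrow> \<bar>r n\<bar> < e / 2"
      using LIMSEQ_D[OF assms(4), of "e / 2"] by auto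
    have "d (\<sigma> m) (\<sigma> n) < e" if "N \<le> m" "N \<le> n" for m n
      using N[OF that(1)] N[OF that(2)] assms(3)[of m n] by linarith
    then show "\<exists>N. \<forall>n n'. N \<le> n \<longrightarrow> N \<le> n' \<longrightarrow> d (\<sigma> n) (\<sigma> n') < e"
      by blast
  qed (use assms(2) in auto)
  then obtain l where "limitin mtopology \<sigma> l sequentially"
    using assms(1) unfolding mcomplete_def by blast
  then have l: "l \<in> M" "\<And>e. e > 0 \<Longrightarrow> \<exists>N. \<forall>n\<ge>N. \<sigma> n \<in> M \<and> d (\<sigma> n) l < e"
    unfolding limit_metric_sequentially by blast+
  have "(\<lambda>n. d (\<sigma> n) l) \<longlonglongrightarrow> 0"
  proof (rule LIMSEQ_I)
    fix e :: real assume "e > 0"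
    then show "\<exists>N. \<forall>n\<ge>N. norm (d (\<sigma> n) l - 0) < e"
      using l(2)[of e] by auto
  qed
  then show ?thesis
    using that l(1) by blast
qed

text \<open>\<open>extend\<close> makes \<open>T\<close> the hull of the image of \<open>M\<close>,
  reduces all traces to segments with ends in the image, and pushes the branches at a point of
  \<open>T\<close> out to points of \<open>M\<close>.\<close>

locale ell1_rep_tree = ell1_rep M d \<Gamma> u coef + T: four_point_space T dT
  for M :: "'a set" and d and \<Gamma> :: "'g set" and u coef and T :: "'t set" and dT +
  fixes f :: "'a \<Rightarrow> 't"
  assumes complete: "mcomplete"
    and tree: "real_tree T dT"
    and f: "f ` M \<subseteq> T" "\<And>x y. x \<in> M \<Longrightarrow> y \<in> M \<Longrightarrow> dT (f x) (f y) = d x y"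
    and extend: "\<And>p q. p \<in> T \<Longrightarrow> q \<in> T \<Longrightarrow>
      \<exists>x\<in>M. \<exists>y\<in>M. dT (f x) (f y) = dT (f x) p + dT p q + dT q (f y)"
begin

lemma f_mem: "x \<in> M \<Longrightarrow> f x \<in> T"
  using f(1) by blast

lemma tree_hull_eq: "tree_hull T dT (f ` M) = T"
proof
  show "tree_hull T dT (f ` M) \<subseteq> T"
    unfolding tree_hull_def using segment_iff[OF tree] f_mem by blast
  show "T \<subseteq> tree_hull T dT (f ` M)"
  proof
    fix p assume p: "p \<in> T"
    then obtain x y where xy: "x \<in> M" "y \<in> M" "dT (f x) (f y) = dT (f x) p + dT p p + dT p (f y)"
      using extend by blast
    then have "p \<in> segment T dT (f x) (f y)"
      using segment_iff[OF tree f_mem f_mem] p by simp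
    then show "p \<in> tree_hull T dT (f ` M)"
      unfolding tree_hull_def using xy by blast
  qed
qed

lemma trace_negligible_points:
  assumes xy: "x \<in> M" "y \<in> M"
  shows "negligible (segment_trace T dT (f x) (f y) (f ` M))"
proof -
  let ?g = "geodesic T dT (f x) (f y)"
  let ?K = "segment_trace T dT (f x) (f y) (f ` M)"
  note mem = f_mem[OF xy(1)] f_mem[OF xy(2)]
  have "\<exists>w. w \<in> M \<and> f w = ?g t" if "t \<in> ?K" for t
    using that by (auto simp: segment_trace_def)
  then obtain \<kappa> where \<kappa>: "\<And>t. t \<in> ?K \<Longrightarrow> \<kappa> t \<in> M" "\<And>t. t \<in> ?K \<Longrightarrow> f (\<kappa> t) = ?g t"
    by metis
  have iso: "dT (?g s) (?g t) = \<bar>s - t\<bar>" if "s \<in> {0..d x y}" "t \<in> {0..d x y}" for s t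
    using geodesic_in_geodesics[OF tree mem] f(2)[OF xy] that by (simp add: geodesics_def)
  have "?g 0 = f x" "?g (d x y) = f y"
    using geodesic_in_geodesics[OF tree mem] f(2)[OF xy] by (simp_all add: geodesics_def)
  then have ends: "0 \<in> ?K" "d x y \<in> ?K"
    using xy f(2)[OF xy] by (auto simp: segment_trace_def)
  have sub: "?K \<subseteq> {0..d x y}"
    using f(2)[OF xy] by (auto simp: segment_trace_def)
  show ?thesis
  proof (rule path_negligible[OF sub ends])
    show "\<kappa> ` ?K \<subseteq> M"
      using \<kappa>(1) by blast
    show "d (\<kappa> s) (\<kappa> t) = \<bar>s - t\<bar>" if "s \<in> ?K" "t \<in> ?K" for s t
      using f(2)[OF \<kappa>(1) \<kappa>(1)] \<kappa>(2) iso that sub by (metis subsetD)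
  qed
qed

text \<open>Prolonging the segment to ends in the image of \<open>M\<close> shifts the parameter by
  \<open>dT (f x) p\<close>.\<close>

lemma trace_negligible:
  assumes pq: "p \<in> T" "q \<in> T"
  shows "negligible (segment_trace T dT p q (f ` M))"
proof -
  obtain x y where xy: "x \<in> M" "y \<in> M" "dT (f x) (f y) = dT (f x) p + dT p q + dT q (f y)"
    using extend[OF pq] by blast
  note mem = f_mem[OF xy(1)] f_mem[OF xy(2)]
  have "segment_trace T dT p q (f ` M) \<subseteq>
    (+) (- dT (f x) p) ` segment_trace T dT (f x) (f y) (f ` M)"
  proof
    fix t assume "t \<in> segment_trace T dT p q (f ` M)"
    then have t: "t \<in> {0..dT p q}" "geodesic T dT p q t \<in> f ` M"
      by (auto simp: segment_trace_def)
    let ?w = "geodesic T dT p q t"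
    have w: "?w \<in> T" "dT p ?w = t" "dT ?w q = dT p q - t"
      using geodesic_point[OF tree pq t(1)] .
    have "dT (f x) ?w \<le> dT (f x) p + t" "dT ?w (f y) \<le> dT p q - t + dT q (f y)"
      "dT (f x) (f y) \<le> dT (f x) ?w + dT ?w (f y)"
      using T.triangle[OF mem(1) pq(1) w(1)] T.triangle[OF w(1) pq(2) mem(2)] T.triangle[OF mem(1) w(1) mem(2)] w
      by auto
    then have "dT (f x) ?w = dT (f x) p + t" "dT (f x) ?w + dT ?w (f y) = dT (f x) (f y)"
      using xy(3) by linarith+
    then have "geodesic T dT (f x) (f y) (dT (f x) p + t) = ?w"
      using geodesic_eq_between[OF tree mem w(1)] by simp
    moreover have "dT (f x) p + t \<in> {0..dT (f x) (f y)}"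
      using t(1) xy(3) T.nonneg[of "f x" p] T.nonneg[of q "f y"] by (simp del: T.nonneg)
    ultimately have "dT (f x) p + t \<in> segment_trace T dT (f x) (f y) (f ` M)"
      using t(2) by (simp add: segment_trace_def)
    then show "t \<in> (+) (- dT (f x) p) ` segment_trace T dT (f x) (f y) (f ` M)"
      by force
  qed
  then show ?thesis
    using negligible_subset negligible_translation[OF trace_negligible_points[OF xy(1,2)]] by blast
qed

lemma negligible_in_hull: "negligible_in_tree T dT (f ` M)"
proof -
  have "tree_measurable T dT (f ` M)"
    unfolding tree_measurable_def using f(1) trace_negligible negligible_imp_sets by blast
  moreover have "tree_measure T dT (f ` M) \<le> 0"
    unfolding tree_measure_def
  proof (rule SUP_least)
    fix R assume "R \<in> {R. finite R \<and> R \<subseteq> T \<times> T \<and> disjoint_family_on (\<lambda>(x, y). segment T dT x y) R}"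
    then have "R \<subseteq> T \<times> T"
      by blast
    then have "emeasure lebesgue (segment_trace T dT x y (f ` M)) = 0" if "(x, y) \<in> R" for x y
      using trace_negligible[of x y] that negligible_iff_emeasure0 negligible_imp_sets by blast
    then show "(\<Sum>(x, y)\<in>R. emeasure lebesgue (segment_trace T dT x y (f ` M))) \<le> 0"
      by (intro eq_refl sum.neutral) auto
  qed
  ultimately show ?thesis
    by (simp add: negligible_in_tree_def tree_hull_eq)
qed

lemma image_closed:
  assumes b: "b \<in> T" "\<And>e. e > 0 \<Longrightarrow> \<exists>v\<in>M. dT b (f v) < e"
  shows "b \<in> f ` M"
proof -
  have "\<exists>v. v \<in> M \<and> dT b (f v) < 1 / Suc n" for n
    using b(2)[of "1 / Suc n"] by auto
  then obtain \<sigma> where \<sigma>: "\<And>n. \<sigma> n \<in> M" "\<And>n. dT b (f (\<sigma> n)) < 1 / Suc n"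
    by metis
  have lim: "(\<lambda>n. 1 / real (Suc n)) \<longlonglongrightarrow> 0"
    by (rule LIMSEQ_Suc[OF lim_1_over_n])
  obtain l where l: "l \<in> M" "(\<lambda>n. d (\<sigma> n) l) \<longlonglongrightarrow> 0"
  proof (rule mcomplete_limit[OF complete \<sigma>(1) _ lim])
    show "d (\<sigma> m) (\<sigma> n) \<le> 1 / real (Suc m) + 1 / real (Suc n)" for m n
      using T.triangle[OF f_mem[OF \<sigma>(1)] b(1) f_mem[OF \<sigma>(1)], of m n] \<sigma>(2)[of m] \<sigma>(2)[of n]
        f(2)[OF \<sigma>(1) \<sigma>(1), of m n] T.commute[of b "f (\<sigma> m)"] by linarith
  qed
  have "dT b (f l) \<le> 1 / real (Suc n) + d (\<sigma> n) l" for n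
    using T.triangle[OF b(1) f_mem[OF \<sigma>(1)[of n]] f_mem[OF l(1)]] \<sigma>(2)[of n] f(2)[OF \<sigma>(1)[of n] l(1)]
    by linarith
  moreover have "(\<lambda>n. 1 / real (Suc n) + d (\<sigma> n) l) \<longlonglongrightarrow> 0 + 0"
    by (intro tendsto_add lim l(2))
  ultimately have "dT b (f l) \<le> 0"
    by (intro LIMSEQ_le_const[of "\<lambda>n. 1 / real (Suc n) + d (\<sigma> n) l"]) auto
  then have "dT b (f l) = 0"
    using T.nonneg[of b "f l"] by linarith
  then have "b = f l"
    using b(1) f_mem[OF l(1)] by simp
  then show ?thesis
    using l(1) by blast
qed

text \<open>On a segment through \<open>x\<close> with ends in the image of \<open>M\<close>, at
  least one end lies beyond \<open>x\<close> as seen from \<open>b\<close>, since the distance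
  formula attains its maximum there.\<close>

lemma extend_past:
  assumes "x \<in> T" "b \<in> T"
  shows "\<exists>p\<in>M. dT (f p) x + dT x b = dT (f p) b"
proof -
  obtain p q where pq: "p \<in> M" "q \<in> M" "dT (f p) (f q) = dT (f p) x + dT x x + dT x (f q)"
    using extend[OF assms(1,1)] by blast
  then have "dT x b = max (dT (f p) b - dT (f p) x) (dT (f q) b - dT x (f q))"
    using T.dist_from_between[OF f_mem f_mem, of p q x b] assms by simp
  then have "dT (f p) x + dT x b = dT (f p) b \<or> dT (f q) x + dT x b = dT (f q) b"
    using T.commute[of x "f q"] by linarith
  then show ?thesis
    using pq by blast
qed

lemma branching_points_mem: "branching_points T dT \<subseteq> f ` M"
proof
  fix b assume "b \<in> branching_points T dT"
  then obtain x y w where b: "b \<in> T" and xyw: "x \<in> T" "y \<in> T" "w \<in> T" "x \<noteq> b" "y \<noteq> b" "w \<noteq> b"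
    and seg: "segment T dT x b \<inter> segment T dT y b = {b}" "segment T dT x b \<inter> segment T dT w b = {b}"
      "segment T dT y b \<inter> segment T dT w b = {b}"
    unfolding branching_points_def by blast
  \<comment> \<open>The point \<open>x\<close> is replaced by a point of \<open>M\<close> beyond it,
    and whatever \<open>b\<close> separates from \<open>x\<close> it still separates from that
    point.\<close>
  have push: "\<exists>p\<in>M. f p \<noteq> b \<and> (\<forall>v\<in>T. dT x b + dT b v = dT x v \<longrightarrow> dT (f p) b + dT b v = dT (f p) v)"
    if x: "x \<in> T" "x \<noteq> b" for x
  proof -
    obtain p where p: "p \<in> M" "dT (f p) x + dT x b = dT (f p) b"
      using extend_past[OF x(1) b] by blast
    have "0 < dT x b"
      using x b by simp
    then have "0 < dT (f p) b"
      using p(2) T.nonneg[of "f p" x] by linarith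
    then have "f p \<noteq> b"
      using b by auto
    moreover have "dT (f p) b + dT b v = dT (f p) v" if "v \<in> T" "dT x b + dT b v = dT x v" for v
      using T.between_extend[OF f_mem[OF p(1)] x(1) b that(1) x(2) p(2) that(2)] .
    ultimately show ?thesis
      using p(1) by blast
  qed
  have sym: "dT x b + dT b v = dT x v \<Longrightarrow> dT v b + dT b x = dT v x" for x v
    using T.commute[of x b] T.commute[of v b] T.commute[of x v] by linarith
  obtain p where p: "p \<in> M" "f p \<noteq> b"
    "\<And>v. v \<in> T \<Longrightarrow> dT x b + dT b v = dT x v \<Longrightarrow> dT (f p) b + dT b v = dT (f p) v"
    using push[OF xyw(1,4)] by blast
  obtain q where q: "q \<in> M" "f q \<noteq> b"
    "\<And>v. v \<in> T \<Longrightarrow> dT y b + dT b v = dT y v \<Longrightarrow> dT (f q) b + dT b v = dT (f q) v"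
    using push[OF xyw(2,5)] by blast
  obtain r where r: "r \<in> M" "f r \<noteq> b"
    "\<And>v. v \<in> T \<Longrightarrow> dT w b + dT b v = dT w v \<Longrightarrow> dT (f r) b + dT b v = dT (f r) v"
    using push[OF xyw(3,6)] by blast
  have xy: "dT x b + dT b y = dT x y" and xw: "dT x b + dT b w = dT x w" and yw: "dT y b + dT b w = dT y w"
    using branching_point_between[OF tree _ _ b] xyw seg by auto
  have pq: "dT (f q) b + dT b (f p) = dT (f q) (f p)"
    by (rule q(3)[OF f_mem[OF p(1)] sym[OF p(3)[OF xyw(2) xy]]])
  have pr: "dT (f r) b + dT b (f p) = dT (f r) (f p)"
    by (rule r(3)[OF f_mem[OF p(1)] sym[OF p(3)[OF xyw(3) xw]]])
  have qr: "dT (f r) b + dT b (f q) = dT (f r) (f q)"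
    by (rule r(3)[OF f_mem[OF q(1)] sym[OF q(3)[OF xyw(3) yw]]])
  show "b \<in> f ` M"
  proof (rule ccontr)
    assume "b \<notin> f ` M"
    then obtain \<epsilon> where \<epsilon>: "\<epsilon> > 0" "\<And>v. v \<in> M \<Longrightarrow> \<epsilon> \<le> dT b (f v)"
      using image_closed[OF b] by (meson not_le)
    define \<beta> where "\<beta> = (\<lambda>v. dT b (f v))"
    have \<beta>: "\<And>v. v \<in> M \<Longrightarrow> \<epsilon> \<le> \<beta> v"
      using \<epsilon> by (simp add: \<beta>_def)
    have "lip_on M d 1 \<beta>"
      unfolding lip_on_def
    proof (intro ballI)
      fix v v' assume "v \<in> M" "v' \<in> M"
      then show "\<bar>\<beta> v - \<beta> v'\<bar> \<le> 1 * d v v'"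
        using T.triangle[OF b f_mem f_mem, of v v'] T.triangle[OF b f_mem f_mem, of v' v] f(2)[of v v']
          T.commute[of "f v" "f v'"] by (simp add: \<beta>_def abs_le_iff)
    qed
    note lip = this
    \<comment> \<open>Lying on the same side of \<open>b\<close>, an equivalence relation on
      \<open>M\<close> by \<open>not_between_trans\<close>.\<close>
    define same where "same = (\<lambda>v v'. d v v' < \<beta> v + \<beta> v')"
    have cross: "d v v' = \<beta> v + \<beta> v'" if "v \<in> M" "v' \<in> M" "\<not> same v v'" for v v'
      using T.triangle[OF f_mem b f_mem, of v v'] that f(2)[of v v'] T.commute[of "f v" b]
      by (simp add: same_def \<beta>_def)
    have sym: "same v v' \<longleftrightarrow> same v' v" for v v'
      using commute[of v v'] by (auto simp: same_def)
    have trans: "same v v''" if "v \<in> M" "v' \<in> M" "v'' \<in> M" "same v v'" "same v' v''" for v v' v''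
      using T.not_between_trans[OF f_mem f_mem f_mem b, of v v' v''] that f(2)
        T.commute[of b "f v"] T.commute[of b "f v'"] by (simp add: same_def \<beta>_def)
    have diff: "\<not> same q p" "\<not> same r p" "\<not> same r q"
      using pq pr qr f(2) p(1) q(1) r(1) T.commute[of b "f q"] T.commute[of b "f r"]
      by (simp_all add: same_def \<beta>_def)
    have refl: "same v v" if "v \<in> M" for v
      using \<beta>[OF that] \<epsilon>(1) that by (simp add: same_def)
    define P where "P = {v \<in> M. same v p}"
    define Q where "Q = {v \<in> M. same v q}"
    \<comment> \<open>The remainder may consist of several branches at \<open>b\<close>; what counts
      is that \<open>b\<close> lies between points of different parts.\<close>
    define R where "R = M - P - Q"
    have PQ: False if "v \<in> P" "v' \<in> Q" "same v v'" for v v'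
      using that trans[of q v' v] trans[of q v p] sym diff(1) p(1) q(1) unfolding P_def Q_def by blast
    have PR: False if "v \<in> P" "v' \<in> R" "same v v'" for v v'
      using that trans[of v' v p] sym p(1) unfolding P_def R_def by blast
    have QR: False if "v \<in> Q" "v' \<in> R" "same v v'" for v v'
      using that trans[of v' v q] sym q(1) unfolding Q_def R_def by blast
    show False
    proof (rule no_missing_branching_point[OF \<epsilon>(1) \<beta> lip, of P Q R p q r])
      show "M = P \<union> Q \<union> R" "P \<inter> R = {}" "Q \<inter> R = {}"
        by (auto simp: P_def Q_def R_def)
      show "P \<inter> Q = {}"
        using PQ refl unfolding P_def by blast
      show "d v v' = \<beta> v + \<beta> v'" if "v \<in> P" "v' \<in> Q \<union> R" for v v'
        using cross[of v v'] PQ PR that unfolding P_def Q_def R_def by blast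
      show "d v v' = \<beta> v + \<beta> v'" if "v \<in> Q" "v' \<in> R" for v v'
        using cross[of v v'] QR that unfolding P_def Q_def R_def by blast
      show "p \<in> P" "q \<in> Q"
        using refl p(1) q(1) by (auto simp: P_def Q_def)
      show "r \<in> R"
        using diff r(1) by (simp add: P_def Q_def R_def)
    qed
  qed
qed

end

lemma (in ell1_rep) tree_embedding:
  assumes "mcomplete"
  shows "\<exists>(T :: ('a \<Rightarrow> real) set) dT. negligible_subset_with_branching M d T dT"
proof -
  interpret four_point_space M d
    by (rule four_point_space)
  obtain T :: "('a \<Rightarrow> real) set" and dT f where T: "real_tree T dT" "f ` M \<subseteq> T"
    "\<And>x y. x \<in> M \<Longrightarrow> y \<in> M \<Longrightarrow> dT (f x) (f y) = d x y"
    "\<And>p q. p \<in> T \<Longrightarrow> q \<in> T \<Longrightarrow>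
      \<exists>x\<in>M. \<exists>y\<in>M. dT (f x) (f y) = dT (f x) p + dT p q + dT q (f y)"
    using real_tree_extension by blast
  interpret ell1_rep_tree M d \<Gamma> u coef T dT f
    using T assms real_tree_four_point[OF T(1)] ell1_rep_axioms
    by (auto intro!: ell1_rep_tree.intro ell1_rep_tree_axioms.intro)
  have "negligible_subset_with_branching M d T dT"
    unfolding negligible_subset_with_branching_def
    using T(1-3) negligible_in_hull branching_points_mem by blast
  then show ?thesis
    by blast
qed

section \<open>Gaps in rooted null spaces\<close>

text \<open>What is left of the tree after rooting it at \<open>z\<close>: \<open>median\<close>
  places in \<open>M\<close> the point where the segments from the root to \<open>x\<close> and
  \<open>y\<close> part, and \<open>null\<close> says that the heights of points of \<open>M\<close>
  on the segment to \<open>x\<close> form a null set.\<close>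

locale rooted_null_space = four_point_space M d + pointed_metric_space M d z
  for M :: "'a set" and d and z +
  assumes complete: "mcomplete"
    and median: "\<And>x y. x \<in> M \<Longrightarrow> y \<in> M \<Longrightarrow>
      \<exists>b\<in>M. d x b + d b y = d x y \<and> d z b + d b x = d z x \<and> d z b + d b y = d z y"
    and null: "\<And>x. x \<in> M \<Longrightarrow> negligible {d z w | w. w \<in> M \<and> d z w + d w x = d z x}"
begin

definition below :: "'a \<Rightarrow> 'a \<Rightarrow> bool" where
  "below w x \<longleftrightarrow> w \<in> M \<and> x \<in> M \<and> d z w + d w x = d z x"

definition gap :: "'a \<Rightarrow> 'a \<Rightarrow> bool" where
  "gap p e \<longleftrightarrow> below p e \<and> p \<noteq> e \<and> (\<forall>w. below p w \<and> below w e \<longrightarrow> w = p \<or> w = e)"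

text \<open>The points below a given one form a chain, so a top determines its bottom, while one
  bottom may belong to many gaps. Hence tops index the gaps.\<close>

definition gap_tops :: "'a set" where
  "gap_tops = {e. \<exists>p. gap p e}"

definition gap_bottom :: "'a \<Rightarrow> 'a" where
  "gap_bottom e = (SOME p. gap p e)"

text \<open>As a function of \<open>x\<close> it changes only across the gap \<open>e\<close>; as a
  family in \<open>e\<close> it is the position of \<open>x\<close> in \<open>ell1\<close>.\<close>

definition gap_coord :: "'a \<Rightarrow> 'a \<Rightarrow> real" where
  "gap_coord e x = (if below e x then d z e - d z (gap_bottom e) else 0)"

lemma below_mem: "below w x \<Longrightarrow> w \<in> M" "below w x \<Longrightarrow> x \<in> M"
  by (auto simp: below_def)

lemma below_refl: "x \<in> M \<Longrightarrow> below x x"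
  by (simp add: below_def)

lemma below_root: "x \<in> M \<Longrightarrow> below z x"
  using base_point by (simp add: below_def)

lemma below_dist: "below w x \<Longrightarrow> d w x = d z x - d z w"
  by (auto simp: below_def)

lemma below_le: "below w x \<Longrightarrow> d z w \<le> d z x"
  using below_dist[of w x] nonneg[of w x] by linarith

lemma below_trans:
  assumes "below v w" "below w x"
  shows "below v x"
proof -
  have mem: "v \<in> M" "w \<in> M" "x \<in> M"
    using assms by (auto simp: below_def)
  then have "d v x \<le> d v w + d w x" "d z x \<le> d z v + d v x"
    using triangle base_point by auto
  then show ?thesis
    using assms mem unfolding below_def by linarith
qed

lemma below_linear: "below v x \<Longrightarrow> below w x \<Longrightarrow> d z v \<le> d z w \<Longrightarrow> below v w"
  using between_chain[of z x v w] base_point by (auto simp: below_def)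

lemma below_eq: "below w x \<Longrightarrow> d z x \<le> d z w \<Longrightarrow> w = x"
  using below_dist[of w x] nonneg[of w x] below_mem[of w x] zero[of w x] by linarith

lemma below_root_eq: "below w z \<Longrightarrow> w = z"
  using below_eq[of w z] base_point by simp

lemma gap_bottom: "e \<in> gap_tops \<Longrightarrow> gap (gap_bottom e) e"
  unfolding gap_bottom_def by (rule someI_ex) (simp add: gap_tops_def)

lemma gap_bottom_below: "e \<in> gap_tops \<Longrightarrow> below (gap_bottom e) e"
  using gap_bottom by (simp add: gap_def)

lemma gap_tops_mem: "e \<in> gap_tops \<Longrightarrow> e \<in> M" "e \<in> gap_tops \<Longrightarrow> gap_bottom e \<in> M"
  using gap_bottom_below below_mem by blast+

lemma gap_length_pos: "e \<in> gap_tops \<Longrightarrow> d z (gap_bottom e) < d z e"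
  using gap_bottom[of e] below_eq unfolding gap_def by (meson not_le)

lemma gap_bottom_dist: "e \<in> gap_tops \<Longrightarrow> d (gap_bottom e) e = d z e - d z (gap_bottom e)"
  using below_dist gap_bottom_below .

lemma below_gap_bottom:
  assumes "e \<in> gap_tops" "below w e" "w \<noteq> e"
  shows "below w (gap_bottom e)"
proof (rule ccontr)
  assume not: "\<not> below w (gap_bottom e)"
  then have "d z (gap_bottom e) < d z w"
    using below_linear[OF assms(2) gap_bottom_below[OF assms(1)]] by linarith
  then have "below (gap_bottom e) w"
    using below_linear[OF gap_bottom_below[OF assms(1)] assms(2)] by simp
  then have "w = gap_bottom e"
    using gap_bottom[OF assms(1)] assms(2,3) unfolding gap_def by blast
  then show False
    using not below_refl gap_tops_mem(2)[OF assms(1)] by simp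
qed

text \<open>These gaps are disjoint intervals of the chain from \<open>b\<close> to
  \<open>x\<close>; the induction splits off the topmost one. \<open>H\<close> is kept general
  because it is used with the height itself and with a multiple of the height plus or minus a
  Lipschitz function.\<close>

lemma sum_gaps_le:
  assumes "finite F" "F \<subseteq> gap_tops" "below b x" "\<And>e. e \<in> F \<Longrightarrow> below e x \<and> \<not> below e b"
    and "\<And>p q. below p q \<Longrightarrow> below q x \<Longrightarrow> H p \<le> (H q :: real)"
  shows "(\<Sum>e\<in>F. H e - H (gap_bottom e)) \<le> H x - H b"
  using assms
proof (induction "card F" arbitrary: F x)
  case 0
  then show ?case
    using below_refl below_mem by simp
next
  case (Suc n)
  have "Max (d z ` F) \<in> d z ` F"
    using Suc.hyps(2) Suc.prems(1) by (intro Max_in) auto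
  then obtain e where e: "e \<in> F" "d z e = Max (d z ` F)"
    by auto
  have max: "d z e' \<le> d z e" if "e' \<in> F" for e'
    using e(2) that Suc.prems(1) by simp
  let ?p = "gap_bottom e"
  have eE: "e \<in> gap_tops" and ex: "below e x" "\<not> below e b"
    using e Suc.prems(2,4) by auto
  have px: "below ?p x"
    using below_trans[OF gap_bottom_below[OF eE] ex(1)] .
  have "below b e" "b \<noteq> e"
    using below_linear[OF ex(1) Suc.prems(3)] below_linear[OF Suc.prems(3) ex(1)] ex(2)
      below_refl[OF below_mem(1)[OF Suc.prems(3)]] by (meson linear, blast)
  then have bp: "below b ?p"
    using below_gap_bottom[OF eE] by blast
  have "(\<Sum>e\<in>F - {e}. H e - H (gap_bottom e)) \<le> H ?p - H b"
  proof (rule Suc.hyps(1))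
    show "n = card (F - {e})"
      using Suc.hyps(2) Suc.prems(1) e(1) by simp
    show "below e' ?p \<and> \<not> below e' b" if "e' \<in> F - {e}" for e'
    proof -
      have "below e' e"
        using below_linear[OF _ ex(1) max] Suc.prems(4) that by blast
      then show ?thesis
        using below_gap_bottom[OF eE] that Suc.prems(4) by blast
    qed
    show "H p \<le> H q" if "below p q" "below q ?p" for p q
      using Suc.prems(5)[OF that(1) below_trans[OF that(2) px]] .
  qed (use Suc.prems bp in auto)
  moreover have "(\<Sum>e\<in>F. H e - H (gap_bottom e)) = (H e - H ?p) + (\<Sum>e\<in>F - {e}. H e - H (gap_bottom e))"
    using Suc.prems(1) e(1) by (simp add: sum.remove)
  moreover have "H e \<le> H x"
    using Suc.prems(5) ex(1) below_refl[OF below_mem(2)[OF ex(1)]] by blast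
  ultimately show ?case
    by linarith
qed

text \<open>Gaps below the median \<open>b\<close> cancel, the others fit between \<open>b\<close>
  and \<open>x\<close> or between \<open>b\<close> and \<open>y\<close>. That \<open>b\<close>
  belongs to \<open>M\<close> is the contribution of the branching points: no gap straddles it. The
  bound also shows that slopes in [-1, 1] on finitely many gaps may be chosen freely.\<close>

lemma sum_gap_coord_le:
  assumes F: "finite F" "F \<subseteq> gap_tops" and xy: "x \<in> M" "y \<in> M"
  shows "(\<Sum>e\<in>F. \<bar>gap_coord e x - gap_coord e y\<bar>) \<le> d x y"
proof -
  obtain b where b: "b \<in> M" "d x b + d b y = d x y" "d z b + d b x = d z x" "d z b + d b y = d z y"
    using median[OF xy] by blast
  have bb: "below b x" "below b y"
    using b xy by (auto simp: below_def)
  define len where "len = (\<lambda>e. d z e - d z (gap_bottom e))"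
  have len: "0 \<le> len e" if "e \<in> F" for e
    using gap_length_pos that F(2) by (fastforce simp: len_def)
  define above where "above = (\<lambda>w. {e \<in> F. below e w \<and> \<not> below e b})"
  have part: "(\<Sum>e\<in>F. if e \<in> above w then len e else 0) \<le> d z w - d z b" if "below b w" for w
  proof -
    have "(\<Sum>e\<in>F. if e \<in> above w then len e else 0) = sum len (above w)"
      using F(1) by (simp add: above_def sum.inter_filter flip: sum.inter_restrict)
    also have "\<dots> \<le> d z w - d z b"
      unfolding len_def using F that below_le by (intro sum_gaps_le) (auto simp: above_def)
    finally show ?thesis .
  qed
  have "\<bar>gap_coord e x - gap_coord e y\<bar>
      \<le> (if e \<in> above x then len e else 0) + (if e \<in> above y then len e else 0)" if e: "e \<in> F" for e
  proof (cases "below e b")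
    case True
    then have "below e x" "below e y"
      using below_trans bb by blast+
    then show ?thesis
      using len[OF e] by (simp add: gap_coord_def)
  next
    case False
    then show ?thesis
      using len[OF e] e by (auto simp: gap_coord_def above_def len_def)
  qed
  then have "(\<Sum>e\<in>F. \<bar>gap_coord e x - gap_coord e y\<bar>)
      \<le> (\<Sum>e\<in>F. (if e \<in> above x then len e else 0) + (if e \<in> above y then len e else 0))"
    by (rule sum_mono)
  also have "\<dots> \<le> (d z x - d z b) + (d z y - d z b)"
    unfolding sum.distrib using part[OF bb(1)] part[OF bb(2)] by (rule add_mono)
  also have "\<dots> = d x y"
    using b(2-4) commute[of x b] by linarith
  finally show ?thesis .
qed

section \<open>The gaps exhaust the length of every segment from the root\<close>

lemma heights_closed:
  assumes x: "x \<in> M"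
  shows "closed {d z w | w. below w x}"
  unfolding closed_sequential_limits
proof (intro allI impI)
  fix t l assume "(\<forall>n. t n \<in> {d z w | w. below w x}) \<and> t \<longlonglongrightarrow> l"
  then have "\<forall>n. \<exists>w. t n = d z w \<and> below w x" and lim: "t \<longlonglongrightarrow> l"
    by auto
  then obtain w where w: "\<And>n. t n = d z (w n)" "\<And>n. below (w n) x"
    by metis
  have mem: "w n \<in> M" for n
    using w(2) below_mem by blast
  have "(\<lambda>n. \<bar>t n - l\<bar>) \<longlonglongrightarrow> 0"
    using lim by (simp add: LIM_zero tendsto_rabs_zero)
  moreover have "d (w m) (w n) \<le> \<bar>t m - l\<bar> + \<bar>t n - l\<bar>" for m n
  proof -
    have "d (w m) (w n) = \<bar>t m - t n\<bar>"
      using below_dist[OF below_linear[OF w(2)[of m] w(2)[of n]]]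
        below_dist[OF below_linear[OF w(2)[of n] w(2)[of m]]] w(1) commute[of "w m" "w n"]
      by (cases "t m \<le> t n") auto
    then show ?thesis
      by linarith
  qed
  ultimately obtain v where v: "v \<in> M" "(\<lambda>n. d (w n) v) \<longlonglongrightarrow> 0"
    using mcomplete_limit[where \<sigma> = w and r = "\<lambda>n. \<bar>t n - l\<bar>"] complete mem by blast
  have "\<bar>d z v - t n\<bar> \<le> d (w n) v" for n
    using triangle[of z "w n" v] triangle[of z v "w n"] commute[of v "w n"] mem[of n] v(1) base_point w(1)
    by (simp add: abs_le_iff)
  then have "(\<lambda>n. d z v - t n) \<longlonglongrightarrow> 0"
    using Lim_null_comparison[OF _ v(2), of "\<lambda>n. d z v - t n"] by simp
  then have "(\<lambda>n. d z v - (d z v - t n)) \<longlonglongrightarrow> d z v - 0"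
    by (intro tendsto_intros)
  then have l: "l = d z v"
    using lim LIMSEQ_unique by fastforce
  have "d z v + d v x - d z x \<le> 2 * d (w n) v" for n
    using triangle[of z "w n" v] triangle[of v "w n" x] commute[of v "w n"] mem[of n] v(1) base_point x w(2)[of n]
    by (simp add: below_def)
  moreover have "(\<lambda>n. 2 * d (w n) v) \<longlonglongrightarrow> 2 * 0"
    by (intro tendsto_intros v(2))
  ultimately have "d z v + d v x - d z x \<le> 2 * 0"
    using LIMSEQ_le_const by blast
  then have "below v x"
    using triangle[OF base_point v(1) x] v(1) x by (simp add: below_def)
  then show "l \<in> {d z w | w. below w x}"
    using l by blast
qed

text \<open>As the set of heights is closed, the nearest heights on either side of \<open>t\<close>
  are attained, and the points attaining them bound a gap.\<close>

lemma gap_at: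
  assumes x: "x \<in> M" and t: "0 \<le> t" "t \<le> d z x" "t \<notin> {d z w | w. below w x}"
  shows "\<exists>e\<in>gap_tops. below e x \<and> d z (gap_bottom e) < t \<and> t < d z e"
proof -
  let ?K = "{d z w | w. below w x}"
  have K: "0 \<in> ?K" "d z x \<in> ?K"
    using below_root[OF x] below_refl[OF x] base_point by force+
  have "Sup (?K \<inter> {..t}) \<in> ?K \<inter> {..t}"
    using K(1) t(1) heights_closed[OF x] by (intro closed_contains_Sup) (auto intro!: bdd_aboveI)
  then obtain p where p: "below p x" "d z p = Sup (?K \<inter> {..t})" "d z p \<le> t"
    by auto
  have "Inf (?K \<inter> {t..}) \<in> ?K \<inter> {t..}"
    using K(2) t(2) heights_closed[OF x] by (intro closed_contains_Inf) (auto intro!: bdd_belowI)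
  then obtain e where e: "below e x" "d z e = Inf (?K \<inter> {t..})" "t \<le> d z e"
    by auto
  have strict: "d z p < t" "t < d z e"
    using p e t(3) by (auto simp: order_less_le)
  have between: "w = p \<or> w = e" if "below p w" "below w e" for w
  proof (cases "d z w \<le> t")
    case True
    then have "d z w \<le> d z p"
      using below_trans[OF that(2) e(1)] unfolding p(2) by (intro cSup_upper) (auto intro!: bdd_aboveI)
    then show ?thesis
      using below_eq[OF that(1)] by simp
  next
    case False
    then have "d z e \<le> d z w"
      using below_trans[OF that(2) e(1)] unfolding e(2) by (intro cInf_lower) (auto intro!: bdd_belowI)
    then show ?thesis
      using below_eq[OF that(2)] by simp
  qed
  have pe: "below p e"
    using below_linear[OF p(1) e(1)] strict by simp
  then have gap: "gap p e"
    using between strict unfolding gap_def by auto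
  then have eE: "e \<in> gap_tops"
    by (auto simp: gap_tops_def)
  have "below p (gap_bottom e)"
    using below_gap_bottom[OF eE pe] gap by (auto simp: gap_def)
  then have "gap_bottom e = p"
    using gap gap_bottom[OF eE] unfolding gap_def by blast
  then show ?thesis
    using eE e(1) strict by blast
qed

text \<open>An open set exceeding the null set of heights by measure at most \<epsilon> leaves a
  compact part of the segment, which finitely many gaps cover.\<close>

lemma gaps_fill:
  assumes x: "x \<in> M" and \<epsilon>: "0 < \<epsilon>"
  shows "\<exists>F. finite F \<and> F \<subseteq> {e \<in> gap_tops. below e x} \<and>
    d z x - \<epsilon> \<le> (\<Sum>e\<in>F. d z e - d z (gap_bottom e))"
proof -
  let ?K = "{d z w | w. below w x}"
  let ?I = "\<lambda>e. {d z (gap_bottom e)<..<d z e}"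
  have "?K = {d z w | w. w \<in> M \<and> d z w + d w x = d z x}"
    using x by (auto simp: below_def)
  then have K: "negligible ?K"
    using null[OF x] by simp
  then have "?K \<in> sets lebesgue"
    by (rule negligible_imp_sets)
  then obtain U where U: "open U" "?K \<subseteq> U" "U - ?K \<in> lmeasurable" "emeasure lebesgue (U - ?K) < ennreal \<epsilon>"
    using sets_lebesgue_outer_open[OF _ \<epsilon>] by blast
  have small: "measure lebesgue (U - ?K) \<le> \<epsilon>"
    using U(3,4) by (simp add: emeasure_eq_measure2 fmeasurableD2 ennreal_less_iff)
  have "compact ({0..d z x} - U)"
    using U(1) by (intro compact_diff) auto
  then obtain F where F: "finite F" "F \<subseteq> {e \<in> gap_tops. below e x}" "{0..d z x} - U \<subseteq> (\<Union>e\<in>F. ?I e)"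
  proof (rule compactE_image)
    show "{0..d z x} - U \<subseteq> (\<Union>e\<in>{e \<in> gap_tops. below e x}. ?I e)"
    proof
      fix t assume "t \<in> {0..d z x} - U"
      then have "0 \<le> t" "t \<le> d z x" "t \<notin> ?K"
        using U(2) by auto
      then show "t \<in> (\<Union>e\<in>{e \<in> gap_tops. below e x}. ?I e)"
        using gap_at[OF x] by fastforce
    qed
  qed auto
  have meas: "(\<Union>e\<in>F. ?I e) \<in> lmeasurable" "?K \<in> lmeasurable"
    using F(1) K by (auto intro!: fmeasurable.finite_UN simp: negligible_iff_measure)
  have "{0..d z x} \<subseteq> (\<Union>e\<in>F. ?I e) \<union> (?K \<union> (U - ?K))"
    using F(3) by auto
  then have "measure lebesgue {0..d z x} \<le> measure lebesgue ((\<Union>e\<in>F. ?I e) \<union> (?K \<union> (U - ?K)))"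
    by (intro measure_mono_fmeasurable fmeasurable.Un meas U(3)) simp_all
  also have "\<dots> \<le> measure lebesgue (\<Union>e\<in>F. ?I e) + (measure lebesgue ?K + measure lebesgue (U - ?K))"
    by (intro order_trans[OF measure_Un_le] add_left_mono measure_Un_le sets.Un fmeasurableD meas U(3))
  also have "\<dots> \<le> (\<Sum>e\<in>F. measure lebesgue (?I e)) + (0 + \<epsilon>)"
    using F(1) small K by (intro add_mono measure_UNION_le) (auto simp: negligible_iff_measure)
  also have "(\<Sum>e\<in>F. measure lebesgue (?I e)) = (\<Sum>e\<in>F. d z e - d z (gap_bottom e))"
    using F(2) gap_length_pos by (intro sum.cong) (fastforce simp: less_imp_le)+
  finally have "d z x - \<epsilon> \<le> (\<Sum>e\<in>F. d z e - d z (gap_bottom e))"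
    by simp
  then show ?thesis
    using F(1,2) by blast
qed

text \<open>\<open>gaps_fill\<close> bounds the finite sums from below; from above they are bounded
  by \<open>sum_gap_coord_le\<close> against the root, where all coordinates vanish.\<close>

lemma gap_coord_has_sum:
  assumes x: "x \<in> M"
  shows "((\<lambda>e. gap_coord e x) has_sum d z x) gap_tops"
  unfolding has_sum_def
proof (rule tendstoI)
  fix \<epsilon> :: real assume "\<epsilon> > 0"
  then obtain F where F: "finite F" "F \<subseteq> {e \<in> gap_tops. below e x}"
    "d z x - \<epsilon> / 2 \<le> (\<Sum>e\<in>F. d z e - d z (gap_bottom e))"
    using gaps_fill[OF x, of "\<epsilon> / 2"] by auto
  have coord: "0 \<le> gap_coord e x" "gap_coord e z = 0" if "e \<in> gap_tops" for e
  proof -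
    have "\<not> below e z"
      using below_root_eq[of e] gap_bottom_below[OF that] below_root_eq gap_length_pos[OF that] by fastforce
    then show "0 \<le> gap_coord e x" "gap_coord e z = 0"
      using gap_length_pos[OF that] by (auto simp: gap_coord_def)
  qed
  show "\<forall>\<^sub>F F in finite_subsets_at_top gap_tops. dist (\<Sum>e\<in>F. gap_coord e x) (d z x) < \<epsilon>"
    unfolding eventually_finite_subsets_at_top
  proof (intro exI[of _ F] conjI allI impI)
    fix G assume G: "finite G \<and> F \<subseteq> G \<and> G \<subseteq> gap_tops"
    have "(\<Sum>e\<in>F. d z e - d z (gap_bottom e)) = (\<Sum>e\<in>F. gap_coord e x)"
      using F(2) by (intro sum.cong) (auto simp: gap_coord_def)
    also have "\<dots> \<le> (\<Sum>e\<in>G. gap_coord e x)"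
      using G coord by (intro sum_mono2) auto
    finally have "d z x - \<epsilon> / 2 \<le> (\<Sum>e\<in>G. gap_coord e x)"
      using F(3) by simp
    moreover have "(\<Sum>e\<in>G. gap_coord e x) \<le> d z x"
    proof -
      have "(\<Sum>e\<in>G. gap_coord e x) = (\<Sum>e\<in>G. \<bar>gap_coord e x - gap_coord e z\<bar>)"
        using coord G by (intro sum.cong) auto
      also have "\<dots> \<le> d x z"
        using G x base_point by (intro sum_gap_coord_le) auto
      finally show ?thesis
        by (simp add: commute)
    qed
    ultimately show "dist (\<Sum>e\<in>G. gap_coord e x) (d z x) < \<epsilon>"
      using \<open>\<epsilon> > 0\<close> unfolding dist_real_def by linarith
  qed (use F in auto)
qed

section \<open>Lipschitz functions as sums of increments over the gaps\<close>

definition slope :: "('a \<Rightarrow> real) \<Rightarrow> 'a \<Rightarrow> real" where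
  "slope f e = (f e - f (gap_bottom e)) / (d z e - d z (gap_bottom e))"

lemma slope_bound:
  assumes "lip_on M d L f" "e \<in> gap_tops"
  shows "\<bar>slope f e\<bar> \<le> L"
proof -
  have "\<bar>f e - f (gap_bottom e)\<bar> \<le> L * d e (gap_bottom e)"
    using assms gap_tops_mem unfolding lip_on_def by blast
  also have "d e (gap_bottom e) = d z e - d z (gap_bottom e)"
    using gap_bottom_dist[OF assms(2)] by (simp add: commute)
  finally show ?thesis
    using gap_length_pos[OF assms(2)] by (simp add: slope_def abs_divide divide_le_eq)
qed

text \<open>Since \<open>L * d z x\<close> plus or minus \<open>f x\<close> is monotone along \<open>below\<close>,
  what the finitely many gaps in \<open>F\<close> miss of \<open>f\<close> is at most \<open>L\<close> times what they miss of the length.\<close>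

lemma lipschitz_has_sum:
  assumes f: "lip_on M d L f" "0 \<le> L" and x: "x \<in> M"
  shows "((\<lambda>e. gap_coord e x * slope f e) has_sum (f x - f z)) gap_tops"
proof (rule has_sum_dominated[OF gap_coord_has_sum[OF x]])
  fix F assume F: "finite F" "F \<subseteq> gap_tops"
  let ?G = "{e \<in> F. below e x}"
  have "(\<Sum>e\<in>?G. (L * d z e + s * f e) - (L * d z (gap_bottom e) + s * f (gap_bottom e)))
      \<le> (L * d z x + s * f x) - (L * d z z + s * f z)" if s: "\<bar>s\<bar> = 1" for s
  proof (rule sum_gaps_le)
    show "below e x \<and> \<not> below e z" if "e \<in> ?G" for e
      using that below_root_eq[of e] gap_bottom_below[of e] below_root_eq[of "gap_bottom e"] gap_length_pos[of e] F(2)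
      by fastforce
    show "L * d z p + s * f p \<le> L * d z q + s * f q" if "below p q" for p q
    proof -
      have "\<bar>f p - f q\<bar> \<le> L * d p q"
        using f(1) that below_mem unfolding lip_on_def by blast
      then have "\<bar>f p - f q\<bar> \<le> L * d z q - L * d z p"
        using below_dist[OF that] by (simp add: right_diff_distrib)
      then show ?thesis
        using s by (auto simp: abs_if split: if_splits)
    qed
  qed (use F below_root[OF x] in auto)
  from this[of 1] this[of "-1"]
  have "\<bar>(f x - f z) - (\<Sum>e\<in>?G. f e - f (gap_bottom e))\<bar>
      \<le> L * d z x - L * (\<Sum>e\<in>?G. d z e - d z (gap_bottom e))"
    using base_point
    by (simp add: sum.distrib sum_subtractf sum_negf right_diff_distrib abs_le_iff sum_distrib_left)
  moreover have "(\<Sum>e\<in>?G. f e - f (gap_bottom e)) = (\<Sum>e\<in>F. gap_coord e x * slope f e)"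
  proof -
    have "(\<Sum>e\<in>?G. f e - f (gap_bottom e)) = (\<Sum>e\<in>F. if below e x then f e - f (gap_bottom e) else 0)"
      using F(1) by (rule sum.inter_filter)
    also have "\<dots> = (\<Sum>e\<in>F. gap_coord e x * slope f e)"
      using F(2) gap_length_pos by (intro sum.cong) (fastforce simp: gap_coord_def slope_def)+
    finally show ?thesis .
  qed
  moreover have "(\<Sum>e\<in>?G. d z e - d z (gap_bottom e)) = (\<Sum>e\<in>F. gap_coord e x)"
    using F(1) by (simp add: gap_coord_def sum.inter_filter)
  ultimately show "\<bar>(f x - f z) - (\<Sum>e\<in>F. gap_coord e x * slope f e)\<bar>
      \<le> L * (d z x - (\<Sum>e\<in>F. gap_coord e x))"
    by (simp add: right_diff_distrib)
qed

end

section \<open>The free space as \<open>\<ell>\<^sub>1\<close> over the gaps\<close>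

lemma (in pointed_metric_space) dual_sum:
  assumes "\<phi> \<in> lip0_dual M d z" "finite F" "\<And>e. e \<in> F \<Longrightarrow> h e \<in> lip0 M d z"
  shows "(\<lambda>x. \<Sum>e\<in>F. c e * h e x) \<in> lip0 M d z \<and>
    \<phi> (\<lambda>x. \<Sum>e\<in>F. c e * h e x) = (\<Sum>e\<in>F. c e * \<phi> (h e))"
  using assms(2,3)
proof (induction F)
  case empty
  then show ?case
    using lip0_zero dual_scale[OF assms(1) lip0_zero, of 0] by simp
next
  case (insert e F)
  then show ?case
    using lip0_add[OF lip0_scale, of "h e" "\<lambda>x. \<Sum>e\<in>F. c e * h e x" "c e"]
      dual_add[OF assms(1) lip0_scale, of "h e" "\<lambda>x. \<Sum>e\<in>F. c e * h e x" "c e"]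
      dual_scale[OF assms(1), of "h e" "c e"] by simp
qed

context rooted_null_space
begin

lemma not_below_root: "e \<in> gap_tops \<Longrightarrow> \<not> below e z"
  using below_root_eq[of e] gap_bottom_below[of e] below_root_eq[of "gap_bottom e"] gap_length_pos[of e]
  by fastforce

lemma gap_coord_lip: "e \<in> gap_tops \<Longrightarrow> lip_on M d 1 (gap_coord e)"
  using sum_gap_coord_le[of "{e}"] by (simp add: lip_on_def)

lemma gap_coord_lip0: "e \<in> gap_tops \<Longrightarrow> gap_coord e \<in> lip0 M d z"
  using gap_coord_lip not_below_root below_mem(2) by (intro lip0I[where L = 1]) (auto simp: gap_coord_def)

text \<open>Coordinates and slopes are biorthogonal: for another gap, \<open>e\<close> lies below
  its top exactly if it lies below its bottom, so the coordinate does not change across it.\<close>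

lemma slope_gap_coord:
  assumes "e \<in> gap_tops" "e' \<in> gap_tops"
  shows "slope (gap_coord e) e' = (if e' = e then 1 else 0)"
proof (cases "e' = e")
  case True
  have "\<not> below e (gap_bottom e)"
    using below_le gap_length_pos[OF assms(1)] by fastforce
  then show ?thesis
    using True below_refl[OF gap_tops_mem(1)[OF assms(1)]] gap_length_pos[OF assms(1)]
    by (simp add: slope_def gap_coord_def)
next
  case False
  then have "below e e' \<longleftrightarrow> below e (gap_bottom e')"
    using below_gap_bottom[OF assms(2)] below_trans[OF _ gap_bottom_below[OF assms(2)]] by blast
  then show ?thesis
    using False by (simp add: slope_def gap_coord_def)
qed

text \<open>The combination of the coordinates with the signs of the values of \<open>\<phi>\<close>
  is 1-Lipschitz by \<open>sum_gap_coord_le\<close> and serves as test function.\<close>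

lemma sum_dual_gap_coord_le:
  assumes \<phi>: "\<phi> \<in> lip0_dual M d z" and F: "finite F" "F \<subseteq> gap_tops"
  shows "(\<Sum>e\<in>F. \<bar>\<phi> (gap_coord e)\<bar>) \<le> lip0_dual_norm M d z \<phi>"
proof -
  let ?h = "\<lambda>x. \<Sum>e\<in>F. sgn (\<phi> (gap_coord e)) * gap_coord e x"
  have h: "?h \<in> lip0 M d z" "\<phi> ?h = (\<Sum>e\<in>F. sgn (\<phi> (gap_coord e)) * \<phi> (gap_coord e))"
    using dual_sum[OF \<phi> F(1), of gap_coord "\<lambda>e. sgn (\<phi> (gap_coord e))"] gap_coord_lip0 F(2) by auto
  have "\<bar>?h x - ?h y\<bar> \<le> 1 * d x y" if "x \<in> M" "y \<in> M" for x y
  proof -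
    have "\<bar>?h x - ?h y\<bar> = \<bar>\<Sum>e\<in>F. sgn (\<phi> (gap_coord e)) * (gap_coord e x - gap_coord e y)\<bar>"
      by (simp add: right_diff_distrib sum_subtractf)
    also have "\<dots> \<le> (\<Sum>e\<in>F. \<bar>gap_coord e x - gap_coord e y\<bar>)"
      by (rule order_trans[OF sum_abs]) (auto simp: abs_mult sgn_if intro!: sum_mono)
    finally show ?thesis
      using sum_gap_coord_le[OF F that] by simp
  qed
  then have "lip_on M d 1 ?h"
    by (simp add: lip_on_def)
  then have "\<bar>\<phi> ?h\<bar> \<le> lip0_dual_norm M d z \<phi>"
    using dual_bound[OF \<phi> h(1)] by fastforce
  moreover have "\<phi> ?h = (\<Sum>e\<in>F. \<bar>\<phi> (gap_coord e)\<bar>)"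
    unfolding h(2) by (intro sum.cong) (auto simp: sgn_if)
  ultimately show ?thesis
    by linarith
qed

lemma dual_gap_coord_has_sum:
  assumes \<phi>: "\<phi> \<in> lip0_dual M d z"
  obtains S where "((\<lambda>e. \<bar>\<phi> (gap_coord e)\<bar>) has_sum S) gap_tops" "S \<le> lip0_dual_norm M d z \<phi>"
proof -
  have "bdd_above (sum (\<lambda>e. \<bar>\<phi> (gap_coord e)\<bar>) ` {F. F \<subseteq> gap_tops \<and> finite F})"
    using sum_dual_gap_coord_le[OF \<phi>] by (intro bdd_aboveI[of _ "lip0_dual_norm M d z \<phi>"]) auto
  then have "(\<lambda>e. \<bar>\<phi> (gap_coord e)\<bar>) summable_on gap_tops"
    by (intro nonneg_bdd_above_summable_on) auto
  then obtain S where "((\<lambda>e. \<bar>\<phi> (gap_coord e)\<bar>) has_sum S) gap_tops"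
    by (auto simp: summable_on_def)
  then show ?thesis
    using that has_sum_le_finite_sums sum_dual_gap_coord_le[OF \<phi>] by metis
qed

text \<open>A finite combination of evaluations can be expanded over the gaps term by term, and the
  slopes of the test function are at most 1 in absolute value.\<close>

lemma span_norm_le:
  assumes \<psi>: "\<psi> \<in> delta_span M d z" and S: "((\<lambda>e. \<bar>\<psi> (gap_coord e)\<bar>) has_sum S) gap_tops"
  shows "lip0_dual_norm M d z \<psi> \<le> S"
proof (rule dual_norm_le)
  fix f assume f: "f \<in> lip0 M d z" "lip_on M d 1 f"
  obtain A c where A: "\<psi> = (\<lambda>f. \<Sum>x\<in>A. c x * lip_delta M d z x f)" "finite A" "A \<subseteq> M"
    using \<psi> unfolding delta_span_def by blast
  have eval: "\<psi> h = (\<Sum>x\<in>A. c x * h x)" if "h \<in> lip0 M d z" for h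
    unfolding A(1) using lip_delta_apply[OF that] by simp
  have "\<psi> f = (\<Sum>x\<in>A. c x * (f x - f z))"
    using eval[OF f(1)] lip0_base[OF f(1)] by simp
  then have "((\<lambda>e. \<Sum>x\<in>A. c x * (gap_coord e x * slope f e)) has_sum \<psi> f) gap_tops"
    using A(2,3) by (simp only:) (intro has_sum_finite_sum has_sum_cmult_right lipschitz_has_sum[OF f(2)]; auto)
  moreover have "(\<Sum>x\<in>A. c x * (gap_coord e x * slope f e)) = \<psi> (gap_coord e) * slope f e" if "e \<in> gap_tops" for e
    unfolding eval[OF gap_coord_lip0[OF that]] by (simp add: sum_distrib_right mult.assoc)
  ultimately have sum: "((\<lambda>e. \<psi> (gap_coord e) * slope f e) has_sum \<psi> f) gap_tops"
    by (simp cong: has_sum_cong)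
  have "\<bar>\<psi> (gap_coord e) * slope f e\<bar> \<le> \<bar>\<psi> (gap_coord e)\<bar>" if "e \<in> gap_tops" for e
    using mult_left_mono[OF slope_bound[OF f(2) that] abs_ge_zero[of "\<psi> (gap_coord e)"]] by (simp add: abs_mult)
  then show "\<bar>\<psi> f\<bar> \<le> S"
    using has_sum_mono[OF sum S] has_sum_mono[OF has_sum_uminusI[OF sum] S] by (simp add: abs_le_iff)
qed

text \<open>The sum of the absolute coefficients is dominated by the dual norm everywhere, hence
  continuous, so the equality on the span passes to the closure.\<close>

lemma free_norm_has_sum:
  assumes \<phi>: "\<phi> \<in> lip_free M d z"
  shows "((\<lambda>e. \<bar>\<phi> (gap_coord e)\<bar>) has_sum lip0_dual_norm M d z \<phi>) gap_tops"
proof -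
  let ?n = "lip0_dual_norm M d z"
  obtain S where S: "((\<lambda>e. \<bar>\<phi> (gap_coord e)\<bar>) has_sum S) gap_tops" "S \<le> ?n \<phi>"
    using dual_gap_coord_has_sum[OF free_dual[OF \<phi>]] by blast
  have "?n \<phi> \<le> S"
  proof (rule field_le_epsilon)
    fix \<epsilon> :: real assume "0 < \<epsilon>"
    then have "0 < \<epsilon> / 2"
      by simp
    then obtain \<psi> where \<psi>: "\<psi> \<in> delta_span M d z" "?n (\<lambda>f. \<phi> f - \<psi> f) < \<epsilon> / 2"
      using \<phi> unfolding lip_free_def by blast
    note \<psi>X = delta_span_free[OF \<psi>(1)]
    note diff = free_dual[OF free_diff[OF \<phi> \<psi>X]]
    obtain D where D: "((\<lambda>e. \<bar>\<phi> (gap_coord e) - \<psi> (gap_coord e)\<bar>) has_sum D) gap_tops"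
      "D \<le> ?n (\<lambda>f. \<phi> f - \<psi> f)"
      using dual_gap_coord_has_sum[OF diff] by blast
    obtain R where R: "((\<lambda>e. \<bar>\<psi> (gap_coord e)\<bar>) has_sum R) gap_tops"
      using dual_gap_coord_has_sum[OF free_dual[OF \<psi>X]] by blast
    have "R \<le> S + D"
      by (rule has_sum_mono[OF R has_sum_add[OF S(1) D(1)]]) auto
    moreover have "?n \<phi> \<le> ?n (\<lambda>f. \<phi> f - \<psi> f) + ?n \<psi>"
      using dual_norm_lincomb[OF diff free_dual[OF \<psi>X], of 1 1] by simp
    ultimately show "?n \<phi> \<le> S + \<epsilon>"
      using span_norm_le[OF \<psi>(1) R] D(2) \<psi>(2) by linarith
  qed
  then show ?thesis
    using S by simp
qed

section \<open>Functionals with prescribed coefficients on the gaps\<close>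

definition gap_functional :: "('a \<Rightarrow> real) \<Rightarrow> ('a \<Rightarrow> real) \<Rightarrow> real" where
  "gap_functional w = (\<lambda>f. if f \<in> lip0 M d z then \<Sum>\<^sub>\<infinity>e\<in>gap_tops. w e * slope f e else 0)"

lemma gap_functional_has_sum:
  assumes w: "((\<lambda>e. \<bar>w e\<bar>) has_sum S) gap_tops" and f: "f \<in> lip0 M d z" "lip_on M d L f"
  shows "((\<lambda>e. w e * slope f e) has_sum gap_functional w f) gap_tops" "\<bar>gap_functional w f\<bar> \<le> S * L"
proof -
  have le: "\<bar>w e * slope f e\<bar> \<le> \<bar>w e\<bar> * L" if "e \<in> gap_tops" for e
    using mult_left_mono[OF slope_bound[OF f(2) that] abs_ge_zero[of "w e"]] by (simp add: abs_mult)
  have SL: "((\<lambda>e. \<bar>w e\<bar> * L) has_sum S * L) gap_tops"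
    by (rule has_sum_cmult_left[OF w])
  have "(\<lambda>e. norm (w e * slope f e)) summable_on gap_tops"
    using le by (intro Infinite_Sum.abs_summable_on_comparison_test'[OF has_sum_imp_summable[OF SL]]) simp
  then have "(\<lambda>e. w e * slope f e) summable_on gap_tops"
    by (rule Infinite_Sum.abs_summable_summable)
  then show sum: "((\<lambda>e. w e * slope f e) has_sum gap_functional w f) gap_tops"
    using f(1) by (simp add: gap_functional_def)
  show "\<bar>gap_functional w f\<bar> \<le> S * L"
    using has_sum_mono[OF sum SL] has_sum_mono[OF has_sum_uminusI[OF sum] SL] le
    by (simp add: abs_le_iff)
qed

lemma slope_add: "slope (\<lambda>x. f x + g x) e = slope f e + slope g e"
  by (simp add: slope_def add_divide_distrib diff_divide_distrib)

lemma slope_scale: "slope (\<lambda>x. c * f x) e = c * slope f e"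
  by (simp add: slope_def flip: right_diff_distrib)

lemma gap_functional_dual:
  assumes w: "((\<lambda>e. \<bar>w e\<bar>) has_sum S) gap_tops"
  shows "gap_functional w \<in> lip0_dual M d z"
proof (rule dualI)
  fix f g assume f: "f \<in> lip0 M d z" and g: "g \<in> lip0 M d z"
  have "((\<lambda>e. w e * slope f e + w e * slope g e) has_sum gap_functional w f + gap_functional w g) gap_tops"
    using gap_functional_has_sum(1)[OF w f lip0_lip_on[OF f]] gap_functional_has_sum(1)[OF w g lip0_lip_on[OF g]]
    by (rule has_sum_add)
  then show "gap_functional w (\<lambda>x. f x + g x) = gap_functional w f + gap_functional w g"
    using gap_functional_has_sum(1)[OF w lip0_add[OF f g] lip0_lip_on[OF lip0_add[OF f g]]] has_sum_unique
    by (simp add: slope_add distrib_left) blast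
next
  fix c f assume f: "f \<in> lip0 M d z"
  have "((\<lambda>e. c * (w e * slope f e)) has_sum c * gap_functional w f) gap_tops"
    by (rule has_sum_cmult_right[OF gap_functional_has_sum(1)[OF w f lip0_lip_on[OF f]]])
  then show "gap_functional w (\<lambda>x. c * f x) = c * gap_functional w f"
    using gap_functional_has_sum(1)[OF w lip0_scale[OF f] lip0_lip_on[OF lip0_scale[OF f]]] has_sum_unique
    by (simp add: slope_scale mult.left_commute) blast
next
  fix f L assume "f \<in> lip0 M d z" "lip_on M d L f"
  then show "\<bar>gap_functional w f\<bar> \<le> S * L"
    by (rule gap_functional_has_sum(2)[OF w])
qed (simp add: gap_functional_def)

lemma gap_functional_free:
  assumes w: "((\<lambda>e. \<bar>w e\<bar>) has_sum S) gap_tops"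
  shows "gap_functional w \<in> lip_free M d z"
proof -
  have "\<exists>\<psi>\<in>delta_span M d z. lip0_dual_norm M d z (\<lambda>f. gap_functional w f - \<psi> f) < \<epsilon>" if "0 < \<epsilon>" for \<epsilon>
  proof -
    obtain F where F: "finite F" "F \<subseteq> gap_tops" "dist (\<Sum>e\<in>F. \<bar>w e\<bar>) S \<le> \<epsilon> / 2"
      using has_sum_finite_approximation[OF w, of "\<epsilon> / 2"] \<open>0 < \<epsilon>\<close> by auto
    define len where "len = (\<lambda>e. d z e - d z (gap_bottom e))"
    \<comment> \<open>The difference of the evaluations at top and bottom divided by
      \<open>len e\<close> returns the slope on gap \<open>e\<close>; these quotients play the part
      of the unit vectors.\<close>
    define \<psi> where "\<psi> = (\<lambda>f. \<Sum>e\<in>F. w e / len e * (lip_delta M d z e f - lip_delta M d z (gap_bottom e) f))"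
    have "\<psi> \<in> delta_span M d z"
      unfolding \<psi>_def using F(1,2)
    proof (induction F)
      case empty
      then show ?case
        using delta_span_lincomb[OF lip_delta_span[OF base_point] lip_delta_span[OF base_point], of 0 0] by simp
    next
      case (insert e F)
      then have "(\<lambda>f. lip_delta M d z e f - lip_delta M d z (gap_bottom e) f) \<in> delta_span M d z"
        using delta_span_lincomb[OF lip_delta_span lip_delta_span, of e "gap_bottom e" 1 "-1"] gap_tops_mem by simp
      then show ?case
        using insert delta_span_lincomb[of "\<lambda>f. lip_delta M d z e f - lip_delta M d z (gap_bottom e) f" _ "w e / len e" 1]
        by simp
    qed
    moreover have "lip0_dual_norm M d z (\<lambda>f. gap_functional w f - \<psi> f) \<le> \<epsilon> / 2"
    proof (rule dual_norm_le)
      fix f assume f: "f \<in> lip0 M d z" "lip_on M d 1 f"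
      have \<psi>f: "\<psi> f = (\<Sum>e\<in>F. w e * slope f e)"
        unfolding \<psi>_def lip_delta_apply[OF f(1)] slope_def len_def by (intro sum.cong) auto
      have rest: "((\<lambda>e. w e * slope f e) has_sum gap_functional w f - \<psi> f) (gap_tops - F)"
        unfolding \<psi>f by (intro has_sum_Diff gap_functional_has_sum[OF w f] has_sum_finite F)
      have wrest: "((\<lambda>e. \<bar>w e\<bar>) has_sum S - (\<Sum>e\<in>F. \<bar>w e\<bar>)) (gap_tops - F)"
        by (intro has_sum_Diff w has_sum_finite F)
      have le: "\<bar>w e * slope f e\<bar> \<le> \<bar>w e\<bar>" if "e \<in> gap_tops" for e
        using mult_left_mono[OF slope_bound[OF f(2) that] abs_ge_zero[of "w e"]] by (simp add: abs_mult)
      have "\<bar>gap_functional w f - \<psi> f\<bar> \<le> S - (\<Sum>e\<in>F. \<bar>w e\<bar>)"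
        using has_sum_mono[OF rest wrest] has_sum_mono[OF has_sum_uminusI[OF rest] wrest] le
        by (simp add: abs_le_iff)
      then show "\<bar>gap_functional w f - \<psi> f\<bar> \<le> \<epsilon> / 2"
        using F(3) unfolding dist_real_def by linarith
    qed
    ultimately show ?thesis
      using that by force
  qed
  then show ?thesis
    using gap_functional_dual[OF w] by (simp add: lip_free_def)
qed

lemma gap_functional_coord:
  assumes w: "((\<lambda>e. \<bar>w e\<bar>) has_sum S) gap_tops" and e: "e \<in> gap_tops"
  shows "gap_functional w (gap_coord e) = w e"
proof -
  have "((\<lambda>e'. w e' * slope (gap_coord e) e') has_sum w e) gap_tops"
    using e slope_gap_coord by (intro has_sum_finite_neutralI[of "{e}"]) auto
  then show ?thesis
    using gap_functional_has_sum(1)[OF w gap_coord_lip0[OF e] gap_coord_lip[OF e]] has_sum_unique by blast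
qed

lemma free_isometric_ell1:
  "linearly_isometric (lip_free M d z) (lip0_dual_norm M d z) (ell1 gap_tops) (ell1_norm gap_tops)"
proof -
  define V where "V = (\<lambda>\<phi> e. if e \<in> gap_tops then \<phi> (gap_coord e) else (0::real))"
  have V: "V \<phi> \<in> ell1 gap_tops" "ell1_norm gap_tops (V \<phi>) = lip0_dual_norm M d z \<phi>" if "\<phi> \<in> lip_free M d z" for \<phi>
  proof -
    have "((\<lambda>e. \<bar>V \<phi> e\<bar>) has_sum lip0_dual_norm M d z \<phi>) gap_tops"
      using free_norm_has_sum[OF that] by (simp add: V_def cong: has_sum_cong)
    then show "V \<phi> \<in> ell1 gap_tops" "ell1_norm gap_tops (V \<phi>) = lip0_dual_norm M d z \<phi>"
      by (auto simp: ell1_def ell1_norm_def V_def summable_on_def intro!: infsumI)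
  qed
  have "inj_on V (lip_free M d z)"
  proof (rule inj_onI)
    fix \<phi> \<psi> assume \<phi>: "\<phi> \<in> lip_free M d z" and \<psi>: "\<psi> \<in> lip_free M d z" and eq: "V \<phi> = V \<psi>"
    have "\<phi> (gap_coord e) = \<psi> (gap_coord e)" if "e \<in> gap_tops" for e
      using fun_cong[OF eq, of e] that by (simp add: V_def)
    then have "((\<lambda>e. 0) has_sum lip0_dual_norm M d z (\<lambda>f. \<phi> f - \<psi> f)) gap_tops"
      using free_norm_has_sum[OF free_diff[OF \<phi> \<psi>]] by (simp cong: has_sum_cong)
    then have "lip0_dual_norm M d z (\<lambda>f. \<phi> f - \<psi> f) = 0"
      using has_sum_unique has_sum_0_simp by blast
    then have "\<phi> f = \<psi> f" if "f \<in> lip0 M d z" for f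
      using dual_bound[OF free_dual[OF free_diff[OF \<phi> \<psi>]] that lip0_lip_on[OF that] lip_norm_nonneg[OF lip0_lip_on[OF that]]]
      by simp
    moreover have "\<phi> f = \<psi> f" if "f \<notin> lip0 M d z" for f
      using free_dual[OF \<phi>] free_dual[OF \<psi>] that by (simp add: lip0_dual_def)
    ultimately show "\<phi> = \<psi>"
      by blast
  qed
  moreover have "w \<in> V ` lip_free M d z" if w: "w \<in> ell1 gap_tops" for w
  proof -
    obtain S where S: "((\<lambda>e. \<bar>w e\<bar>) has_sum S) gap_tops"
      using w by (auto simp: ell1_def summable_on_def)
    have "V (gap_functional w) = w"
      using w gap_functional_coord[OF S] by (auto simp: V_def ell1_def)
    then show ?thesis
      using gap_functional_free[OF S] by (metis image_eqI)
  qed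
  ultimately have "bij_betw V (lip_free M d z) (ell1 gap_tops)"
    using V(1) by (auto simp: bij_betw_def)
  then show ?thesis
    unfolding linearly_isometric_def using V(2) by (intro exI[of _ V]) (auto simp: V_def)
qed

end

section \<open>The characterization\<close>

lemma negligible_subset_rooted_null_space:
  assumes M: "Metric_space M d" "Metric_space.mcomplete M d" "z \<in> M"
    and sub: "negligible_subset_with_branching M d T dT"
  shows "rooted_null_space M d z"
proof -
  interpret Metric_space M d by fact
  obtain f where tree: "real_tree T dT" and fM: "f ` M \<subseteq> T"
    and iso: "\<And>x y. x \<in> M \<Longrightarrow> y \<in> M \<Longrightarrow> dT (f x) (f y) = d x y"
    and neg: "negligible_in_tree T dT (f ` M)" and branch: "branching_points T dT \<subseteq> f ` M"
    using sub unfolding negligible_subset_with_branching_def by blast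
  interpret T: four_point_space T dT
    by (rule real_tree_four_point) fact
  have mem: "f x \<in> T" if "x \<in> M" for x
    using fM that by blast
  show ?thesis
  proof
    show "d p q + d r s \<le> max (d p r + d q s) (d q r + d p s)"
      if "p \<in> M" "q \<in> M" "r \<in> M" "s \<in> M" for p q r s
      using T.four_point[OF mem mem mem mem, of p q r s] iso that by simp
    show "\<exists>b\<in>M. d x b + d b y = d x y \<and> d z b + d b x = d z x \<and> d z b + d b y = d z y"
      if x: "x \<in> M" and y: "y \<in> M" for x y
    proof -
      obtain b where b: "b \<in> T" "dT (f x) b + dT b (f y) = dT (f x) (f y)"
        "dT (f x) b + dT b (f z) = dT (f x) (f z)" "dT (f y) b + dT b (f z) = dT (f y) (f z)"
        using real_tree_median[OF tree mem[OF x] mem[OF y] mem[OF M(3)]] by metis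
      have "b \<in> f ` M"
      \<comment> \<open>A median different from the three points has three nontrivial arms, hence is
        a branching point.\<close>
      proof (cases "b = f x \<or> b = f y \<or> b = f z")
        case False
        then have "b \<in> branching_points T dT"
          using branching_point_of_median[OF tree b(1) mem[OF x] mem[OF y] mem[OF M(3)] _ _ _ b(2-4)] by blast
        then show ?thesis
          using branch by blast
      qed (use x y M(3) in blast)
      then obtain v where "v \<in> M" "b = f v"
        by blast
      then show ?thesis
        using b(2-4) iso x y M(3) commute[of x v] commute[of y v] commute[of z v] commute[of x z] commute[of y z]
        by (intro bexI[of _ v]) auto
    qed
    show "negligible {d z w | w. w \<in> M \<and> d z w + d w x = d z x}" if x: "x \<in> M" for x
    proof -
      let ?H = "tree_hull T dT (f ` M)"
      let ?K = "segment_trace ?H dT (f z) (f x) (f ` M)"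
      have "f v \<in> ?H" if "v \<in> M" for v
      proof -
        have "f v \<in> segment T dT (f v) (f v)"
          using segment_iff[OF tree mem mem] mem that by simp
        then show ?thesis
          using that unfolding tree_hull_def by blast
      qed
      then have hull: "f z \<in> ?H" "f x \<in> ?H"
        using x M(3) by auto
      \<comment> \<open>Since \<open>emeasure\<close> vanishes on non-measurable sets, measure 0
        alone would not give negligibility.\<close>
      then have sets: "?K \<in> sets lebesgue"
        using neg unfolding negligible_in_tree_def tree_measurable_def by blast
      \<comment> \<open>A single segment is an admissible disjoint family in the supremum.\<close>
      have "(\<Sum>(p, q)\<in>{(f z, f x)}. emeasure lebesgue (segment_trace ?H dT p q (f ` M)))
          \<le> tree_measure ?H dT (f ` M)"
        unfolding tree_measure_def
        using hull by (intro SUP_upper) (auto simp: disjoint_family_on_def)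
      then have "emeasure lebesgue ?K = 0"
        using neg by (simp add: negligible_in_tree_def)
      then have "negligible ?K"
        using sets negligible_iff_emeasure0 by blast
      moreover have "{d z w | w. w \<in> M \<and> d z w + d w x = d z x} \<subseteq> ?K"
      proof
        fix t assume "t \<in> {d z w | w. w \<in> M \<and> d z w + d w x = d z x}"
        then obtain w where w: "t = d z w" "w \<in> M" "d z w + d w x = d z x"
          by blast
        have "geodesic T dT (f z) (f x) (dT (f z) (f w)) = f w"
          using w iso x M(3) by (intro geodesic_eq_between[OF tree] mem) auto
        then have "geodesic ?H dT (f z) (f x) t = f w"
          using geodesic_tree_hull[OF tree fM, of "f z" "f x"] x M(3) w iso by simp
        moreover have "t \<in> {0..dT (f z) (f x)}"
          unfolding atLeastAtMost_iff using w iso[OF M(3) x] nonneg[of z w] nonneg[of w x] by linarith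
        ultimately show "t \<in> ?K"
          using w(2) by (auto simp: segment_trace_def)
      qed
      ultimately show ?thesis
        using negligible_subset by blast
    qed
  qed (use M in auto)
qed

text \<open>A dense set of the size of one index set receives an injection of the other by
  minimality.\<close>

lemma same_density_eqpoll:
  fixes A :: "'x set" and B :: "'y set"
  assumes "if finite M then finite A \<and> card M = Suc (card A) else has_density M d A"
    and "if finite M then finite B \<and> card M = Suc (card B) else has_density M d B"
  shows "A \<approx> B"
proof (cases "finite M")
  case True
  then show ?thesis
    using assms by (simp add: eqpoll_iff_card)
next
  case False
  then obtain S T where S: "S \<subseteq> M" "Metric_space.mtopology M d closure_of S = M" "S \<approx> A"
    and T: "T \<subseteq> M" "Metric_space.mtopology M d closure_of T = M" "T \<approx> B"
    using assms unfolding has_density_def by metis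
  then have "A \<lesssim> T" "B \<lesssim> S"
    using False assms unfolding has_density_def by metis+
  then show ?thesis
    using lepoll_antisym[OF lepoll_trans2[OF _ T(3)] lepoll_trans2[OF _ S(3)]] by blast
qed

text \<open>The forward direction delivers a tree of real functions on the type of \<open>M\<close>;
  the second conjunct admits trees carried by an arbitrary type \<open>'t\<close>.\<close>

theorem theorem5:
  fixes M :: "'a set" and d :: "'a \<Rightarrow> 'a \<Rightarrow> real" and z :: 'a and \<Gamma> :: "'g set"
  assumes "Metric_space M d"
    and "Metric_space.mcomplete M d"
    and "z \<in> M"
  shows
    "(linearly_isometric (lip_free M d z) (lip0_dual_norm M d z) (ell1 \<Gamma>) (ell1_norm \<Gamma>) \<longleftrightarrow>
        (if finite M then finite \<Gamma> \<and> card M = Suc (card \<Gamma>) else has_density M d \<Gamma>) \<and>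
        (\<exists>(T :: ('a \<Rightarrow> real) set) dT. negligible_subset_with_branching M d T dT)) \<and>
     ((if finite M then finite \<Gamma> \<and> card M = Suc (card \<Gamma>) else has_density M d \<Gamma>) \<and>
        (\<exists>(T :: 't set) dT. negligible_subset_with_branching M d T dT) \<longrightarrow>
      linearly_isometric (lip_free M d z) (lip0_dual_norm M d z) (ell1 \<Gamma>) (ell1_norm \<Gamma>))"
proof -
  let ?iso = "linearly_isometric (lip_free M d z) (lip0_dual_norm M d z) (ell1 \<Gamma>) (ell1_norm \<Gamma>)"
  let ?density = "if finite M then finite \<Gamma> \<and> card M = Suc (card \<Gamma>) else has_density M d \<Gamma>"
  interpret pointed_metric_space M d z
    using assms by (simp add: pointed_metric_space_def pointed_metric_space_axioms_def)
  have forward: "?density \<and> (\<exists>(T :: ('a \<Rightarrow> real) set) dT. negligible_subset_with_branching M d T dT)"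
    if iso: ?iso
  proof -
    obtain u coef where "ell1_rep M d \<Gamma> u coef"
      using isometry_ell1_rep[OF iso] by blast
    then show ?thesis
      using ell1_rep.density ell1_rep.tree_embedding assms(2) by blast
  qed
  have backward: ?iso if "rooted_null_space M d z" ?density
  proof -
    interpret R: rooted_null_space M d z
      by fact
    \<comment> \<open>Feeding the isometry over the gaps back into the forward construction makes
      the density result available for \<open>R.gap_tops\<close>.\<close>
    obtain u coef where "ell1_rep M d R.gap_tops u coef"
      using isometry_ell1_rep[OF R.free_isometric_ell1] by blast
    then have "R.gap_tops \<approx> \<Gamma>"
      using same_density_eqpoll[OF ell1_rep.density that(2)] by blast
    then show ?thesis
      using linearly_isometric_ell1_eqpoll[OF R.free_isometric_ell1] by blast
  qed
  note root = negligible_subset_rooted_null_space[OF assms]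
  show ?thesis
  proof (intro conjI impI)
    show "?iso \<longleftrightarrow> ?density \<and> (\<exists>(T :: ('a \<Rightarrow> real) set) dT. negligible_subset_with_branching M d T dT)"
      by (rule iffI, erule forward, elim conjE exE, rule backward[OF root])
    assume "?density \<and> (\<exists>(T :: 't set) dT. negligible_subset_with_branching M d T dT)"
    then show ?iso
      by (elim conjE exE) (rule backward[OF root])
  qed
qed

end
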